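(* For a real plane algebraic curve $C$ (in the affine plane $\mathbb{A}^2=\mathbb{C}^2$), the following are equivalent: (1) $C$ is trigonometric; (2) there exist polynomials $P(\varphi),Q(\varphi)\in\mathbb{C}[\varphi]$ such that the map $\mathbb{C}^*\to\mathbb{A}^2$ given by $$\varphi\longmapsto\bigl(P(\varphi)+\overline P(\varphi^{-1}),\ Q(\varphi)+\overline Q(\varphi^{-1})\bigr)$$ is a birational parametrization of $C$; (3) $C$ is rational, with two complex conjugate local branches at infinity (and no other local branches at infinity), and with an infinite real point set.
   Context: A real plane algebraic curve is one defined by a polynomial with real coefficients. $\overline P$ denotes the polynomial obtained from $P$ by complex conjugation of the coefficients. Local branches at infinity are the local branches of the projective closure of $C$ in $\mathbb{P}^2$ centered at points of the line at infinity $L^\infty=\mathbb{P}^2\setminus\mathbb{A}^2$ (the two branches may be centered at the same real point). Trigonometric curve: a real algebraic curve $C$ in $\mathbb{A}^2$ for which there exist real trigonometric polynomials $X(t),Y(t)$ (finite real linear combinations of $\sin(kt),\cos(kt)$, $k\in\mathbb{Z}_{\ge0}$) such that $t\mapsto(X(t),Y(t))$, generically one-to-one on $[0,2\pi)$, parametrizes the real point set of $C$, meaning that $C$ is the complex Zariski closure of the image (so the image is the real point set up to finitely many points). *)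

theory Defs
  imports Complex_Main "HOL-Computational_Algebra.Computational_Algebra"
begin

section \<open>Plane algebraic curves\<close>

text \<open>
  A bivariate polynomial \<open>F(x, y)\<close> is an element of \<open>'a poly poly\<close>, with \<open>y\<close> the outer
  variable: the coefficient of \<open>x\<^sup>i y\<^sup>j\<close> is \<open>coeff (coeff F j) i\<close>.
\<close>

definition eval2 :: "'a::comm_ring_1 poly poly \<Rightarrow> 'a \<times> 'a \<Rightarrow> 'a" where
  "eval2 F p = poly (poly F [:snd p:]) (fst p)"

definition real_plane_curve :: "(complex \<times> complex) set \<Rightarrow> bool" where
  "real_plane_curve C \<longleftrightarrow>
     (\<exists>F :: real poly poly. (\<forall>c. F \<noteq> [:[:c:]:]) \<and>
        C = {p. eval2 (map_poly (map_poly complex_of_real) F) p = 0})"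

definition real_points :: "(complex \<times> complex) set \<Rightarrow> (complex \<times> complex) set" where
  "real_points C = {p \<in> C. fst p \<in> \<real> \<and> snd p \<in> \<real>}"

definition zariski_closure :: "(complex \<times> complex) set \<Rightarrow> (complex \<times> complex) set" where
  "zariski_closure S =
     {p. \<forall>F :: complex poly poly. (\<forall>q\<in>S. eval2 F q = 0) \<longrightarrow> eval2 F p = 0}"


section \<open>Trigonometric curves\<close>

definition trig_poly :: "(real \<Rightarrow> real) \<Rightarrow> bool" where
  "trig_poly X \<longleftrightarrow>
     (\<exists>n (a :: nat \<Rightarrow> real) b. \<forall>t. X t = (\<Sum>k\<le>n. a k * cos (real k * t) + b k * sin (real k * t)))"

text \<open>
  Generically one-to-one: only finitely many parameters in the period share their image
  with another parameter.
\<close>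

definition trigonometric :: "(complex \<times> complex) set \<Rightarrow> bool" where
  "trigonometric C \<longleftrightarrow> real_plane_curve C \<and>
     (\<exists>X Y. trig_poly X \<and> trig_poly Y \<and>
        finite {t \<in> {0..<2*pi}. \<exists>s\<in>{0..<2*pi}. s \<noteq> t \<and> X s = X t \<and> Y s = Y t} \<and>
        C = zariski_closure ((\<lambda>t. (complex_of_real (X t), complex_of_real (Y t))) ` {0..<2*pi}))"


section \<open>Birational parametrizations and rational curves\<close>

definition regular_on :: "complex set \<Rightarrow> (complex \<Rightarrow> complex \<times> complex) \<Rightarrow> bool" where
  "regular_on U f \<longleftrightarrow>
     (\<exists>A1 B1 A2 B2 :: complex poly. \<forall>t\<in>U. poly B1 t \<noteq> 0 \<and> poly B2 t \<noteq> 0 \<and>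
        f t = (poly A1 t / poly B1 t, poly A2 t / poly B2 t))"

text \<open>
  \<open>f\<close> is a morphism from the nonempty open subset \<open>U\<close> of the affine line to the curve \<open>C\<close>, and
  some rational function \<open>N/D\<close> on \<open>C\<close> is inverse to it, on both sides, off finite sets of points.
  On a curve, finite exceptional sets amount to dense open domains.
\<close>

definition birational_parametrization ::
    "complex set \<Rightarrow> (complex \<Rightarrow> complex \<times> complex) \<Rightarrow> (complex \<times> complex) set \<Rightarrow> bool" where
  "birational_parametrization U f C \<longleftrightarrow>
     finite (- U) \<and> regular_on U f \<and> f ` U \<subseteq> C \<and>
     (\<exists>N D :: complex poly poly.
        finite {t \<in> U. \<not> (eval2 D (f t) \<noteq> 0 \<and> eval2 N (f t) / eval2 D (f t) = t)} \<and>
        finite {p \<in> C. \<not> (eval2 D p \<noteq> 0 \<and> eval2 N p / eval2 D p \<in> U \<and>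
                           f (eval2 N p / eval2 D p) = p)})"

text \<open>Rational: birational to the projective line.\<close>

definition rational_curve :: "(complex \<times> complex) set \<Rightarrow> bool" where
  "rational_curve C \<longleftrightarrow> (\<exists>U f. birational_parametrization U f C)"


section \<open>Local branches at infinity\<close>

text \<open>
  The value at \<open>(x, y, z)\<close> of the form of degree \<open>d\<close> whose coefficient at
  \<open>x\<^sup>i y\<^sup>j z\<^sup>d\<^sup>-\<^sup>i\<^sup>-\<^sup>j\<close> is \<open>g i j\<close>; the embedding \<open>e\<close> of the scalars is the identity for points
  and \<open>fps_const\<close> for formal arcs.
\<close>

definition form_eval ::
    "(complex \<Rightarrow> 'a::comm_ring_1) \<Rightarrow> nat \<Rightarrow> (nat \<Rightarrow> nat \<Rightarrow> complex) \<Rightarrow> 'a \<times> 'a \<times> 'a \<Rightarrow> 'a" where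
  "form_eval e d g = (\<lambda>(x, y, z). \<Sum>i\<le>d. \<Sum>j\<le>d - i. e (g i j) * x ^ i * y ^ j * z ^ (d - i - j))"

type_synonym arc = "complex fps \<times> complex fps \<times> complex fps"

text \<open>
  An arc \<open>(a, b, c)\<close> in homogeneous coordinates has a centre
  \<open>(a(0) : b(0) : c(0))\<close> in the projective plane provided this is not \<open>(0, 0, 0)\<close>.
\<close>

definition centred :: "arc \<Rightarrow> bool" where
  "centred = (\<lambda>(a, b, c). (fps_nth a 0, fps_nth b 0, fps_nth c 0) \<noteq> (0, 0, 0))"

definition centred_at_infinity :: "arc \<Rightarrow> bool" where
  "centred_at_infinity = (\<lambda>(a, b, c). centred (a, b, c) \<and> fps_nth c 0 = 0)"

text \<open>
  The projective closure of \<open>C\<close> is the zero set of all forms that vanish on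
  \<open>{(x : y : 1) | (x, y) \<in> C}\<close>.
\<close>

definition arc_on_projective_closure :: "(complex \<times> complex) set \<Rightarrow> arc \<Rightarrow> bool" where
  "arc_on_projective_closure C p \<longleftrightarrow>
     (\<forall>d g. (\<forall>(x, y)\<in>C. form_eval (\<lambda>c. c) d g (x, y, 1) = 0) \<longrightarrow> form_eval fps_const d g p = 0)"

definition arc_transform :: "complex fps \<Rightarrow> complex fps \<Rightarrow> arc \<Rightarrow> arc" where
  "arc_transform u \<tau> = (\<lambda>(a, b, c).
     (u * fps_compose a \<tau>, u * fps_compose b \<tau>, u * fps_compose c \<tau>))"

text \<open>
  A primitive arc does not factor through a substitution of order at least two. The case
  \<open>\<tau> = 0\<close> excludes arcs that are constant in the projective plane.
\<close>

definition primitive_arc :: "arc \<Rightarrow> bool" where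
  "primitive_arc p \<longleftrightarrow>
     \<not> (\<exists>q u \<tau>. fps_nth u 0 \<noteq> 0 \<and> fps_nth \<tau> 0 = 0 \<and> fps_nth \<tau> 1 = 0 \<and> p = arc_transform u \<tau> q)"

definition arc_equiv :: "(arc \<times> arc) set" where
  "arc_equiv = {(p, q). \<exists>u \<tau>. fps_nth u 0 \<noteq> 0 \<and> fps_nth \<tau> 0 = 0 \<and> fps_nth \<tau> 1 \<noteq> 0 \<and>
                              q = arc_transform u \<tau> p}"

text \<open>
  Local branches are places: primitive arcs up to rescaling of the homogeneous coordinates
  by a unit and change of the parameter.
\<close>

definition branches_at_infinity :: "(complex \<times> complex) set \<Rightarrow> arc set set" where
  "branches_at_infinity C =
     {p. centred_at_infinity p \<and> primitive_arc p \<and> arc_on_projective_closure C p} // arc_equiv"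

definition fps_cnj :: "complex fps \<Rightarrow> complex fps" where
  "fps_cnj a = Abs_fps (\<lambda>n. cnj (fps_nth a n))"

definition conj_branch :: "arc set \<Rightarrow> arc set" where
  "conj_branch B = (\<lambda>(a, b, c). (fps_cnj a, fps_cnj b, fps_cnj c)) ` B"

end

(* A parametrization inverted generically by a rational function N/D turns every arc of the curve
   into a Laurent series, the value of N/D on the arc. Hence the branches at infinity
   correspond to the poles of the parametrization. With exactly two poles, moved to 0 and infinity
   by a Moebius map, the parametrization is by Laurent polynomials; complex conjugation of the curve
   lifts to z -> kappa / conj z (the lift exchanges the poles because the two branches are conjugate
   but distinct), real points force kappa > 0, and after rescaling the parametrization has the
   form P(z) + conj P(1/z).

   From trigonometric to birational: let k be the degree of z over the field of rational functions on
   the curve, so that a general fibre has k points. The product of the points of a fibre has neither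
   zeros nor poles in C - 0, so it is a monomial c z^m. Over a general real point of the image of the
   unit circle exactly one point of the fibre lies on the circle and the others are paired by
   reflection, so k is odd. By comparing growth at infinity m has the parity of k, hence m is not 0, all points of
   a fibre have the same modulus, and k = 1. *)
theory Submission
  imports Defs
begin

section \<open>Evaluation homomorphisms\<close>

text \<open>The function field of \<open>C\<close> is never constructed: by
  \<open>vanish_iff\<close> a polynomial vanishes on \<open>C\<close> exactly when it vanishes along
  the parametrization for all but finitely many parameters, and identities are transported this way.
  The obstacle is that \<open>N/D\<close> inverts the parametrization only off finite sets, while
  every arc at infinity has to be captured. Elimination removes it: for a polynomial
  \<open>G\<close> not vanishing identically on \<open>C\<close>, each coordinate satisfies a
  nonzero one-variable complex polynomial modulo \<open>G\<close> on \<open>C\<close>. Hence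
  \<open>G\<close> has finitely many zeros on \<open>C\<close> and cannot vanish at a point of
  \<open>C\<close> over a larger field unless that point has complex coordinates; an arc centred at
  infinity, read as a point over the Laurent series, does not. This is why constants are mapped into
  an arbitrary field before evaluation. In the trigonometric direction injectivity is given on the
  circle only, and a fibre might have further points off the circle; the product of a fibre is used
  because it is a rational function of the parameter that takes the same value at all points of the
  fibre.\<close>

locale comm_hom =
  fixes h :: "'a::comm_ring_1 \<Rightarrow> 'b::comm_ring_1"
  assumes hom_add: "h (x + y) = h x + h y"
    and hom_mult: "h (x * y) = h x * h y"
    and hom_1: "h 1 = 1"
begin

lemma hom_0 [simp]: "h 0 = 0"
  using hom_add[of 0 0] by simp

lemma hom_uminus: "h (- x) = - h x"
  using hom_add[of x "- x"] by (simp add: eq_neg_iff_add_eq_0 add.commute)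

lemma hom_diff: "h (x - y) = h x - h y"
  using hom_add[of x "- y"] by (simp add: hom_uminus)

lemma hom_sum: "h (sum g A) = (\<Sum>x\<in>A. h (g x))"
  by (induction A rule: infinite_finite_induct) (auto simp: hom_add)

lemma hom_power: "h (x ^ n) = h x ^ n"
  by (induction n) (auto simp: hom_mult hom_1)

lemmas hom_simps = hom_add hom_mult hom_1 hom_uminus hom_diff hom_sum hom_power

lemma comm_hom_map_poly: "comm_hom (map_poly h)"
proof
  fix p q :: "'a poly"
  show "map_poly h (p + q) = map_poly h p + map_poly h q"
    by (rule poly_eqI) (simp add: coeff_map_poly hom_add)
  show "map_poly h (p * q) = map_poly h p * map_poly h q"
    by (rule poly_eqI) (simp add: coeff_map_poly coeff_mult hom_sum hom_mult)
  show "map_poly h 1 = 1"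
    by (simp add: hom_1)
qed

lemma hom_poly: "h (poly p x) = poly (map_poly h p) (h x)"
  by (induction p) (auto simp: map_poly_pCons hom_add hom_mult)

lemma hom_eval2: "h (eval2 F (a, b)) = eval2 (map_poly (map_poly h) F) (h a, h b)"
proof -
  interpret m: comm_hom "map_poly h" by (rule comm_hom_map_poly)
  show ?thesis by (simp add: eval2_def hom_poly m.hom_poly map_poly_pCons)
qed

lemma hom_form_eval:
  "h (form_eval e d g (x, y, z)) = form_eval (\<lambda>c. h (e c)) d g (h x, h y, h z)"
  by (simp add: form_eval_def hom_simps)

end

lemma comm_hom_compose: "comm_hom g \<Longrightarrow> comm_hom h \<Longrightarrow> comm_hom (\<lambda>x. g (h x))"
  by (simp add: comm_hom_def)

lemma comm_hom_poly: "comm_hom (\<lambda>p. poly p x)"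
  by (simp add: comm_hom_def)

lemma comm_hom_eval2: "comm_hom (\<lambda>F. eval2 F p)"
  by (simp add: comm_hom_def eval2_def)

lemma comm_hom_id: "comm_hom (\<lambda>x. x)"
  by (simp add: comm_hom_def)

lemma comm_hom_cnj: "comm_hom cnj"
  by (simp add: comm_hom_def)

lemma comm_hom_fls_const: "comm_hom (fls_const :: complex \<Rightarrow> complex fls)"
  by (simp add: comm_hom_def fls_plus_const fls_const_mult_const)

lemma comm_hom_fps_to_fls: "comm_hom (fps_to_fls :: complex fps \<Rightarrow> complex fls)"
  by (simp add: comm_hom_def fls_times_fps_to_fls)

lemma comm_hom_fls_compose:
  assumes "H \<noteq> 0" "fps_nth H 0 = 0"
  shows "comm_hom (\<lambda>F :: complex fls. fls_compose_fps F H)"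
  using assms by (simp add: comm_hom_def fls_compose_fps_add fls_compose_fps_mult)

lemmas eval2_hom_simps = comm_hom.hom_simps[OF comm_hom_eval2]

lemma eval2_0 [simp]: "eval2 0 p = 0"
  by (simp add: eval2_def)

section \<open>Plane polynomials evaluated over larger fields, and homogenization\<close>

definition const2 :: "complex \<Rightarrow> complex poly poly" where "const2 c = [:[:c:]:]"
definition XX :: "complex poly poly" where "XX = [:[:0, 1:]:]"
definition YY :: "complex poly poly" where "YY = [:0, 1:]"

lemma const2_0 [simp]: "const2 0 = 0"
  by (simp add: const2_def)

lemma comm_hom_const2: "comm_hom const2"
  by (simp add: comm_hom_def const2_def one_pCons)

lemma eval2_const2 [simp]: "eval2 (const2 c) p = c"
  and eval2_XX [simp]: "eval2 XX p = fst p"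
  and eval2_YY [simp]: "eval2 YY p = snd p"
  by (simp_all add: eval2_def const2_def XX_def YY_def)

text \<open>The constants enter through \<open>e\<close>: the identity for points of the plane,
  \<open>fls_const\<close> for arcs read as points over the Laurent series.\<close>

definition ev :: "(complex \<Rightarrow> 'k::field) \<Rightarrow> 'k \<times> 'k \<Rightarrow> complex poly poly \<Rightarrow> 'k" where
  "ev e p F = eval2 (map_poly (map_poly e) F) p"

lemma comm_hom_ev: "comm_hom e \<Longrightarrow> comm_hom (ev e p)"
  unfolding ev_def by (rule comm_hom_compose[OF comm_hom_eval2 comm_hom.comm_hom_map_poly[OF comm_hom.comm_hom_map_poly]])

lemma ev_id: "ev (\<lambda>c. c) p F = eval2 F p"
proof -
  have "map_poly (\<lambda>c. c) = (\<lambda>p :: complex poly. p)" by (rule ext) simp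
  thus ?thesis by (simp add: ev_def)
qed

lemma ev_vars:
  assumes "comm_hom e"
  shows "ev e p (const2 c) = e c" "ev e p XX = fst p" "ev e p YY = snd p"
  using assms by (simp_all add: ev_def const2_def XX_def YY_def eval2_def map_poly_pCons comm_hom.hom_0
      comm_hom.hom_1)

text \<open>Homogenization of \<open>G\<close> in degree \<open>n\<close>, which may exceed the
  degree of \<open>G\<close>; at \<open>b = 0\<close> it sees only the coefficient of index
  \<open>n\<close>, the value at the point at infinity.\<close>

definition hom2 :: "(complex \<Rightarrow> 'k::comm_ring_1) \<Rightarrow> nat \<Rightarrow> complex poly \<Rightarrow> 'k \<Rightarrow> 'k \<Rightarrow> 'k" where
  "hom2 e n G a b = (\<Sum>j\<le>n. e (coeff G j) * a ^ j * b ^ (n - j))"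

lemma (in comm_hom) hom_hom2: "h (hom2 e n G a b) = hom2 (\<lambda>c. h (e c)) n G (h a) (h b)"
  by (simp add: hom2_def hom_simps)

lemma poly_map_poly_altdef:
  fixes e :: "'a::zero \<Rightarrow> 'k::comm_ring_1"
  assumes "e 0 = 0" "degree G \<le> n"
  shows "poly (map_poly e G) x = (\<Sum>j\<le>n. e (coeff G j) * x ^ j)"
proof -
  have le: "degree (map_poly e G) \<le> n"
    by (rule degree_le) (use assms in \<open>auto simp: coeff_map_poly coeff_eq_0\<close>)
  have "poly (map_poly e G) x = (\<Sum>j\<le>degree (map_poly e G). coeff (map_poly e G) j * x ^ j)"
    by (simp add: poly_altdef)
  also have "\<dots> = (\<Sum>j\<le>n. coeff (map_poly e G) j * x ^ j)"
    by (rule sum.mono_neutral_left)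
      (use assms le in \<open>auto simp: coeff_eq_0\<close>)
  finally show ?thesis using assms by (simp add: coeff_map_poly)
qed

lemma hom2_field:
  fixes e :: "complex \<Rightarrow> 'k::field"
  assumes "e 0 = 0" "degree G \<le> n" "b \<noteq> 0"
  shows "hom2 e n G a b = b ^ n * poly (map_poly e G) (a / b)"
  unfolding hom2_def poly_map_poly_altdef[of e, OF assms(1,2)] sum_distrib_left
  by (rule sum.cong) (use assms in \<open>auto simp: power_divide power_diff field_simps\<close>)

lemma hom2_complex:
  assumes "degree G \<le> n" "(b::complex) \<noteq> 0"
  shows "hom2 (\<lambda>c. c) n G a b = b ^ n * poly G (a / b)"
  using hom2_field[of "\<lambda>c. c", OF _ assms] by simp

lemma hom2_0_right: "hom2 e n G a 0 = e (coeff G n) * a ^ n"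
proof -
  have "hom2 e n G a 0 = (\<Sum>j\<in>{n}. e (coeff G j) * a ^ j * 0 ^ (n - j))"
    unfolding hom2_def by (rule sum.mono_neutral_right) (auto simp: power_0_left)
  thus ?thesis by simp
qed

text \<open>Clearing denominators. Any bound \<open>d\<close> on the total degree works, so two
  polynomials can be homogenized in one common degree.\<close>

lemma form_eval_eq_ev:
  fixes e :: "complex \<Rightarrow> 'k::field"
  assumes "comm_hom e" and d: "\<And>i j. i + j > d \<Longrightarrow> coeff (coeff W j) i = 0" and "c \<noteq> 0"
  shows "form_eval e d (\<lambda>i j. coeff (coeff W j) i) (a, b, c) = c ^ d * ev e (a / c, b / c) W"
proof -
  interpret comm_hom e by fact
  have dW: "degree W \<le> d"
  proof (rule degree_le, intro allI impI)
    fix j assume "d < j" thus "coeff W j = 0" by (intro poly_eqI) (simp add: d)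
  qed
  have dj: "degree (coeff W j) \<le> d - j" if "j \<le> d" for j
    by (rule degree_le) (use d that in auto)
  have "ev e (x, y) W = (\<Sum>j\<le>d. \<Sum>i\<le>d - j. e (coeff (coeff W j) i) * x ^ i * y ^ j)" for x y
  proof -
    have "poly (map_poly (map_poly e) W) [:y:] = (\<Sum>j\<le>d. map_poly e (coeff W j) * [:y:] ^ j)"
      by (rule poly_map_poly_altdef) (use dW in auto)
    hence "ev e (x, y) W = (\<Sum>j\<le>d. poly (map_poly e (coeff W j)) x * y ^ j)"
      by (simp add: ev_def eval2_def poly_sum)
    also have "\<dots> = (\<Sum>j\<le>d. (\<Sum>i\<le>d - j. e (coeff (coeff W j) i) * x ^ i) * y ^ j)"
      by (rule sum.cong) (use dj in \<open>auto simp: poly_map_poly_altdef[of e]\<close>)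
    finally show ?thesis by (simp add: sum_distrib_right)
  qed
  hence "c ^ d * ev e (a / c, b / c) W =
     (\<Sum>j\<le>d. \<Sum>i\<le>d - j. c ^ d * (e (coeff (coeff W j) i) * (a / c) ^ i * (b / c) ^ j))"
    by (simp add: sum_distrib_left)
  also have "\<dots> = (\<Sum>j\<le>d. \<Sum>i\<le>d - j. e (coeff (coeff W j) i) * a ^ i * b ^ j * c ^ (d - i - j))"
  proof (intro sum.cong refl)
    fix i j assume "j \<in> {..d}" "i \<in> {..d - j}"
    then obtain k where k: "d = i + j + k" by (metis add.commute atMost_iff le_Suc_ex le_diff_conv2)
    show "c ^ d * (e (coeff (coeff W j) i) * (a / c) ^ i * (b / c) ^ j)
        = e (coeff (coeff W j) i) * a ^ i * b ^ j * c ^ (d - i - j)"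
      using \<open>c \<noteq> 0\<close> unfolding k by (simp add: power_divide power_add field_simps)
  qed
  also have "\<dots> = form_eval e d (\<lambda>i j. coeff (coeff W j) i) (a, b, c)"
  proof -
    have "(\<Sum>j\<le>d. \<Sum>i\<le>d - j. F i j) = (\<Sum>i\<le>d. \<Sum>j\<le>d - i. F i j)" for F :: "nat \<Rightarrow> nat \<Rightarrow> 'k"
    proof -
      have "(\<Sum>j\<le>d. \<Sum>i\<le>d - j. F i j) = (\<Sum>j\<le>d. \<Sum>i\<in>{..d} \<inter> {i. i + j \<le> d}. F i j)"
        by (intro sum.cong) auto
      also have "\<dots> = (\<Sum>j\<le>d. \<Sum>i\<le>d. if i + j \<le> d then F i j else 0)"
        by (simp add: sum.inter_restrict)
      also have "\<dots> = (\<Sum>i\<le>d. \<Sum>j\<le>d. if i + j \<le> d then F i j else 0)"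
        by (rule sum.swap)
      also have "\<dots> = (\<Sum>i\<le>d. \<Sum>j\<in>{..d} \<inter> {j. i + j \<le> d}. F i j)"
        by (simp add: sum.inter_restrict)
      also have "\<dots> = (\<Sum>i\<le>d. \<Sum>j\<le>d - i. F i j)"
        by (intro sum.cong) auto
      finally show ?thesis .
    qed
    thus ?thesis by (simp add: form_eval_def)
  qed
  finally show ?thesis ..
qed

lemma total_degree_bound:
  fixes W :: "'a::zero poly poly"
  obtains d where "\<And>i j. i + j > d \<Longrightarrow> coeff (coeff W j) i = 0"
proof -
  define m where "m = Max (insert 0 ((\<lambda>j. degree (coeff W j)) ` {..degree W}))"
  have "coeff (coeff W j) i = 0" if "i + j > m + degree W" for i j
  proof (cases "j \<le> degree W")
    case True
    hence "degree (coeff W j) \<le> m" unfolding m_def by (intro Max_ge) auto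
    thus ?thesis using that True by (intro coeff_eq_0) auto
  qed (auto simp: coeff_eq_0)
  thus ?thesis using that by blast
qed

section \<open>Germs of rational functions and elimination\<close>

text \<open>A stand-in for an element of the field of rational functions in \<open>t\<close>:
  finitely many values are irrelevant, so values forced by division by zero do no harm.\<close>

definition rat :: "(complex \<Rightarrow> complex) \<Rightarrow> bool" where
  "rat u \<longleftrightarrow> (\<exists>A E. E \<noteq> 0 \<and> (MOST t. u t = poly A t / poly E t))"

lemma eventually_poly_nonzero:
  "(p :: complex poly) \<noteq> 0 \<Longrightarrow> MOST t. poly p t \<noteq> 0"
  by (simp add: eventually_cofinite poly_roots_finite)

lemma poly_eq_0_if_eventually:
  assumes "MOST t. poly p t = (0 :: complex)"
  shows "p = 0"
proof (rule ccontr)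
  assume "p \<noteq> 0"
  from eventually_conj[OF assms eventually_poly_nonzero[OF this]]
  have "MOST t :: complex. False" by (rule eventually_mono) auto
  thus False by (simp add: eventually_cofinite infinite_UNIV_char_0)
qed

lemma poly_eq_if_eventually:
  assumes "MOST t. poly p t = poly (q :: complex poly) t"
  shows "p = q"
  using poly_eq_0_if_eventually[of "p - q"] assms by simp

lemma eventually_nonzero: "MOST t :: complex. t \<noteq> 0"
  by (simp add: eventually_cofinite)

lemma rat_quotient: "E \<noteq> 0 \<Longrightarrow> rat (\<lambda>t. poly A t / poly E t)"
  unfolding rat_def by (rule exI[of _ A], rule exI[of _ E]) auto

lemma rat_poly: "rat (poly A)"
  using rat_quotient[of 1 A] by simp

lemma rat_const: "rat (\<lambda>t. c)"
  using rat_poly[of "[:c:]"] by (simp add: rat_def)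

lemma rat_cong: "rat u \<Longrightarrow> MOST t. u t = v t \<Longrightarrow> rat v"
  unfolding rat_def
proof (elim exE conjE, goal_cases)
  case (1 A E)
  show ?case
    by (rule exI[of _ A], rule exI[of _ E]) (use 1 in \<open>auto elim: eventually_elim2\<close>)
qed

lemma rat_common:
  assumes "rat u" "rat v"
  obtains A B E where "E \<noteq> 0" "MOST t. poly E t \<noteq> 0 \<and>
     u t = poly A t / poly E t \<and> v t = poly B t / poly E t"
proof -
  obtain A1 E1 where 1: "E1 \<noteq> 0" "MOST t. u t = poly A1 t / poly E1 t"
    using assms(1) by (auto simp: rat_def)
  obtain A2 E2 where 2: "E2 \<noteq> 0" "MOST t. v t = poly A2 t / poly E2 t"
    using assms(2) by (auto simp: rat_def)
  show ?thesis
  proof (rule that[of "E1 * E2" "A1 * E2" "A2 * E1"])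
    show "E1 * E2 \<noteq> 0" using 1 2 by auto
    show "MOST t. poly (E1 * E2) t \<noteq> 0 \<and>
      u t = poly (A1 * E2) t / poly (E1 * E2) t \<and> v t = poly (A2 * E1) t / poly (E1 * E2) t"
      using 1(2) 2(2) eventually_poly_nonzero[OF 1(1)] eventually_poly_nonzero[OF 2(1)]
      by eventually_elim auto
  qed
qed

lemma rat_add: assumes "rat u" "rat v" shows "rat (\<lambda>t. u t + v t)"
proof -
  obtain A B E where E: "E \<noteq> 0" "MOST t. poly E t \<noteq> 0 \<and>
     u t = poly A t / poly E t \<and> v t = poly B t / poly E t" using rat_common[OF assms] .
  show ?thesis
    by (rule rat_cong[OF rat_quotient[OF E(1), of "A + B"]], use E(2) in eventually_elim)
      (auto simp: add_divide_distrib)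
qed

lemma rat_mult: assumes "rat u" "rat v" shows "rat (\<lambda>t. u t * v t)"
proof -
  obtain A B E where E: "E \<noteq> 0" "MOST t. poly E t \<noteq> 0 \<and>
     u t = poly A t / poly E t \<and> v t = poly B t / poly E t" using rat_common[OF assms] .
  show ?thesis
    by (rule rat_cong[OF rat_quotient[of "E * E" "A * B"]], use E(1) in simp,
        use E(2) in eventually_elim) auto
qed

lemma rat_inverse: assumes "rat u" shows "rat (\<lambda>t. inverse (u t))"
proof -
  obtain A E where E: "E \<noteq> 0" "MOST t. u t = poly A t / poly E t"
    using assms by (auto simp: rat_def)
  show ?thesis
  proof (cases "A = 0")
    case True
    show ?thesis
      by (rule rat_cong[OF rat_const[of 0]], use E(2) in eventually_elim) (simp add: True)
  next
    case False
    show ?thesis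
      by (rule rat_cong[OF rat_quotient[OF False, of E]], use E(2) in eventually_elim) auto
  qed
qed

lemma rat_divide: "rat u \<Longrightarrow> rat v \<Longrightarrow> rat (\<lambda>t. u t / v t)"
  unfolding divide_inverse by (intro rat_mult rat_inverse)

lemma rat_poly_compose: "rat u \<Longrightarrow> rat (\<lambda>t. poly p (u t))"
  by (induction p) (auto intro!: rat_const rat_add rat_mult)

lemma rat_eval2:
  assumes "rat u" "rat v" shows "rat (\<lambda>t. eval2 G (u t, v t))"
  unfolding eval2_def
  by (induction G) (auto intro!: rat_const rat_add rat_mult rat_poly_compose assms)

text \<open>A nonzero numerator has finitely many roots. This replaces the statement that rational
  functions form a field: what is not generically zero is generically invertible.\<close>

lemma rat_dichotomy:
  assumes "rat u"
  shows "(MOST t. u t = 0) \<or> (MOST t. u t \<noteq> 0)"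
proof -
  obtain A E where E: "E \<noteq> 0" "MOST t. u t = poly A t / poly E t"
    using assms by (auto simp: rat_def)
  show ?thesis
  proof (cases "A = 0")
    case True
    with E(2) show ?thesis by (auto elim: eventually_mono)
  next
    case False
    have "MOST t. u t \<noteq> 0"
      using E(2) eventually_poly_nonzero[OF False] eventually_poly_nonzero[OF E(1)]
      by eventually_elim auto
    thus ?thesis ..
  qed
qed

section \<open>Algebraic dependence of two rational functions of one variable\<close>

lemma poly_family_dependent:
  fixes p :: "'i \<Rightarrow> complex poly"
  assumes "finite S" "card S > n" "\<And>k i. k \<in> S \<Longrightarrow> i \<ge> n \<Longrightarrow> coeff (p k) i = 0"
  shows "\<exists>c. (\<exists>k\<in>S. c k \<noteq> 0) \<and> (\<Sum>k\<in>S. smult (c k) (p k)) = 0"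
  using assms
proof (induction n arbitrary: S p)
  case 0
  hence "p k = 0" if "k \<in> S" for k using that by (intro poly_eqI) auto
  moreover have "S \<noteq> {}" using 0 by auto
  ultimately show ?case by (intro exI[of _ "\<lambda>_. 1"]) auto
next
  case (Suc n)
  show ?case
  proof (cases "\<forall>k\<in>S. coeff (p k) n = 0")
    case True
    show ?thesis
    proof (rule Suc.IH)
      show "coeff (p k) i = 0" if "k \<in> S" "i \<ge> n" for k i
        using that True Suc.prems(3)[of k i] by (cases "i = n") auto
    qed (use Suc.prems in auto)
  next
    case False
    then obtain l where l: "l \<in> S" "coeff (p l) n \<noteq> 0" by auto
    \<comment> \<open>Pivoting on \<open>l\<close> clears the coefficient of index \<open>n\<close>
      in all other members, so the induction hypothesis applies to \<open>S\<close> without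
      \<open>l\<close>.\<close>
    define r where "r = (\<lambda>k. coeff (p k) n / coeff (p l) n)"
    define q where "q = (\<lambda>k. p k - smult (r k) (p l))"
    have "\<exists>c. (\<exists>k\<in>S - {l}. c k \<noteq> 0) \<and> (\<Sum>k\<in>S - {l}. smult (c k) (q k)) = 0"
    proof (rule Suc.IH)
      show "coeff (q k) i = 0" if "k \<in> S - {l}" "i \<ge> n" for k i
        using that l Suc.prems(3)[of k i] Suc.prems(3)[of l i]
        by (cases "i = n") (auto simp: q_def r_def)
    qed (use Suc.prems l in auto)
    then obtain c where c: "\<exists>k\<in>S - {l}. c k \<noteq> 0" "(\<Sum>k\<in>S - {l}. smult (c k) (q k)) = 0"
      by blast
    define c' where "c' = c(l := - (\<Sum>k\<in>S - {l}. c k * r k))"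
    have "(\<Sum>k\<in>S. smult (c' k) (p k)) = smult (c' l) (p l) + (\<Sum>k\<in>S - {l}. smult (c' k) (p k))"
      using l Suc.prems by (intro sum.remove) auto
    also have "(\<Sum>k\<in>S - {l}. smult (c' k) (p k))
        = (\<Sum>k\<in>S - {l}. smult (c k) (q k) + smult (c k * r k) (p l))"
      by (intro sum.cong) (auto simp: c'_def q_def smult_diff_right)
    also have "\<dots> = smult (\<Sum>k\<in>S - {l}. c k * r k) (p l)"
      by (simp add: sum.distrib c smult_sum)
    finally have "(\<Sum>k\<in>S. smult (c' k) (p k)) = 0"
      by (simp add: c'_def)
    moreover have "\<exists>k\<in>S. c' k \<noteq> 0" using c(1) by (auto simp: c'_def)
    ultimately show ?thesis by blast
  qed
qed

lemma eval2_monom: "eval2 (monom (monom c i) j) (x, y) = c * x ^ i * y ^ j"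
  by (simp add: eval2_def poly_monom)

text \<open>A count of dimensions: after multiplication by a power of the common denominator, the
  monomials in \<open>u\<close> and \<open>v\<close> of bidegree at most \<open>(m, m)\<close>
  become polynomials whose degree is bounded linearly in \<open>m\<close>, while their number grows
  quadratically.\<close>

lemma rat_algebraically_dependent:
  assumes "rat u" "rat v"
  shows "\<exists>R \<noteq> 0. MOST t. eval2 R (u t, v t) = 0"
proof -
  obtain A B E where E: "E \<noteq> 0" "MOST t. poly E t \<noteq> 0 \<and>
     u t = poly A t / poly E t \<and> v t = poly B t / poly E t" using rat_common[OF assms] .
  define \<delta> where "\<delta> = max (degree A) (max (degree B) (degree E))"
  \<comment> \<open>Large enough for \<open>(m + 1)^2\<close> to exceed
    \<open>2 * m * \<delta> + 1\<close>, the dimension of the space of polynomials of degree at most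
    \<open>2 * m * \<delta>\<close>.\<close>
  define m where "m = 2 * \<delta> + 1"
  define S where "S = {..m} \<times> {..m}"
  define p where "p = (\<lambda>(i, j). A ^ i * B ^ j * E ^ (2 * m - i - j))"
  have deg: "degree (p k) \<le> 2 * m * \<delta>" if k: "k \<in> S" for k
  proof -
    obtain i j where ij: "k = (i, j)" "i \<le> m" "j \<le> m" using k by (auto simp: S_def)
    have pw: "degree (Z ^ n) \<le> n * \<delta>" if "degree Z \<le> \<delta>" for Z :: "complex poly" and n
      using degree_power_le[of Z n] mult_le_mono2[OF that, of n]
      by (metis mult.commute order.trans)
    have "degree (p k) \<le> i * \<delta> + j * \<delta> + (2 * m - i - j) * \<delta>"
      unfolding p_def ij prod.case
      by (intro order.trans[OF degree_mult_le] add_mono pw) (auto simp: \<delta>_def)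
    also have "\<dots> = (i + j + (2 * m - i - j)) * \<delta>" by (simp add: algebra_simps)
    also have "i + j + (2 * m - i - j) = 2 * m" using ij by linarith
    finally show ?thesis .
  qed
  have "card S = (m + 1) * (m + 1)" by (simp add: S_def)
  moreover have "2 * m * \<delta> + 1 < (m + 1) * (m + 1)" by (simp add: m_def algebra_simps)
  ultimately have "\<exists>c. (\<exists>k\<in>S. c k \<noteq> 0) \<and> (\<Sum>k\<in>S. smult (c k) (p k)) = 0"
  proof (intro poly_family_dependent[where n = "2 * m * \<delta> + 1"])
    show "coeff (p k) i = 0" if "k \<in> S" "2 * m * \<delta> + 1 \<le> i" for k i
      using deg[OF that(1)] that(2) by (intro coeff_eq_0) auto
  qed (auto simp: S_def)
  then obtain c k where c: "k \<in> S" "c k \<noteq> 0" "(\<Sum>k\<in>S. smult (c k) (p k)) = 0" by blast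
  define R where "R = (\<Sum>k\<in>S. monom (monom (c k) (fst k)) (snd k))"
  have "coeff (coeff R (snd k)) (fst k) = (\<Sum>k'\<in>S. if k' = k then c k else 0)"
    unfolding R_def coeff_sum
    by (intro sum.cong) (auto simp: prod_eq_iff)
  also have "\<dots> = c k" using c(1) by (simp add: S_def)
  finally have "R \<noteq> 0" using c(2) by auto
  moreover have "MOST t. eval2 R (u t, v t) = 0"
    using E(2)
  proof eventually_elim
    case (elim t)
    have "poly E t ^ (2 * m) * eval2 R (u t, v t) =
      (\<Sum>k\<in>S. poly E t ^ (2 * m) * (c k * u t ^ fst k * v t ^ snd k))"
      by (simp add: R_def eval2_hom_simps eval2_monom sum_distrib_left)
    also have "\<dots> = (\<Sum>k\<in>S. c k * poly (p k) t)"
    proof (intro sum.cong refl)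
      fix k assume "k \<in> S"
      then obtain i j where ij: "k = (i, j)" "i \<le> m" "j \<le> m" by (auto simp: S_def)
      obtain r where r: "2 * m = i + j + r" using ij(2,3)
        by (metis add_mono le_Suc_ex mult_2)
      show "poly E t ^ (2 * m) * (c k * u t ^ fst k * v t ^ snd k) = c k * poly (p k) t"
        using elim by (simp add: ij(1) p_def r power_divide power_add)
    qed
    also have "\<dots> = poly (\<Sum>k\<in>S. smult (c k) (p k)) t" by (simp add: poly_sum)
    finally show ?case using c(3) elim by simp
  qed
  ultimately show ?thesis by blast
qed

text \<open>\<open>Z\<close> and \<open>G\<close> satisfy an algebraic relation along
  \<open>f\<close>. Once it is not divisible by the variable of \<open>G\<close>, its part free of
  that variable is a nonzero polynomial \<open>r\<close> in \<open>Z\<close>, and the rest is a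
  multiple of \<open>G\<close>.\<close>

lemma elimination:
  fixes f :: "complex \<Rightarrow> complex \<times> complex"
  assumes "rat (\<lambda>t. fst (f t))" "rat (\<lambda>t. snd (f t))"
    and "\<not> (MOST t. eval2 G (f t) = 0)"
  shows "\<exists>r \<noteq> 0. \<exists>H. MOST t. eval2 (poly (map_poly const2 r) Z + G * H) (f t) = 0"
proof -
  have rt: "rat (\<lambda>t. eval2 W (f t))" for W
    using rat_eval2[OF assms(1,2), of W] by simp
  obtain R where R: "R \<noteq> 0" "MOST t. eval2 R (eval2 Z (f t), eval2 G (f t)) = 0"
    using rat_algebraically_dependent[OF rt rt] by blast
  have nz: "MOST t. eval2 G (f t) \<noteq> 0"
    using rat_dichotomy[OF rt, of G] assms(3) by blast
  \<comment> \<open>The outer variable of \<open>R\<close> stands for \<open>G\<close>; a power of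
    it can be cancelled because \<open>G\<close> is generically nonzero along
    \<open>f\<close>.\<close>
  obtain R' where R': "R = [:- 0, 1:] ^ order 0 R * R'" "\<not> [:- 0, 1:] dvd R'"
    using order_decomp[OF R(1), of 0] by blast
  obtain r S where rS: "R' = pCons r S" by (cases R')
  have "r \<noteq> 0" using R'(2) by (auto simp: rS dvd_iff_poly_eq_0)
  define H where "H = eval2 (map_poly (map_poly const2) S) (Z, G)"
  have "MOST t. eval2 (poly (map_poly const2 r) Z + G * H) (f t) = 0"
    using R(2) nz
  proof eventually_elim
    case (elim t)
    interpret comm_hom "\<lambda>F. eval2 F (f t)" by (rule comm_hom_eval2)
    have [simp]: "map_poly (map_poly (\<lambda>F. eval2 F (f t))) (map_poly (map_poly const2) S) = S"
      by (simp add: map_poly_map_poly o_def)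
    have [simp]: "map_poly (\<lambda>F. eval2 F (f t)) (map_poly const2 r) = r"
      by (simp add: map_poly_map_poly o_def)
    have "eval2 R' (eval2 Z (f t), eval2 G (f t)) = 0"
      using elim by (subst (asm) R'(1)) (simp add: eval2_def)
    thus ?case
      by (simp add: hom_add hom_mult H_def hom_eval2 hom_poly) (simp add: rS eval2_def)
  qed
  thus ?thesis using \<open>r \<noteq> 0\<close> by blast
qed

section \<open>Parametrized plane curves\<close>

text \<open>Each factor \<open>y - \<rho>\<close> exceeds \<open>y0 - \<rho>\<close> in norm by a
  factor of at most \<open>1 + norm (y - y0) / \<epsilon>\<close>. Read backwards, a polynomial tiny
  at \<open>y0\<close> but not at \<open>y\<close> has a root near \<open>y0\<close>: a quantitative
  continuity of roots.\<close>

lemma norm_poly_le_if_roots_far: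
  fixes q :: "complex poly"
  assumes "\<epsilon> > 0" "\<And>\<rho>. poly q \<rho> = 0 \<Longrightarrow> \<epsilon> \<le> norm (y0 - \<rho>)"
  shows "norm (poly q y) \<le> norm (poly q y0) * (1 + norm (y - y0) / \<epsilon>) ^ degree q"
  using assms(2)
proof (induction "degree q" arbitrary: q)
  case 0
  then obtain c where "q = [:c:]" by (metis degree_0_id)
  thus ?case by simp
next
  case (Suc n)
  have "\<not> constant (poly q)" using Suc.hyps(2) by (simp add: constant_degree)
  then obtain \<rho> where \<rho>: "poly q \<rho> = 0" using fundamental_theorem_of_algebra by blast
  then obtain q' where q': "q = [:- \<rho>, 1:] * q'" by (auto simp: poly_eq_0_iff_dvd elim: dvdE)
  have "q' \<noteq> 0" using q' Suc.hyps(2) by auto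
  hence "degree q = Suc (degree q')" unfolding q' by (subst degree_mult_eq) auto
  hence n: "n = degree q'" using Suc.hyps(2) by simp
  have IH: "norm (poly q' y) \<le> norm (poly q' y0) * (1 + norm (y - y0) / \<epsilon>) ^ degree q'"
    by (rule Suc.hyps(1)[OF n]) (use Suc.prems q' in auto)
  have "norm (y - \<rho>) \<le> norm (y0 - \<rho>) + norm (y - y0)"
    using norm_triangle_ineq[of "y0 - \<rho>" "y - y0"] by simp
  also have "norm (y - y0) \<le> norm (y0 - \<rho>) * (norm (y - y0) / \<epsilon>)"
    using mult_right_mono[OF Suc.prems[OF \<rho>], of "norm (y - y0) / \<epsilon>"] assms(1) by simp
  finally have "norm (y - \<rho>) \<le> norm (y0 - \<rho>) * (1 + norm (y - y0) / \<epsilon>)"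
    by (simp add: algebra_simps)
  hence "norm (y - \<rho>) * norm (poly q' y) \<le> (norm (y0 - \<rho>) * (1 + norm (y - y0) / \<epsilon>)) *
      (norm (poly q' y0) * (1 + norm (y - y0) / \<epsilon>) ^ degree q')"
    using IH assms(1) by (intro mult_mono) auto
  moreover have "norm (poly q z) = norm (z - \<rho>) * norm (poly q' z)" for z
    unfolding q' by (simp add: norm_mult flip: norm_mult) (simp add: algebra_simps)
  ultimately show ?case using \<open>degree q = Suc (degree q')\<close> by (simp add: mult_ac)
qed

lemma eval2_slice: "eval2 F (x, y) = poly (map_poly (\<lambda>q. poly q x) F) y"
  using comm_hom.hom_poly[OF comm_hom_poly[of x], of F "[:y:]"] by (simp add: eval2_def)

lemma continuous_on_eval2: "continuous_on A (\<lambda>q. eval2 (F :: complex poly poly) q)"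
  unfolding eval2_def
proof (induction F)
  case (pCons a F)
  thus ?case by (auto intro!: continuous_intros)
qed auto

text \<open>A zero of \<open>F\<close> is a limit of other zeros: either the whole vertical line
  through it consists of zeros, or the roots of the vertical slices move continuously. So
  \<open>G\<close>, which vanishes at the zeros outside \<open>E\<close>, cannot be nonzero at
  \<open>p\<close>.\<close>

lemma zero_set_no_isolated_points:
  fixes F G :: "complex poly poly"
  assumes "eval2 F p = 0" "finite E" "\<And>q. eval2 F q = 0 \<Longrightarrow> q \<notin> E \<Longrightarrow> eval2 G q = 0"
  shows "eval2 G p = 0"
proof (rule ccontr)
  assume Gp: "eval2 G p \<noteq> 0"
  obtain x0 y0 where p: "p = (x0, y0)" by (cases p)
  have "open ((\<lambda>q. eval2 G q) -` (- {0}))"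
    using continuous_on_open_vimage[of UNIV "\<lambda>q. eval2 G q"] continuous_on_eval2[of UNIV G] by auto
  then obtain A B where AB: "open A" "open B" "x0 \<in> A" "y0 \<in> B" "\<And>q. q \<in> A \<times> B \<Longrightarrow> eval2 G q \<noteq> 0"
    using Gp p by (fastforce elim!: open_prod_elim)
  obtain \<epsilon> where \<epsilon>: "\<epsilon> > 0" "\<And>y. dist y y0 < \<epsilon> \<Longrightarrow> y \<in> B"
    using AB(2,4) by (auto simp: open_dist)
  show False
  proof (cases "map_poly (\<lambda>q. poly q x0) F = 0")
    case True
    have "MOST y. y \<notin> snd ` E"
      using assms(2) by (simp add: eventually_cofinite)
    hence "MOST y. poly (map_poly (\<lambda>q. poly q x0) G) y = 0"
    proof eventually_elim
      case (elim y)
      have "(x0, y) \<notin> E" using elim by force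
      with assms(3)[of "(x0, y)"] show ?case by (simp add: eval2_slice True)
    qed
    hence "map_poly (\<lambda>q. poly q x0) G = 0" by (rule poly_eq_0_if_eventually)
    thus False using Gp by (simp add: p eval2_slice)
  next
    case False
    then obtain y1 where y1: "eval2 F (x0, y1) \<noteq> 0"
      unfolding eval2_slice using poly_all_0_iff_0 by blast
    \<comment> \<open>Bounds the growth factor from \<open>y0\<close> to \<open>y1\<close> uniformly
      in the slice, since every slice has degree at most \<open>degree F\<close>.\<close>
    define K where "K = (1 + norm (y1 - y0) / \<epsilon>) ^ degree F"
    \<comment> \<open>At \<open>x0\<close> the second term vanishes and the first does not; the
      strict inequality persists near \<open>x0\<close> and forces a root of the slice within
      \<open>\<epsilon>\<close> of \<open>y0\<close>.\<close>
    have cont: "isCont (\<lambda>x. norm (eval2 F (x, y1)) - norm (eval2 F (x, y0)) * K) x0"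
      unfolding eval2_def by (auto intro!: continuous_intros)
    have "\<forall>\<^sub>F x in at x0. 0 < norm (eval2 F (x, y1)) - norm (eval2 F (x, y0)) * K"
      by (rule order_tendstoD(1)[OF isContD[OF cont]]) (use y1 assms(1) p in auto)
    moreover have "\<forall>\<^sub>F x in at x0. x \<in> A"
      using AB(1,3) by (auto simp: eventually_at_topological)
    moreover have "\<forall>\<^sub>F x in at x0. x \<notin> fst ` E - {x0}"
      unfolding eventually_at_topological
      by (intro exI[of _ "- (fst ` E - {x0})"] conjI open_Compl finite_imp_closed) (use assms(2) in auto)
    moreover have "\<forall>\<^sub>F x in at x0. x \<noteq> x0"
      by (auto simp: eventually_at_topological)
    ultimately have "\<forall>\<^sub>F x in at x0. False"
    proof eventually_elim
      case (elim x)
      have "\<exists>y. dist y y0 < \<epsilon> \<and> eval2 F (x, y) = 0"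
      proof (rule ccontr)
        assume no: "\<not> ?thesis"
        let ?q = "map_poly (\<lambda>q. poly q x) F"
        have "\<epsilon> \<le> norm (y0 - \<rho>)" if "poly ?q \<rho> = 0" for \<rho>
          using no that by (force simp: eval2_slice dist_norm norm_minus_commute not_less)
        from norm_poly_le_if_roots_far[where q = ?q and y = y1, OF \<epsilon>(1) this]
        have "norm (eval2 F (x, y1)) \<le> norm (eval2 F (x, y0)) * (1 + norm (y1 - y0) / \<epsilon>) ^ degree ?q"
          by (simp add: eval2_slice)
        also have "\<dots> \<le> norm (eval2 F (x, y0)) * K"
          unfolding K_def using \<epsilon>(1)
          by (intro mult_left_mono power_increasing degree_le) (auto simp: coeff_map_poly coeff_eq_0)
        finally show False using elim(1) by simp
      qed
      then obtain y where y: "dist y y0 < \<epsilon>" "eval2 F (x, y) = 0" by blast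
      have "(x, y) \<notin> E" using elim(3,4) by force
      hence "eval2 G (x, y) = 0" using assms(3) y by blast
      thus False using AB(5)[of "(x, y)"] elim(2) \<epsilon>(2) y(1) by auto
    qed
    thus False by simp
  qed
qed

text \<open>Over the algebraically closed field of constants \<open>r\<close> splits into linear
  factors, one of which must vanish at \<open>x\<close>.\<close>

lemma constant_if_algebraic:
  fixes e :: "complex \<Rightarrow> 'k::field"
  assumes "comm_hom e" "r \<noteq> 0" "poly (map_poly e r) x = 0"
  shows "\<exists>c. x = e c"
  using assms(2,3)
proof (induction "degree r" arbitrary: r)
  interpret comm_hom e by fact
  case 0
  then obtain c where c: "r = [:c:]" by (metis degree_0_id)
  have "e c * e (inverse c) = 1" using 0 c by (simp flip: hom_mult add: hom_1)
  moreover have "e c = 0" using 0 by (simp add: c map_poly_pCons)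
  ultimately show ?case by simp
next
  interpret comm_hom e by fact
  interpret m: comm_hom "map_poly e" by (rule comm_hom_map_poly)
  case (Suc n)
  have "\<not> constant (poly r)" using Suc.hyps(2) by (simp add: constant_degree)
  then obtain \<rho> where \<rho>: "poly r \<rho> = 0" using fundamental_theorem_of_algebra by blast
  then obtain q where q: "r = [:- \<rho>, 1:] * q" by (auto simp: poly_eq_0_iff_dvd elim: dvdE)
  have "q \<noteq> 0" using q Suc.hyps(2) by auto
  hence n: "n = degree q" using Suc.hyps(2) unfolding q by (subst (asm) degree_mult_eq) auto
  have "(x - e \<rho>) * poly (map_poly e q) x = 0"
    using Suc.prems(2) by (simp only: q m.hom_mult) (auto simp: map_poly_pCons hom_simps)
  then consider "x - e \<rho> = 0" | "poly (map_poly e q) x = 0"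
    unfolding mult_eq_0_iff by blast
  thus ?case
  proof cases
    case 1
    thus ?thesis by (intro exI[of _ \<rho>]) simp
  next
    case 2
    thus ?thesis by (rule Suc.hyps(1)[OF n \<open>q \<noteq> 0\<close>])
  qed
qed

section \<open>Generic parametrizations and points of the curve over extension fields\<close>

definition par :: "complex poly \<Rightarrow> complex poly \<Rightarrow> complex poly \<Rightarrow> complex \<Rightarrow> complex \<times> complex" where
  "par G1 G2 G3 t = (poly G1 t / poly G3 t, poly G2 t / poly G3 t)"

text \<open>The triple \<open>(G1, G2, G3)\<close> is a projective parametrization without base
  points at finite parameters. \<open>vanish_iff\<close> says that \<open>C\<close> and the generic
  image carry the same ideal, in place of irreducibility and density; \<open>inverse_ND\<close> is
  the inverse with its denominator cleared.\<close>

locale gen_param =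
  fixes C :: "(complex \<times> complex) set" and G1 G2 G3 :: "complex poly" and N D :: "complex poly poly"
  assumes G3_nz: "G3 \<noteq> 0"
    and no_common_zero: "\<And>t. poly G1 t \<noteq> 0 \<or> poly G2 t \<noteq> 0 \<or> poly G3 t \<noteq> 0"
    and vanish_iff: "\<And>W. (\<forall>p\<in>C. eval2 W p = 0) \<longleftrightarrow> (MOST t. eval2 W (par G1 G2 G3 t) = 0)"
    and inverse_ND: "MOST t. eval2 D (par G1 G2 G3 t) \<noteq> 0 \<and>
       eval2 N (par G1 G2 G3 t) = t * eval2 D (par G1 G2 G3 t)"
begin

abbreviation "f \<equiv> par G1 G2 G3"

lemma rat_par: "rat (\<lambda>t. fst (f t))" "rat (\<lambda>t. snd (f t))"
  using G3_nz by (auto simp: par_def intro!: rat_quotient)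

lemma eliminate:
  assumes "\<not> (MOST t. eval2 G (f t) = 0)"
  obtains r H where "r \<noteq> 0" "\<And>p. p \<in> C \<Longrightarrow> eval2 (poly (map_poly const2 r) Z + G * H) p = 0"
  using elimination[OF rat_par assms, of Z] vanish_iff by metis

text \<open>At a zero of \<open>G\<close> on \<open>C\<close> the eliminated relation reduces to a
  polynomial equation for \<open>Z\<close> alone; with \<open>Z\<close> each coordinate in turn,
  only finitely many points remain.\<close>

lemma finite_zeros:
  assumes "\<not> (MOST t. eval2 G (f t) = 0)"
  shows "finite {p \<in> C. eval2 G p = 0}"
proof -
  have *: "\<exists>r. r \<noteq> 0 \<and> (\<forall>p\<in>C. eval2 G p = 0 \<longrightarrow> poly r (eval2 Z p) = 0)" for Z
  proof -
    obtain r H where r: "r \<noteq> 0" "\<And>p. p \<in> C \<Longrightarrow> eval2 (poly (map_poly const2 r) Z + G * H) p = 0"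
      using eliminate[OF assms] by blast
    have "poly r (eval2 Z p) = 0" if "p \<in> C" "eval2 G p = 0" for p
    proof -
      interpret comm_hom "\<lambda>F. eval2 F p" by (rule comm_hom_eval2)
      have "map_poly (\<lambda>F. eval2 F p) (map_poly const2 r) = r"
        by (simp add: map_poly_map_poly o_def)
      thus ?thesis using r(2)[OF that(1)] that(2) by (simp add: hom_simps hom_poly)
    qed
    thus ?thesis using r(1) by blast
  qed
  obtain r s where rs: "r \<noteq> 0" "s \<noteq> 0" "\<And>p. p \<in> C \<Longrightarrow> eval2 G p = 0 \<Longrightarrow> poly r (fst p) = 0"
    "\<And>p. p \<in> C \<Longrightarrow> eval2 G p = 0 \<Longrightarrow> poly s (snd p) = 0"
    using *[of XX] *[of YY] by auto
  have "finite ({x. poly r x = 0} \<times> {y. poly s y = 0})"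
    using rs(1,2) by (simp add: poly_roots_finite)
  thus ?thesis by (rule finite_subset[rotated]) (use rs in auto)
qed

text \<open>If \<open>G\<close> vanished, elimination would make each coordinate algebraic over the
  complex numbers, hence constant. Over the Laurent series this shows that denominators do not
  vanish identically along an arc centred at infinity.\<close>

lemma nonvanishing_at_point:
  fixes e :: "complex \<Rightarrow> 'k::field"
  assumes e: "comm_hom e" and pt: "\<And>W. (\<forall>p\<in>C. eval2 W p = 0) \<Longrightarrow> ev e (\<alpha>, \<beta>) W = 0"
    and nonconst: "\<not> (\<exists>c. \<alpha> = e c) \<or> \<not> (\<exists>c. \<beta> = e c)"
    and G: "\<not> (MOST t. eval2 G (f t) = 0)"
  shows "ev e (\<alpha>, \<beta>) G \<noteq> 0"
proof
  assume 0: "ev e (\<alpha>, \<beta>) G = 0"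
  interpret comm_hom "ev e (\<alpha>, \<beta>)" by (rule comm_hom_ev[OF e])
  have "\<exists>c. ev e (\<alpha>, \<beta>) Z = e c" for Z
  proof -
    obtain r H where r: "r \<noteq> 0" "\<And>p. p \<in> C \<Longrightarrow> eval2 (poly (map_poly const2 r) Z + G * H) p = 0"
      using eliminate[OF G] by blast
    have "map_poly (ev e (\<alpha>, \<beta>)) (map_poly const2 r) = map_poly e r"
      by (simp add: map_poly_map_poly o_def ev_vars[OF e])
    hence "poly (map_poly e r) (ev e (\<alpha>, \<beta>) Z) = 0"
      using pt[of "poly (map_poly const2 r) Z + G * H"] r(2) 0 by (simp add: hom_simps hom_poly)
    thus ?thesis by (rule constant_if_algebraic[OF e r(1)])
  qed
  from this[of XX] this[of YY] nonconst show False by (simp add: ev_vars[OF e])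
qed

lemma D_generic: "\<not> (MOST t. eval2 D (f t) = 0)"
proof
  assume "MOST t. eval2 D (f t) = 0"
  with inverse_ND have "MOST t :: complex. False" by eventually_elim auto
  thus False by (simp add: infinite_UNIV_char_0)
qed

lemma hom2_f:
  assumes "degree G \<le> n"
  shows "MOST t. eval2 (hom2 const2 n G N D) (f t) = eval2 D (f t) ^ n * poly G t"
  using inverse_ND
proof eventually_elim
  case (elim t)
  interpret comm_hom "\<lambda>F. eval2 F (f t)" by (rule comm_hom_eval2)
  show ?case using elim assms by (simp add: hom_hom2 hom2_complex)
qed

lemma hom2_generic:
  assumes "degree G \<le> n" "G \<noteq> 0"
  shows "\<not> (MOST t. eval2 (hom2 const2 n G N D) (f t) = 0)"
proof
  assume "MOST t. eval2 (hom2 const2 n G N D) (f t) = 0"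
  with hom2_f[OF assms(1)] inverse_ND eventually_poly_nonzero[OF assms(2)]
  have "MOST t :: complex. False" by eventually_elim auto
  thus False by (simp add: infinite_UNIV_char_0)
qed

definition bound :: nat where "bound = max (degree G1) (max (degree G2) (degree G3))"

lemma bound: "degree G1 \<le> bound" "degree G2 \<le> bound" "degree G3 \<le> bound"
  by (auto simp: bound_def)

text \<open>The identities \<open>x * G3 = G1\<close> and \<open>y * G3 = G2\<close> at the
  parameter \<open>N/D\<close>, homogenized so as to be polynomial in the point; they hold along the
  parametrization and hence on all of \<open>C\<close>.\<close>

lemma relations_on_curve:
  assumes "p \<in> C"
  shows "eval2 (hom2 const2 bound G1 N D - XX * hom2 const2 bound G3 N D) p = 0"
    and "eval2 (hom2 const2 bound G2 N D - YY * hom2 const2 bound G3 N D) p = 0"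
proof -
  note h = hom2_f[OF bound(1)] hom2_f[OF bound(2)] hom2_f[OF bound(3)] eventually_poly_nonzero[OF G3_nz]
  have "MOST t. eval2 (hom2 const2 bound G1 N D - XX * hom2 const2 bound G3 N D) (f t) = 0"
    using h by eventually_elim (auto simp: eval2_hom_simps par_def)
  thus "eval2 (hom2 const2 bound G1 N D - XX * hom2 const2 bound G3 N D) p = 0"
    using vanish_iff assms by blast
  have "MOST t. eval2 (hom2 const2 bound G2 N D - YY * hom2 const2 bound G3 N D) (f t) = 0"
    using h by eventually_elim (auto simp: eval2_hom_simps par_def)
  thus "eval2 (hom2 const2 bound G2 N D - YY * hom2 const2 bound G3 N D) p = 0"
    using vanish_iff assms by blast
qed

text \<open>Polynomial relations on \<open>C\<close> persist at a point of \<open>C\<close> over any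
  field, so as soon as the two denominators are nonzero there, the point is the image of its
  parameter \<open>T\<close>.\<close>

lemma parameter_of_point:
  fixes e :: "complex \<Rightarrow> 'k::field"
  assumes e: "comm_hom e" and pt: "\<And>W. (\<forall>p\<in>C. eval2 W p = 0) \<Longrightarrow> ev e (\<alpha>, \<beta>) W = 0"
    and D: "ev e (\<alpha>, \<beta>) D \<noteq> 0" and G3: "ev e (\<alpha>, \<beta>) (hom2 const2 bound G3 N D) \<noteq> 0"
  defines "T \<equiv> ev e (\<alpha>, \<beta>) N / ev e (\<alpha>, \<beta>) D"
  shows "poly (map_poly e G3) T \<noteq> 0" "\<alpha> = poly (map_poly e G1) T / poly (map_poly e G3) T"
    "\<beta> = poly (map_poly e G2) T / poly (map_poly e G3) T"
proof -
  interpret e: comm_hom e by fact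
  interpret comm_hom "ev e (\<alpha>, \<beta>)" by (rule comm_hom_ev[OF e])
  let ?d = "ev e (\<alpha>, \<beta>) D ^ bound"
  have h: "ev e (\<alpha>, \<beta>) (hom2 const2 bound G N D) = ?d * poly (map_poly e G) T" if "degree G \<le> bound" for G
    using D that by (simp add: hom_hom2 ev_vars[OF e] hom2_field T_def)
  show nz: "poly (map_poly e G3) T \<noteq> 0" using G3 by (simp add: h bound)
  have 1: "ev e (\<alpha>, \<beta>) (hom2 const2 bound G1 N D - XX * hom2 const2 bound G3 N D) = 0"
    by (rule pt) (use relations_on_curve in auto)
  have 2: "ev e (\<alpha>, \<beta>) (hom2 const2 bound G2 N D - YY * hom2 const2 bound G3 N D) = 0"
    by (rule pt) (use relations_on_curve in auto)
  show "\<alpha> = poly (map_poly e G1) T / poly (map_poly e G3) T"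
    using 1 D nz by (simp add: hom_simps h bound ev_vars[OF e] field_simps)
  show "\<beta> = poly (map_poly e G2) T / poly (map_poly e G3) T"
    using 2 D nz by (simp add: hom_simps h bound ev_vars[OF e] field_simps)
qed

lemma finite_exceptional_points:
  "finite {p \<in> C. \<not> (eval2 D p \<noteq> 0 \<and> poly G3 (eval2 N p / eval2 D p) \<noteq> 0 \<and>
      f (eval2 N p / eval2 D p) = p)}"
proof (rule finite_subset)
  show "{p \<in> C. \<not> (eval2 D p \<noteq> 0 \<and> poly G3 (eval2 N p / eval2 D p) \<noteq> 0 \<and>
      f (eval2 N p / eval2 D p) = p)} \<subseteq>
    {p \<in> C. eval2 D p = 0} \<union> {p \<in> C. eval2 (hom2 const2 bound G3 N D) p = 0}"
  proof (safe, goal_cases)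
    case (1 x y)
    thus ?case using parameter_of_point(1)[OF comm_hom_id, of x y] by (auto simp: ev_id)
  next
    case (2 x y)
    thus ?case using parameter_of_point(2,3)[OF comm_hom_id, of x y] by (auto simp: ev_id par_def)
  qed
  show "finite ({p \<in> C. eval2 D p = 0} \<union> {p \<in> C. eval2 (hom2 const2 bound G3 N D) p = 0})"
    using finite_zeros[OF D_generic] finite_zeros[OF hom2_generic[OF bound(3) G3_nz]] by simp
qed

text \<open>The homogenized composition of \<open>F\<close> with the parametrization is a polynomial
  in \<open>t\<close>; vanishing generically, it vanishes identically, so no parameter with nonzero
  \<open>G3\<close> is exceptional.\<close>

lemma par_in_zero_set:
  assumes "C = {p. eval2 F p = 0}" "poly G3 t \<noteq> 0"
  shows "f t \<in> C"
proof -
  obtain d where d: "\<And>i j. i + j > d \<Longrightarrow> coeff (coeff F j) i = 0"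
    using total_degree_bound[of F] by blast
  let ?g = "\<lambda>i j. coeff (coeff F j) i"
  define M where "M = form_eval (\<lambda>c. [:c:]) d ?g (G1, G2, G3)"
  have M: "poly M t = form_eval (\<lambda>c. c) d ?g (poly G1 t, poly G2 t, poly G3 t)" for t
    using comm_hom.hom_form_eval[OF comm_hom_poly[of t], of "\<lambda>c. [:c:]" d ?g G1 G2 G3] by (simp add: M_def)
  have Mf: "poly M t = poly G3 t ^ d * eval2 F (f t)" if "poly G3 t \<noteq> 0" for t
    unfolding M using form_eval_eq_ev[OF comm_hom_id d that] by (simp add: ev_id par_def)
  have "MOST t. eval2 F (f t) = 0" using vanish_iff[of F] assms(1) by simp
  hence "MOST t. poly M t = 0"
    using eventually_poly_nonzero[OF G3_nz] by eventually_elim (simp add: Mf)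
  hence "M = 0" by (rule poly_eq_0_if_eventually)
  thus ?thesis using Mf[OF assms(2)] assms by simp
qed

lemma birational:
  assumes "C = {p. eval2 F p = 0}" "U = {t. poly G3 t \<noteq> 0}" "\<And>t. t \<in> U \<Longrightarrow> g t = f t"
  shows "birational_parametrization U g C"
  unfolding birational_parametrization_def
proof (intro conjI exI)
  show "finite (- U)" using G3_nz by (simp add: assms(2) Collect_neg_eq[symmetric] poly_roots_finite)
  show "regular_on U g"
    unfolding regular_on_def
    by (rule exI[of _ G1], rule exI[of _ G3], rule exI[of _ G2], rule exI[of _ G3])
      (use assms in \<open>auto simp: par_def\<close>)
  show "g ` U \<subseteq> C" using assms par_in_zero_set[OF assms(1)] by auto
  have "finite {t. \<not> (eval2 D (f t) \<noteq> 0 \<and> eval2 N (f t) = t * eval2 D (f t))}"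
    using inverse_ND by (simp add: eventually_cofinite)
  thus "finite {t \<in> U. \<not> (eval2 D (g t) \<noteq> 0 \<and> eval2 N (g t) / eval2 D (g t) = t)}"
    by (rule finite_subset[rotated]) (use assms in auto)
  show "finite {p \<in> C. \<not> (eval2 D p \<noteq> 0 \<and> eval2 N p / eval2 D p \<in> U \<and>
         g (eval2 N p / eval2 D p) = p)}"
    by (rule finite_subset[OF _ finite_exceptional_points]) (use assms in auto)
qed

end

section \<open>From birational maps to generic parametrizations\<close>

lemma remove_common_zeros:
  fixes P1 P2 P3 :: "complex poly"
  assumes "P3 \<noteq> 0"
  shows "\<exists>H G1 G2 G3. P1 = H * G1 \<and> P2 = H * G2 \<and> P3 = H * G3 \<and>
    (\<forall>t. poly G1 t \<noteq> 0 \<or> poly G2 t \<noteq> 0 \<or> poly G3 t \<noteq> 0)"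
  using assms
proof (induction "degree P3" arbitrary: P1 P2 P3 rule: less_induct)
  case less
  show ?case
  proof (cases "\<exists>t. poly P1 t = 0 \<and> poly P2 t = 0 \<and> poly P3 t = 0")
    case False
    thus ?thesis by (intro exI[of _ 1] exI[of _ P1] exI[of _ P2] exI[of _ P3]) auto
  next
    case True
    then obtain t Q1 Q2 Q3 where Q: "P1 = [:- t, 1:] * Q1" "P2 = [:- t, 1:] * Q2" "P3 = [:- t, 1:] * Q3"
      unfolding poly_eq_0_iff_dvd by (auto elim!: dvdE)
    have "Q3 \<noteq> 0" using Q less.prems by auto
    hence "degree Q3 < degree P3" unfolding Q by (subst degree_mult_eq) auto
    from less.hyps[OF this \<open>Q3 \<noteq> 0\<close>, of Q1 Q2] obtain H G1 G2 G3
      where "Q1 = H * G1" "Q2 = H * G2" "Q3 = H * G3"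
        "\<forall>t. poly G1 t \<noteq> 0 \<or> poly G2 t \<noteq> 0 \<or> poly G3 t \<noteq> 0" by blast
    hence "P1 = ([:- t, 1:] * H) * G1 \<and> P2 = ([:- t, 1:] * H) * G2 \<and> P3 = ([:- t, 1:] * H) * G3 \<and>
      (\<forall>t. poly G1 t \<noteq> 0 \<or> poly G2 t \<noteq> 0 \<or> poly G3 t \<noteq> 0)"
      unfolding Q mult.assoc by blast
    thus ?thesis by blast
  qed
qed

text \<open>The delicate direction of \<open>vanish_iff\<close>: a polynomial vanishing generically
  along the parametrization vanishes at all but finitely many points of \<open>C\<close>, and the
  absence of isolated points in a zero set gives the remaining ones.\<close>

lemma gen_param_if_birational:
  fixes F :: "complex poly poly"
  assumes C: "C = {p. eval2 F p = 0}" and "finite (- U)" "f ` U \<subseteq> C"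
    and f: "\<And>t. t \<in> U \<Longrightarrow> f t = par G1 G2 G3 t" and "G3 \<noteq> 0"
    and "\<And>t. poly G1 t \<noteq> 0 \<or> poly G2 t \<noteq> 0 \<or> poly G3 t \<noteq> 0"
    and 1: "finite {t \<in> U. \<not> (eval2 D (f t) \<noteq> 0 \<and> eval2 N (f t) / eval2 D (f t) = t)}"
    and 2: "finite {p \<in> C. \<not> (eval2 D p \<noteq> 0 \<and> eval2 N p / eval2 D p \<in> U \<and> f (eval2 N p / eval2 D p) = p)}"
  shows "gen_param C G1 G2 G3 N D"
proof
  have U: "MOST t. t \<in> U"
    using assms(2) by (simp add: eventually_cofinite Compl_eq)
  show "MOST t. eval2 D (par G1 G2 G3 t) \<noteq> 0 \<and>
       eval2 N (par G1 G2 G3 t) = t * eval2 D (par G1 G2 G3 t)"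
  proof -
    have "MOST t. \<not> (t \<in> U \<and> \<not> (eval2 D (f t) \<noteq> 0 \<and> eval2 N (f t) / eval2 D (f t) = t))"
      using 1 by (simp add: eventually_cofinite)
    thus ?thesis using U
    proof eventually_elim
      case (elim t)
      thus ?case by (metis f nonzero_eq_divide_eq)
    qed
  qed
  fix W
  show "(\<forall>p\<in>C. eval2 W p = 0) \<longleftrightarrow> (MOST t. eval2 W (par G1 G2 G3 t) = 0)"
  proof
    assume "\<forall>p\<in>C. eval2 W p = 0"
    thus "MOST t. eval2 W (par G1 G2 G3 t) = 0"
      using U assms(3) f by (auto elim!: eventually_mono)
  next
    assume "MOST t. eval2 W (par G1 G2 G3 t) = 0"
    hence fin: "finite {t. eval2 W (par G1 G2 G3 t) \<noteq> 0}" by (simp add: eventually_cofinite)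
    \<comment> \<open>Points not recovered by the inverse, together with the images of the finitely
      many parameters where \<open>W\<close> does not vanish.\<close>
    let ?E = "{p \<in> C. \<not> (eval2 D p \<noteq> 0 \<and> eval2 N p / eval2 D p \<in> U \<and> f (eval2 N p / eval2 D p) = p)}
      \<union> f ` {t. eval2 W (par G1 G2 G3 t) \<noteq> 0}"
    show "\<forall>p\<in>C. eval2 W p = 0"
    proof
      fix p assume "p \<in> C"
      show "eval2 W p = 0"
      proof (rule zero_set_no_isolated_points)
        show "eval2 F p = 0" using \<open>p \<in> C\<close> C by simp
        show "finite ?E" using fin 2 by simp
        fix q assume q: "eval2 F q = 0" "q \<notin> ?E"
        define t where "t = eval2 N q / eval2 D q"
        have "t \<in> U" "f t = q" using q C by (auto simp: t_def)
        thus "eval2 W q = 0" using q(2) f[of t] by force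
      qed
    qed
  qed
qed fact+

lemma birational_imp_gen_param:
  fixes F :: "complex poly poly"
  assumes C: "C = {p. eval2 F p = 0}" and "birational_parametrization U f C"
  shows "\<exists>G1 G2 G3 N D. gen_param C G1 G2 G3 N D"
proof -
  obtain N D where *: "finite (- U)" "regular_on U f" "f ` U \<subseteq> C"
     "finite {t \<in> U. \<not> (eval2 D (f t) \<noteq> 0 \<and> eval2 N (f t) / eval2 D (f t) = t)}"
     "finite {p \<in> C. \<not> (eval2 D p \<noteq> 0 \<and> eval2 N p / eval2 D p \<in> U \<and> f (eval2 N p / eval2 D p) = p)}"
    using assms(2) unfolding birational_parametrization_def by blast
  obtain A1 B1 A2 B2 where AB: "\<And>t. t \<in> U \<Longrightarrow> poly B1 t \<noteq> 0 \<and> poly B2 t \<noteq> 0 \<and>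
        f t = (poly A1 t / poly B1 t, poly A2 t / poly B2 t)"
    using *(2) unfolding regular_on_def by blast
  have "U \<noteq> {}" using *(1) infinite_UNIV_char_0[where 'a = complex] by auto
  hence "B1 * B2 \<noteq> 0" using AB by fastforce
  from remove_common_zeros[OF this, of "A1 * B2" "A2 * B1"] obtain H G1 G2 G3 where
    G: "A1 * B2 = H * G1" "A2 * B1 = H * G2" "B1 * B2 = H * G3"
    "\<And>t. poly G1 t \<noteq> 0 \<or> poly G2 t \<noteq> 0 \<or> poly G3 t \<noteq> 0" by blast
  have "gen_param C G1 G2 G3 N D"
  proof (rule gen_param_if_birational[OF C *(1,3) _ _ G(4) *(4,5)])
    show "G3 \<noteq> 0" using G(3) \<open>B1 * B2 \<noteq> 0\<close> by auto
    fix t assume t: "t \<in> U"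
    have "poly A1 t * poly B2 t = poly H t * poly G1 t" "poly A2 t * poly B1 t = poly H t * poly G2 t"
      "poly B1 t * poly B2 t = poly H t * poly G3 t"
      using G(1-3) by (metis poly_mult)+
    moreover from this(3) have "poly H t \<noteq> 0" "poly G3 t \<noteq> 0" using AB[OF t] by auto
    moreover have "poly G t / poly G3 t = (poly H t * poly G t) / (poly H t * poly G3 t)" for G
      using \<open>poly H t \<noteq> 0\<close> by simp
    ultimately have "poly G1 t / poly G3 t = (poly A1 t * poly B2 t) / (poly B1 t * poly B2 t)"
      "poly G2 t / poly G3 t = (poly A2 t * poly B1 t) / (poly B1 t * poly B2 t)" by simp_all
    hence "poly G1 t / poly G3 t = poly A1 t / poly B1 t" "poly G2 t / poly G3 t = poly A2 t / poly B2 t"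
      using AB[OF t] by simp_all
    thus "f t = par G1 G2 G3 t" using AB[OF t] by (simp add: par_def)
  qed
  thus ?thesis by blast
qed

text \<open>Numerator of the Moebius substitution \<open>(a * z + b) / (c * z + d)\<close> into
  \<open>G\<close>, taken in formal degree \<open>n\<close>; at the pole of the substitution its
  value is governed by the coefficient of index \<open>n\<close>.\<close>

definition mob :: "complex \<Rightarrow> complex \<Rightarrow> complex \<Rightarrow> complex \<Rightarrow> nat \<Rightarrow> complex poly \<Rightarrow> complex poly" where
  "mob a b c d n G = hom2 (\<lambda>z. [:z:]) n G [:b, a:] [:d, c:]"

lemma poly_mob_hom2: "poly (mob a b c d n G) z = hom2 (\<lambda>x. x) n G (a * z + b) (c * z + d)"
  using comm_hom.hom_hom2[OF comm_hom_poly[of z]] by (simp add: mob_def algebra_simps)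

lemma poly_mob:
  assumes "degree G \<le> n" "c * z + d \<noteq> 0"
  shows "poly (mob a b c d n G) z = (c * z + d) ^ n * poly G ((a * z + b) / (c * z + d))"
  using hom2_complex[OF assms] by (simp add: poly_mob_hom2)

lemma eventually_mob:
  fixes a b c d :: complex
  assumes "a * d - b * c \<noteq> 0" "MOST t. P t"
  shows "MOST z. c * z + d \<noteq> 0 \<and> P ((a * z + b) / (c * z + d))"
proof -
  have "[:d, c:] \<noteq> 0" using assms(1) by auto
  hence nz: "MOST z. c * z + d \<noteq> 0"
    using eventually_poly_nonzero[of "[:d, c:]"] by (simp add: algebra_simps)
  have "finite ({z. c * z + d \<noteq> 0 \<and> (a * z + b) / (c * z + d) \<in> {t. \<not> P t}})"
  proof (rule finite_subset)
    show "{z. c * z + d \<noteq> 0 \<and> (a * z + b) / (c * z + d) \<in> {t. \<not> P t}}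
       \<subseteq> (\<lambda>t. (d * t - b) / (a - c * t)) ` {t. \<not> P t}"
    proof safe
      fix z assume z: "c * z + d \<noteq> 0" "\<not> P ((a * z + b) / (c * z + d))"
      define t where "t = (a * z + b) / (c * z + d)"
      have t: "t * (c * z + d) = a * z + b" using z(1) by (simp add: t_def)
      have "(a - c * t) * (c * z + d) = a * d - b * c"
        using t by algebra
      hence "a - c * t \<noteq> 0" using assms(1) by auto
      moreover have "(d * t - b) = z * (a - c * t)" using t by algebra
      ultimately have "z = (d * t - b) / (a - c * t)" by simp
      thus "z \<in> (\<lambda>t. (d * t - b) / (a - c * t)) ` {t. \<not> P t}" using z(2) unfolding t_def by blast
    qed
    show "finite ((\<lambda>t. (d * t - b) / (a - c * t)) ` {t. \<not> P t})"
      using assms(2) by (simp add: eventually_cofinite)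
  qed
  hence "MOST z. \<not> (c * z + d \<noteq> 0 \<and> (a * z + b) / (c * z + d) \<in> {t. \<not> P t})"
    by (simp add: eventually_cofinite)
  thus ?thesis using nz by eventually_elim auto
qed

lemma eventually_mob_iff:
  fixes a b c d :: complex
  assumes "a * d - b * c \<noteq> 0"
  shows "(MOST z. P ((a * z + b) / (c * z + d))) \<longleftrightarrow> (MOST t. P t)"
proof
  assume "MOST t. P t"
  from eventually_mob[OF assms this]
  show "MOST z. P ((a * z + b) / (c * z + d))" by (rule eventually_mono) auto
next
  let ?\<mu> = "\<lambda>z. (a * z + b) / (c * z + d)"
  have "[:d, c:] \<noteq> 0" using assms(1) by auto
  hence nz: "MOST z. c * z + d \<noteq> 0"
    using eventually_poly_nonzero[of "[:d, c:]"] by (simp add: algebra_simps)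
  assume "MOST z. P (?\<mu> z)"
  from eventually_conj[OF nz this]
  have "MOST t. (- c) * t + a \<noteq> 0 \<and> (\<lambda>z. c * z + d \<noteq> 0 \<and> P (?\<mu> z)) ((d * t + (- b)) / ((- c) * t + a))"
    by (rule eventually_mob[rotated]) (use assms in \<open>simp add: algebra_simps\<close>)
  thus "MOST t. P t"
  proof eventually_elim
    case (elim t)
    let ?z = "(d * t + (- b)) / ((- c) * t + a)"
    have "?\<mu> ?z = t"
    proof -
      have z: "?z * ((- c) * t + a) = d * t - b" using elim by simp
      hence "a * ?z + b = t * (c * ?z + d)" by algebra
      thus ?thesis using elim by simp
    qed
    thus ?case using elim by simp
  qed
qed

text \<open>The new inverse is the inverse Moebius map \<open>(d * t - b) / (a - c * t)\<close>
  applied to \<open>N/D\<close>. The hypothesis \<open>top\<close> says that the old parametrization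
  has no base point at infinity, which matters where \<open>c * z + d = 0\<close>.\<close>

lemma (in gen_param) gen_param_mob:
  assumes det: "a * d - b * c \<noteq> 0" and n: "degree G1 \<le> n" "degree G2 \<le> n" "degree G3 \<le> n"
    and top: "coeff G1 n \<noteq> 0 \<or> coeff G2 n \<noteq> 0 \<or> coeff G3 n \<noteq> 0"
  shows "gen_param C (mob a b c d n G1) (mob a b c d n G2) (mob a b c d n G3)
           (const2 d * N - const2 b * D) (const2 a * D - const2 c * N)"
proof
  let ?\<mu> = "\<lambda>z. (a * z + b) / (c * z + d)"
  let ?f' = "par (mob a b c d n G1) (mob a b c d n G2) (mob a b c d n G3)"
  have f': "?f' z = f (?\<mu> z)" if "c * z + d \<noteq> 0" for z
    using that n by (simp add: par_def poly_mob)
  have nz: "MOST z. c * z + d \<noteq> 0"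
    using eventually_mob[OF det, of "\<lambda>_. True"] by simp
  show "mob a b c d n G3 \<noteq> 0"
  proof
    assume 0: "mob a b c d n G3 = 0"
    from eventually_mob[OF det eventually_poly_nonzero[OF G3_nz]]
    have "MOST z :: complex. False"
    proof eventually_elim
      case (elim z)
      thus ?case using poly_mob[OF n(3), of c z d a b] 0 by simp
    qed
    thus False by (simp add: infinite_UNIV_char_0)
  qed
  show "poly (mob a b c d n G1) z \<noteq> 0 \<or> poly (mob a b c d n G2) z \<noteq> 0 \<or> poly (mob a b c d n G3) z \<noteq> 0" for z
  proof (cases "c * z + d = 0")
    case True
    have "a * z + b \<noteq> 0"
    proof
      assume "a * z + b = 0"
      hence "a * d - b * c = 0" using True by algebra
      thus False using det by simp
    qed
    thus ?thesis using top True by (simp add: poly_mob_hom2 hom2_0_right)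
  next
    case False
    thus ?thesis using no_common_zero[of "?\<mu> z"] n by (simp add: poly_mob)
  qed
  show "(\<forall>p\<in>C. eval2 W p = 0) \<longleftrightarrow> (MOST z. eval2 W (?f' z) = 0)" for W
  proof -
    have "(MOST z. eval2 W (?f' z) = 0) \<longleftrightarrow> (MOST z. eval2 W (f (?\<mu> z)) = 0)"
      by (rule eventually_subst) (use nz in \<open>eventually_elim, simp add: f'\<close>)
    thus ?thesis using vanish_iff[of W] eventually_mob_iff[OF det, of "\<lambda>t. eval2 W (f t) = 0"] by simp
  qed
  show "MOST z. eval2 (const2 a * D - const2 c * N) (?f' z) \<noteq> 0 \<and>
    eval2 (const2 d * N - const2 b * D) (?f' z) = z * eval2 (const2 a * D - const2 c * N) (?f' z)"
    using eventually_mob[OF det inverse_ND]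
  proof eventually_elim
    case (elim z)
    define t where "t = ?\<mu> z"
    define x where "x = eval2 D (f t)"
    have t: "t * (c * z + d) = a * z + b" using elim by (simp add: t_def)
    have x: "x \<noteq> 0" "eval2 N (f t) = t * x" using elim by (auto simp: t_def x_def)
    have "(a - c * t) * (c * z + d) = a * d - b * c" using t by algebra
    hence "a - c * t \<noteq> 0" using det by auto
    moreover have "d * (t * x) - b * x = z * (a * x - c * (t * x))" using t by algebra
    moreover have "?f' z = f t" using elim by (simp add: f' t_def)
    ultimately show ?case using x
      by (simp add: eval2_hom_simps flip: x_def)
  qed
qed

section \<open>Arcs and local branches at infinity\<close>

lemma fps_compose_nth_1: "fps_nth b 0 = 0 \<Longrightarrow> fps_nth (a oo b) 1 = fps_nth a 1 * fps_nth (b :: complex fps) 1"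
  by (simp add: fps_compose_nth)

lemma arc_transform_compose:
  assumes "fps_nth \<tau> 0 = 0" "fps_nth \<tau>' 0 = 0"
  shows "arc_transform u' \<tau>' (arc_transform u \<tau> p) = arc_transform (u' * (u oo \<tau>')) (\<tau> oo \<tau>') p"
  using assms
  by (cases p) (simp add: arc_transform_def fps_compose_mult_distrib fps_compose_assoc mult.assoc)

lemma arc_transform_id: "arc_transform 1 fps_X p = p"
  by (cases p) (simp add: arc_transform_def)

lemma equiv_arc_equiv: "equiv UNIV arc_equiv"
proof (rule equivI)
  show "arc_equiv \<subseteq> UNIV \<times> UNIV" by simp
  show "refl_on UNIV arc_equiv"
  proof (rule refl_onI)
    fix p :: arc
    have "p = arc_transform 1 fps_X p" by (simp add: arc_transform_id)
    moreover have "fps_nth (1 :: complex fps) 0 \<noteq> 0" "fps_nth (fps_X :: complex fps) 0 = 0"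
      "fps_nth (fps_X :: complex fps) 1 \<noteq> 0" by simp_all
    ultimately show "(p, p) \<in> arc_equiv" unfolding arc_equiv_def by blast
  qed
  show "sym arc_equiv"
  proof (rule symI)
    fix p q assume "(p, q) \<in> arc_equiv"
    then obtain u \<tau> where u: "fps_nth u 0 \<noteq> 0" "fps_nth \<tau> 0 = 0" "fps_nth \<tau> 1 \<noteq> 0"
      "q = arc_transform u \<tau> p" by (auto simp: arc_equiv_def)
    define \<sigma> where "\<sigma> = fps_inv \<tau>"
    have \<sigma>: "\<tau> oo \<sigma> = fps_X" unfolding \<sigma>_def by (rule fps_inv_right) (use u in auto)
    have \<sigma>0: "fps_nth \<sigma> 0 = 0" by (simp add: \<sigma>_def fps_inv_def)
    have "fps_nth \<tau> 1 * fps_nth \<sigma> 1 = 1"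
      using fps_compose_nth_1[OF \<sigma>0, of \<tau>] by (simp add: \<sigma>)
    hence \<sigma>1: "fps_nth \<sigma> 1 \<noteq> 0" by auto
    define v where "v = inverse (u oo \<sigma>)"
    have "v * (u oo \<sigma>) = 1" unfolding v_def by (rule inverse_mult_eq_1) (use u in simp)
    hence "arc_transform v \<sigma> q = p"
      unfolding u(4) by (simp add: arc_transform_compose u \<sigma>0 \<sigma> arc_transform_id)
    moreover have "fps_nth v 0 \<noteq> 0" using u by (simp add: v_def)
    ultimately show "(q, p) \<in> arc_equiv" using \<sigma>0 \<sigma>1 by (auto simp: arc_equiv_def)
  qed
  show "trans arc_equiv"
  proof (rule transI)
    fix p q r assume "(p, q) \<in> arc_equiv" "(q, r) \<in> arc_equiv"
    then obtain u \<tau> v \<sigma> where u: "fps_nth u 0 \<noteq> 0" "fps_nth \<tau> 0 = 0" "fps_nth \<tau> 1 \<noteq> 0"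
      "q = arc_transform u \<tau> p" and v: "fps_nth v 0 \<noteq> 0" "fps_nth \<sigma> 0 = 0" "fps_nth \<sigma> 1 \<noteq> 0"
      "r = arc_transform v \<sigma> q" by (auto simp: arc_equiv_def)
    have "r = arc_transform (v * (u oo \<sigma>)) (\<tau> oo \<sigma>) p"
      unfolding v(4) u(4) using u v by (simp add: arc_transform_compose)
    moreover have "fps_nth (v * (u oo \<sigma>)) 0 \<noteq> 0" "fps_nth (\<tau> oo \<sigma>) 0 = 0" using u v by simp_all
    moreover have "fps_nth (\<tau> oo \<sigma>) 1 \<noteq> 0" using u v by (simp only: fps_compose_nth_1) simp
    ultimately show "(p, r) \<in> arc_equiv" unfolding arc_equiv_def by blast
  qed
qed

lemma arc_class_eq_iff: "arc_equiv `` {p} = arc_equiv `` {q} \<longleftrightarrow> (p, q) \<in> arc_equiv"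
  using eq_equiv_class_iff[OF equiv_arc_equiv] by simp

section \<open>Complex conjugation of arcs\<close>

definition conj_arc :: "arc \<Rightarrow> arc" where
  "conj_arc = (\<lambda>(a, b, c). (fps_cnj a, fps_cnj b, fps_cnj c))"

lemma fps_cnj_nth [simp]: "fps_nth (fps_cnj a) n = cnj (fps_nth a n)"
  by (simp add: fps_cnj_def)

lemma fps_cnj_fps_cnj [simp]: "fps_cnj (fps_cnj a) = a"
  by (simp add: fps_eq_iff)

lemma fps_cnj_mult: "fps_cnj (a * b) = fps_cnj a * fps_cnj b"
  by (simp add: fps_eq_iff fps_mult_nth)

lemma fps_cnj_power: "fps_cnj (a ^ n) = fps_cnj a ^ n"
  by (induction n) (simp_all add: fps_cnj_mult, simp add: fps_eq_iff)

lemma fps_cnj_compose: "fps_cnj (a oo b) = fps_cnj a oo fps_cnj b"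
  by (simp add: fps_eq_iff fps_compose_nth flip: fps_cnj_power)

lemma conj_arc_transform: "conj_arc (arc_transform u \<tau> p) = arc_transform (fps_cnj u) (fps_cnj \<tau>) (conj_arc p)"
  by (cases p) (simp add: arc_transform_def conj_arc_def fps_cnj_mult fps_cnj_compose)

lemma conj_arc_conj_arc [simp]: "conj_arc (conj_arc p) = p"
  by (cases p) (simp add: conj_arc_def)

lemma conj_arc_equiv: "(p, q) \<in> arc_equiv \<Longrightarrow> (conj_arc p, conj_arc q) \<in> arc_equiv"
proof -
  assume "(p, q) \<in> arc_equiv"
  then obtain u \<tau> where u: "fps_nth u 0 \<noteq> 0" "fps_nth \<tau> 0 = 0" "fps_nth \<tau> 1 \<noteq> 0"
      "q = arc_transform u \<tau> p" by (auto simp: arc_equiv_def)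
  have "conj_arc q = arc_transform (fps_cnj u) (fps_cnj \<tau>) (conj_arc p)"
    by (simp add: u(4) conj_arc_transform)
  moreover have "fps_nth (fps_cnj u) 0 \<noteq> 0" "fps_nth (fps_cnj \<tau>) 0 = 0" "fps_nth (fps_cnj \<tau>) 1 \<noteq> 0"
    using u by simp_all
  ultimately show ?thesis unfolding arc_equiv_def by blast
qed

lemma conj_branch_class: "conj_branch (arc_equiv `` {p}) = arc_equiv `` {conj_arc p}"
proof -
  have "conj_branch B = conj_arc ` B" for B by (simp add: conj_branch_def conj_arc_def)
  moreover have "conj_arc ` (arc_equiv `` {p}) = arc_equiv `` {conj_arc p}"
  proof (intro equalityI subsetI)
    fix q assume "q \<in> conj_arc ` (arc_equiv `` {p})"
    thus "q \<in> arc_equiv `` {conj_arc p}" using conj_arc_equiv by auto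
  next
    fix q assume "q \<in> arc_equiv `` {conj_arc p}"
    hence "(conj_arc p, q) \<in> arc_equiv" by simp
    hence "(p, conj_arc q) \<in> arc_equiv" using conj_arc_equiv by fastforce
    thus "q \<in> conj_arc ` (arc_equiv `` {p})"
      by (intro image_eqI[of _ _ "conj_arc q"]) auto
  qed
  ultimately show ?thesis by simp
qed

text \<open>A coordinate of \<open>(a', b', c')\<close> that is a unit provides the quotient
  \<open>u\<close> as a power series; \<open>u\<close> is itself a unit because
  \<open>(a, b, c)\<close> is centred as well.\<close>

lemma proportional_centred_arcs:
  assumes "centred (a, b, c)" "centred (a', b', c')" "c \<noteq> 0" "c' \<noteq> 0" "a * c' = a' * c" "b * c' = b' * c"
  shows "\<exists>u. fps_nth u 0 \<noteq> 0 \<and> a = u * a' \<and> b = u * b' \<and> c = u * c'"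
proof -
  have *: "fps_nth u 0 \<noteq> 0" if "a = u * a'" "b = u * b'" "c = u * c'" for u
    using assms(1) that by (auto simp: centred_def)
  have div: "x = (x * inverse y) * y" if "fps_nth y 0 \<noteq> 0" for x y :: "complex fps"
    using that by (simp add: mult.assoc inverse_mult_eq_1)
  consider "fps_nth c' 0 \<noteq> 0" | "fps_nth a' 0 \<noteq> 0" | "fps_nth b' 0 \<noteq> 0"
    using assms(2) by (auto simp: centred_def)
  then obtain u where "a = u * a'" "b = u * b'" "c = u * c'"
  proof cases
    case 1
    define u where "u = c * inverse c'"
    have c: "c = u * c'" unfolding u_def by (rule div[OF 1])
    have "a * c' = (u * a') * c'" "b * c' = (u * b') * c'"
      using assms(5,6) unfolding c by (simp_all only: mult_ac)
    hence "a = u * a'" "b = u * b'" using assms(4) by simp_all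
    with that[of u] c show ?thesis by blast
  next
    case 2
    define u where "u = a * inverse a'"
    have a: "a = u * a'" unfolding u_def by (rule div[OF 2])
    have "c * a' = (u * c') * a'" using assms(5) unfolding a by (simp only: mult_ac)
    moreover have "a' \<noteq> 0" using 2 by auto
    ultimately have c: "c = u * c'" by simp
    have "b * c' = (u * b') * c'" using assms(6) unfolding c by (simp only: mult_ac)
    hence "b = u * b'" using assms(4) by simp
    with that[of u] a c show ?thesis by blast
  next
    case 3
    define u where "u = b * inverse b'"
    have b: "b = u * b'" unfolding u_def by (rule div[OF 3])
    have "c * b' = (u * c') * b'" using assms(6) unfolding b by (simp only: mult_ac)
    moreover have "b' \<noteq> 0" using 3 by auto
    ultimately have c: "c = u * c'" by simp
    have "a * c' = (u * a') * c'" using assms(5) unfolding c by (simp only: mult_ac)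
    hence "a = u * a'" using assms(4) by simp
    with that[of u] b c show ?thesis by blast
  qed
  with * show ?thesis by blast
qed

section \<open>Arcs as points over the Laurent series\<close>

abbreviation "\<F> \<equiv> (fps_to_fls :: complex fps \<Rightarrow> complex fls)"

lemma form_on_line_at_infinity:
  "form_eval e d g (a, b, 0) = (\<Sum>i\<le>d. e (g i (d - i)) * a ^ i * b ^ (d - i))"
  unfolding form_eval_def prod.case
proof (rule sum.cong[OF refl])
  fix i assume "i \<in> {..d}"
  have "(\<Sum>j\<le>d - i. e (g i j) * a ^ i * b ^ j * 0 ^ (d - i - j)) =
     (\<Sum>j\<in>{d - i}. e (g i j) * a ^ i * b ^ j * 0 ^ (d - i - j))"
    by (rule sum.mono_neutral_right) (auto simp: power_0_left)
  thus "(\<Sum>j\<le>d - i. e (g i j) * a ^ i * b ^ j * 0 ^ (d - i - j)) = e (g i (d - i)) * a ^ i * b ^ (d - i)"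
    by simp
qed

definition branch_arcs :: "(complex \<times> complex) set \<Rightarrow> arc set" where
  "branch_arcs C = {p. centred_at_infinity p \<and> primitive_arc p \<and> arc_on_projective_closure C p}"

lemma branches_at_infinity_altdef: "branches_at_infinity C = (\<lambda>p. arc_equiv `` {p}) ` branch_arcs C"
  by (auto simp: branches_at_infinity_def branch_arcs_def quotient_def)

text \<open>An arc inside the line at infinity would satisfy the leading form of \<open>F\<close>,
  so the ratio of its coordinates would be algebraic and hence constant, and a constant arc is not
  primitive.\<close>

lemma branch_arc_not_in_line:
  fixes F :: "complex poly poly"
  assumes "C = {p. eval2 F p = 0}" "F \<noteq> 0" "(a, b, c) \<in> branch_arcs C"
  shows "c \<noteq> 0"
proof
  assume c: "c = 0"
  \<comment> \<open>The exact total degree is taken, so that the form of degree \<open>d\<close>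
    does not vanish identically on the line at infinity.\<close>
  define P where "P = (\<lambda>d. \<forall>i j. i + j > d \<longrightarrow> coeff (coeff F j) i = 0)"
  define d where "d = (LEAST d. P d)"
  have "\<exists>d. P d" using total_degree_bound[of F] unfolding P_def by metis
  hence d: "P d" unfolding d_def by (rule LeastI_ex)
  have "\<exists>i j. i + j = d \<and> coeff (coeff F j) i \<noteq> 0"
  proof (rule ccontr)
    assume no: "\<not> ?thesis"
    have "P (d - 1)"
      unfolding P_def
    proof safe
      fix i j assume "d - 1 < i + j"
      thus "coeff (coeff F j) i = 0" using no d unfolding P_def by (cases "i + j = d") auto
    qed
    hence "d = 0" using Least_le[of P "d - 1"] unfolding d_def[symmetric] by linarith
    have "F = 0"
    proof (intro poly_eqI)
      fix i j
      show "coeff (coeff F j) i = coeff (coeff 0 j) i"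
        using no d \<open>d = 0\<close> unfolding P_def by (cases "i + j = 0") auto
    qed
    thus False using assms(2) by simp
  qed
  then obtain k l where kl: "k + l = d" "coeff (coeff F l) k \<noteq> 0" by blast
  define g where "g = (\<lambda>i j. coeff (coeff F j) i)"
  \<comment> \<open>The leading form of \<open>F\<close>, dehomogenized to a polynomial in the ratio
    of the first two coordinates.\<close>
  define h where "h = (\<Sum>i\<le>d. monom (g i (d - i)) i)"
  have h: "coeff h i = (if i \<le> d then g i (d - i) else 0)" for i
    by (simp add: h_def coeff_sum)
  have "coeff h k \<noteq> 0" using kl by (auto simp: h g_def)
  hence "h \<noteq> 0" by auto
  have dh: "degree h \<le> d" by (rule degree_le) (simp add: h)
  have "form_eval (\<lambda>c. c) d g (x, y, 1) = 0" if "(x, y) \<in> C" for x y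
    using form_eval_eq_ev[OF comm_hom_id, of d F 1 x y] d that assms(1)
    unfolding g_def P_def by (simp add: ev_id)
  hence "form_eval fps_const d g (a, b, 0) = 0"
    using assms(3) c unfolding branch_arcs_def arc_on_projective_closure_def by blast
  hence "\<F> (form_eval fps_const d g (a, b, 0)) = 0" by simp
  hence "form_eval fls_const d g (\<F> a, \<F> b, 0) = 0"
    by (simp add: comm_hom.hom_form_eval[OF comm_hom_fps_to_fls])
  moreover have "form_eval fls_const d g (\<F> a, \<F> b, 0) = hom2 fls_const d h (\<F> a) (\<F> b)"
    unfolding form_on_line_at_infinity hom2_def by (intro sum.cong) (auto simp: h)
  ultimately have 0: "hom2 fls_const d h (\<F> a) (\<F> b) = 0" by simp
  have "\<exists>u k k'. fps_nth u 0 \<noteq> 0 \<and> a = u * fps_const k \<and> b = u * fps_const k'"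
  proof (cases "b = 0")
    case True
    thus ?thesis using assms(3) c
      by (intro exI[of _ a] exI[of _ 1] exI[of _ 0])
        (auto simp: branch_arcs_def centred_at_infinity_def centred_def)
  next
    case False
    have "poly (map_poly fls_const h) (\<F> a / \<F> b) = 0"
      using 0 False dh by (simp add: hom2_field)
    then obtain k where "\<F> a / \<F> b = fls_const k"
      using constant_if_algebraic[OF comm_hom_fls_const \<open>h \<noteq> 0\<close>] by blast
    hence "\<F> a = \<F> (b * fps_const k)" using False by (simp add: field_simps fls_times_fps_to_fls)
    hence a: "a = b * fps_const k" by simp
    show ?thesis
      by (intro exI[of _ b] exI[of _ k] exI[of _ 1])
        (use a assms(3) c in \<open>auto simp: branch_arcs_def centred_at_infinity_def centred_def\<close>)
  qed
  then obtain u k k' where u: "fps_nth u 0 \<noteq> 0" "a = u * fps_const k" "b = u * fps_const k'" by blast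
  hence "(a, b, c) = arc_transform u 0 (fps_const k, fps_const k', 0)"
    by (simp add: arc_transform_def c)
  hence "\<not> primitive_arc (a, b, c)"
    unfolding primitive_arc_def using u(1) by (metis fps_zero_nth)
  thus False using assms(3) by (simp add: branch_arcs_def)
qed

definition arc_point :: "arc \<Rightarrow> complex fls \<times> complex fls" where
  "arc_point = (\<lambda>(a, b, c). (\<F> a / \<F> c, \<F> b / \<F> c))"

lemma ev_arc_point_eq_0:
  assumes "arc_on_projective_closure C (a, b, c)" "c \<noteq> 0" "\<And>p. p \<in> C \<Longrightarrow> eval2 W p = 0"
  shows "ev fls_const (arc_point (a, b, c)) W = 0"
proof -
  obtain d where d: "\<And>i j. i + j > d \<Longrightarrow> coeff (coeff W j) i = 0"
    using total_degree_bound[of W] by blast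
  define g where "g = (\<lambda>i j. coeff (coeff W j) i)"
  have "form_eval (\<lambda>c. c) d g (x, y, 1) = 0" if "(x, y) \<in> C" for x y
    using form_eval_eq_ev[where d = d and W = W and c = 1 and a = x and b = y, OF comm_hom_id d] that assms(3)
    unfolding g_def by (simp add: ev_id)
  hence "form_eval fps_const d g (a, b, c) = 0"
    using assms(1) unfolding arc_on_projective_closure_def by blast
  hence "\<F> (form_eval fps_const d g (a, b, c)) = 0" by simp
  hence "form_eval fls_const d g (\<F> a, \<F> b, \<F> c) = 0"
    by (simp add: comm_hom.hom_form_eval[OF comm_hom_fps_to_fls])
  thus ?thesis
    using form_eval_eq_ev[where d = d and W = W and c = "\<F> c" and a = "\<F> a" and b = "\<F> b",
        OF comm_hom_fls_const d] assms(2)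
    by (simp add: g_def arc_point_def)
qed

text \<open>Constant affine coordinates would make \<open>a\<close> and \<open>b\<close> multiples
  of \<open>c\<close>, so all three would vanish at the origin of the parameter and the arc would
  have no centre.\<close>

lemma arc_point_nonconstant:
  assumes "centred_at_infinity (a, b, c)" "c \<noteq> 0"
  shows "\<not> (\<exists>k. \<F> a / \<F> c = fls_const k) \<or> \<not> (\<exists>k. \<F> b / \<F> c = fls_const k)"
proof (rule ccontr)
  assume "\<not> ?thesis"
  then obtain k k' where "\<F> a / \<F> c = fls_const k" "\<F> b / \<F> c = fls_const k'" by blast
  hence "\<F> a = \<F> (fps_const k * c)" "\<F> b = \<F> (fps_const k' * c)"
    using assms(2) by (simp_all add: field_simps fls_times_fps_to_fls)
  hence "a = fps_const k * c" "b = fps_const k' * c" by simp_all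
  thus False using assms(1) by (simp add: centred_at_infinity_def centred_def)
qed

text \<open>Taylor expansion of the projective parametrization at \<open>r\<close>, with local
  parameter \<open>t - r\<close>.\<close>

definition poly_arc :: "complex poly \<Rightarrow> complex poly \<Rightarrow> complex poly \<Rightarrow> complex \<Rightarrow> arc" where
  "poly_arc G1 G2 G3 r = (fps_of_poly (pcompose G1 [:r, 1:]), fps_of_poly (pcompose G2 [:r, 1:]),
     fps_of_poly (pcompose G3 [:r, 1:]))"

lemma fps_of_pcompose:
  assumes "fps_nth \<tau> 0 = 0"
  shows "\<F> (fps_of_poly (pcompose G [:r, 1:]) oo \<tau>) = poly (map_poly fls_const G) (fls_const r + \<F> \<tau>)"
proof (induction G)
  case (pCons c G)
  have lin: "fps_of_poly [:r, 1:] oo \<tau> = fps_const r + \<tau>"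
    using assms by (simp add: fps_of_poly_pCons fps_compose_add_distrib fps_X_fps_compose_startby0)
  have eq: "fps_of_poly (pcompose (pCons c G) [:r, 1:])
      = fps_const c + fps_of_poly [:r, 1:] * fps_of_poly (pcompose G [:r, 1:])"
    by (simp only: pcompose_pCons fps_of_poly_add fps_of_poly_mult fps_of_poly_const)
  show ?case unfolding eq using pCons assms lin
    by (simp add: map_poly_pCons fps_compose_add_distrib fps_compose_mult_distrib fls_times_fps_to_fls)
qed simp

lemma fps_of_pcompose_X:
  "\<F> (fps_of_poly (pcompose G [:r, 1:])) = poly (map_poly fls_const G) (fls_const r + fls_X)"
  using fps_of_pcompose[of fps_X G r] by simp

text \<open>The orders of \<open>Y\<close> and \<open>\<tau>\<close> multiply to the order of
  \<open>fls_X\<close>, which is one. A negative order of \<open>Y\<close> is contradictory because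
  \<open>\<tau>\<close> has positive order.\<close>

lemma fls_compose_eq_X:
  fixes \<tau> :: "complex fps"
  assumes "\<tau> \<noteq> 0" "fps_nth \<tau> 0 = 0" "fls_compose_fps Y \<tau> = fls_X"
  shows "fps_nth \<tau> 1 \<noteq> 0"
proof (cases "fls_subdegree Y \<ge> 0")
  case True
  define y where "y = fls_regpart Y"
  have "Y = \<F> y" using True by (simp add: y_def)
  hence "\<F> (y oo \<tau>) = \<F> fps_X" using assms by simp
  hence "y oo \<tau> = fps_X" by (simp only: fps_to_fls_eq_iff)
  hence "fps_nth y 1 * fps_nth \<tau> 1 = 1" using fps_compose_nth_1[OF assms(2), of y] by simp
  thus ?thesis by auto
next
  case False
  define y where "y = fls_regpart (inverse Y)"
  have "Y \<noteq> 0" using False by auto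
  hence "inverse Y = \<F> y" using False by (simp add: y_def)
  hence "\<F> (y oo \<tau>) = inverse fls_X"
    using assms by (metis fls_compose_fps_inverse fls_compose_fps_to_fls)
  hence "\<F> ((y oo \<tau>) * fps_X) = \<F> 1" by (simp add: fls_times_fps_to_fls)
  hence "(y oo \<tau>) * fps_X = 1" by (simp only: fps_to_fls_eq_iff)
  hence "fps_nth ((y oo \<tau>) * fps_X) 0 = 1" by simp
  thus ?thesis by simp
qed

text \<open>The value of \<open>N/D\<close> along the arc. It may have a pole, which happens for the
  branch over the parameter at infinity.\<close>

definition arc_parameter :: "complex poly poly \<Rightarrow> complex poly poly \<Rightarrow> arc \<Rightarrow> complex fls" where
  "arc_parameter N D p = ev fls_const (arc_point p) N / ev fls_const (arc_point p) D"

lemma ev_arc_point_transform: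
  assumes "\<tau> \<noteq> 0" "fps_nth \<tau> 0 = 0" "u \<noteq> 0"
  shows "ev fls_const (arc_point (arc_transform u \<tau> p)) W = fls_compose_fps (ev fls_const (arc_point p) W) \<tau>"
proof -
  interpret comm_hom "\<lambda>F. fls_compose_fps F \<tau>" by (rule comm_hom_fls_compose) fact+
  obtain a b c where p: "p = (a, b, c)" by (cases p)
  have pt: "arc_point (arc_transform u \<tau> p) =
      (fls_compose_fps (\<F> a / \<F> c) \<tau>, fls_compose_fps (\<F> b / \<F> c) \<tau>)"
    using assms by (simp add: p arc_point_def arc_transform_def fls_times_fps_to_fls fls_compose_fps_divide)
  have 2: "map_poly (\<lambda>F. fls_compose_fps F \<tau>) (map_poly fls_const p) = map_poly fls_const p" for p
    by (simp add: map_poly_map_poly o_def)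
  have "map_poly (map_poly (\<lambda>F. fls_compose_fps F \<tau>)) (map_poly (map_poly fls_const) W)
     = map_poly (map_poly fls_const) W"
    by (subst map_poly_map_poly) (simp_all add: o_def 2)
  thus ?thesis unfolding pt unfolding ev_def p arc_point_def by (simp add: hom_eval2)
qed

lemma arc_parameter_transform:
  assumes "\<tau> \<noteq> 0" "fps_nth \<tau> 0 = 0" "u \<noteq> 0"
  shows "arc_parameter N D (arc_transform u \<tau> p) = fls_compose_fps (arc_parameter N D p) \<tau>"
  using assms by (simp add: arc_parameter_def ev_arc_point_transform fls_compose_fps_divide)

lemma arc_parameter_equiv:
  assumes "(p, q) \<in> arc_equiv"
  obtains \<tau> where "\<tau> \<noteq> 0" "fps_nth \<tau> 0 = 0" "arc_parameter N D q = fls_compose_fps (arc_parameter N D p) \<tau>"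
proof -
  obtain u \<tau> where u: "fps_nth u 0 \<noteq> 0" "fps_nth \<tau> 0 = 0" "fps_nth \<tau> 1 \<noteq> 0"
      "q = arc_transform u \<tau> p" using assms by (auto simp: arc_equiv_def)
  have "u \<noteq> 0" "\<tau> \<noteq> 0" using u by auto
  with that u arc_parameter_transform[of \<tau> u N D p] show ?thesis by blast
qed

section \<open>Branches at infinity as poles of the parametrization\<close>

context gen_param
begin

abbreviation "pole_arc \<equiv> poly_arc G1 G2 G3"

text \<open>A generically valid identity between polynomials in \<open>t\<close> is a formal one, so
  after homogenizing \<open>N\<close> and \<open>D\<close> in a common degree the parameter may be
  replaced by an element \<open>T\<close> of any extension field.\<close>

lemma ev_inverse_ND:
  fixes e :: "complex \<Rightarrow> 'k::field"
  assumes e: "comm_hom e" and nz: "poly (map_poly e G3) T \<noteq> 0"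
  defines "p \<equiv> (poly (map_poly e G1) T / poly (map_poly e G3) T, poly (map_poly e G2) T / poly (map_poly e G3) T)"
  shows "ev e p N = T * ev e p D"
proof -
  obtain d1 where d1: "\<And>i j. i + j > d1 \<Longrightarrow> coeff (coeff N j) i = 0"
    using total_degree_bound[of N] by blast
  obtain d2 where d2: "\<And>i j. i + j > d2 \<Longrightarrow> coeff (coeff D j) i = 0"
    using total_degree_bound[of D] by blast
  define d where "d = max d1 d2"
  have dN: "\<And>i j. i + j > d \<Longrightarrow> coeff (coeff N j) i = 0"
    and dD: "\<And>i j. i + j > d \<Longrightarrow> coeff (coeff D j) i = 0" using d1 d2 by (auto simp: d_def)
  define M where "M = (\<lambda>W. form_eval (\<lambda>c. [:c:]) d (\<lambda>i j. coeff (coeff W j) i) (G1, G2, G3))"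
  have M: "poly (M W) t = poly G3 t ^ d * eval2 W (f t)"
    if "poly G3 t \<noteq> 0" "\<And>i j. i + j > d \<Longrightarrow> coeff (coeff W j) i = 0" for W t
    using comm_hom.hom_form_eval[OF comm_hom_poly[of t], of "\<lambda>c. [:c:]" d "\<lambda>i j. coeff (coeff W j) i" G1 G2 G3]
      form_eval_eq_ev[OF comm_hom_id that(2,1)] by (simp add: M_def ev_id par_def)
  have "MOST t. poly (M N) t = poly ([:0, 1:] * M D) t"
    using inverse_ND eventually_poly_nonzero[OF G3_nz]
    by eventually_elim (simp add: M dN dD)
  hence MND: "M N = [:0, 1:] * M D" by (rule poly_eq_if_eventually)
  interpret h: comm_hom "\<lambda>G. poly (map_poly e G) T"
    by (rule comm_hom_compose[OF comm_hom_poly comm_hom.comm_hom_map_poly[OF e]])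
  have K: "poly (map_poly e (M W)) T = poly (map_poly e G3) T ^ d * ev e p W"
    if "\<And>i j. i + j > d \<Longrightarrow> coeff (coeff W j) i = 0" for W
    unfolding M_def p_def
    using form_eval_eq_ev[OF e that nz] by (simp add: h.hom_form_eval map_poly_pCons comm_hom.hom_0[OF e])
  have "poly (map_poly e (M N)) T = T * poly (map_poly e (M D)) T"
    by (simp only: MND h.hom_mult) (simp add: map_poly_pCons comm_hom.hom_0[OF e] comm_hom.hom_1[OF e])
  thus ?thesis using nz by (simp add: K dN dD)
qed

text \<open>An arc centred at infinity is a nonconstant point over the Laurent series, so neither
  \<open>D\<close> nor the homogenized third coordinate vanishes on it, and its parameter reproduces
  it.\<close>

lemma branch_arc_parameter:
  assumes p: "arc_on_projective_closure C (a, b, c)" "centred_at_infinity (a, b, c)" and c: "c \<noteq> 0"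
  defines "T \<equiv> arc_parameter N D (a, b, c)"
  shows "ev fls_const (arc_point (a, b, c)) D \<noteq> 0" "poly (map_poly fls_const G3) T \<noteq> 0"
    "\<F> a / \<F> c = poly (map_poly fls_const G1) T / poly (map_poly fls_const G3) T"
    "\<F> b / \<F> c = poly (map_poly fls_const G2) T / poly (map_poly fls_const G3) T"
proof -
  have pt: "ev fls_const (\<F> a / \<F> c, \<F> b / \<F> c) W = 0" if "\<forall>p\<in>C. eval2 W p = 0" for W
    using ev_arc_point_eq_0[OF p(1) c] that by (simp add: arc_point_def)
  note nv = nonvanishing_at_point[OF comm_hom_fls_const pt arc_point_nonconstant[OF p(2) c]]
  note D = nv[OF _ D_generic]
  note G = nv[OF _ hom2_generic[OF bound(3) G3_nz]]
  show "ev fls_const (arc_point (a, b, c)) D \<noteq> 0" using D by (simp add: arc_point_def)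
  show "poly (map_poly fls_const G3) T \<noteq> 0"
    "\<F> a / \<F> c = poly (map_poly fls_const G1) T / poly (map_poly fls_const G3) T"
    "\<F> b / \<F> c = poly (map_poly fls_const G2) T / poly (map_poly fls_const G3) T"
    using parameter_of_point[OF comm_hom_fls_const pt D G] by (simp_all add: T_def arc_parameter_def arc_point_def)
qed

text \<open>Writing the parameter as \<open>r + \<tau>\<close>, the arc is the expansion at
  \<open>r\<close> reparametrized by \<open>\<tau>\<close> up to a unit. Primitivity then forces
  \<open>\<tau>\<close> to have order one, and the centre at infinity forces \<open>G3\<close> to
  vanish at \<open>r\<close>.\<close>

lemma branch_arc_at_pole:
  assumes p: "(a, b, c) \<in> branch_arcs C" and c: "c \<noteq> 0"
    and T: "fls_subdegree (arc_parameter N D (a, b, c)) \<ge> 0"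
  shows "poly G3 (fls_nth (arc_parameter N D (a, b, c)) 0) = 0"
    "(pole_arc (fls_nth (arc_parameter N D (a, b, c)) 0), (a, b, c)) \<in> arc_equiv"
proof -
  define T where "T = arc_parameter N D (a, b, c)"
  define r where "r = fls_nth T 0"
  define \<tau> where "\<tau> = fls_regpart T - fps_const r"
  have \<tau>0: "fps_nth \<tau> 0 = 0" by (simp add: \<tau>_def r_def)
  have T\<tau>: "T = fls_const r + \<F> \<tau>" using T by (simp add: \<tau>_def T_def)
  have arc: "arc_on_projective_closure C (a, b, c)" "centred_at_infinity (a, b, c)" "primitive_arc (a, b, c)"
    using p by (auto simp: branch_arcs_def)
  define \<gamma> where "\<gamma> = (\<lambda>G. fps_of_poly (pcompose G [:r, 1:]) oo \<tau>)"
  have \<gamma>: "\<F> (\<gamma> G) = poly (map_poly fls_const G) T" for G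
    unfolding \<gamma>_def T\<tau> by (rule fps_of_pcompose[OF \<tau>0])
  have \<gamma>0: "fps_nth (\<gamma> G) 0 = poly G r" for G
    by (simp add: \<gamma>_def poly_pcompose flip: poly_0_coeff_0)
  note bp = branch_arc_parameter[OF arc(1,2) c, folded T_def]
  have nz: "\<gamma> G3 \<noteq> 0" using bp(2) \<gamma>[of G3] by auto
  have "\<F> (a * \<gamma> G3) = \<F> (\<gamma> G1 * c)" "\<F> (b * \<gamma> G3) = \<F> (\<gamma> G2 * c)"
    using bp(2-4) c by (simp_all add: fls_times_fps_to_fls \<gamma> field_simps)
  hence "a * \<gamma> G3 = \<gamma> G1 * c" "b * \<gamma> G3 = \<gamma> G2 * c" by simp_all
  moreover have "centred (\<gamma> G1, \<gamma> G2, \<gamma> G3)"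
    using no_common_zero[of r] by (auto simp: centred_def \<gamma>0)
  moreover have "centred (a, b, c)" using arc(2) by (simp add: centred_at_infinity_def)
  ultimately obtain u where u: "fps_nth u 0 \<noteq> 0" "a = u * \<gamma> G1" "b = u * \<gamma> G2" "c = u * \<gamma> G3"
    using proportional_centred_arcs[of a b c "\<gamma> G1" "\<gamma> G2" "\<gamma> G3"] c nz by blast
  have tr: "(a, b, c) = arc_transform u \<tau> (pole_arc r)"
    using u by (simp add: arc_transform_def poly_arc_def \<gamma>_def)
  have "fps_nth \<tau> 1 \<noteq> 0"
    using arc(3) tr u(1) \<tau>0 unfolding primitive_arc_def by blast
  hence "(pole_arc r, (a, b, c)) \<in> arc_equiv"
    using tr u(1) \<tau>0 unfolding arc_equiv_def by blast
  thus "(pole_arc (fls_nth (arc_parameter N D (a, b, c)) 0), (a, b, c)) \<in> arc_equiv"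
    by (simp add: T_def r_def)
  have "fps_nth c 0 = 0" using arc(2) by (simp add: centred_at_infinity_def)
  hence "poly G3 r = 0"
    using u(1) unfolding u(4) by (simp add: \<gamma>0)
  thus "poly G3 (fls_nth (arc_parameter N D (a, b, c)) 0) = 0"
    by (simp add: T_def r_def)
qed

lemma pole_arc_third_nonzero: "fps_of_poly (pcompose G3 [:r, 1:]) \<noteq> 0"
proof -
  have "pcompose G3 [:r, 1:] \<noteq> 0" using G3_nz by (subst pcompose_eq_0_iff) auto
  thus ?thesis using fps_of_poly_eq_iff[of _ 0] by simp
qed

lemma pole_arc_on_closure: "arc_on_projective_closure C (pole_arc r)"
  unfolding arc_on_projective_closure_def
proof (intro allI impI)
  fix d g assume *: "\<forall>(x, y)\<in>C. form_eval (\<lambda>c. c) d g (x, y, 1) = 0"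
  define W :: "complex poly poly" where "W = (\<Sum>i\<le>d. \<Sum>j\<le>d - i. monom (monom (g i j) i) j)"
  have W: "eval2 W (x, y) = form_eval (\<lambda>c. c) d g (x, y, 1)" for x y
    by (simp add: W_def eval2_hom_simps eval2_monom form_eval_def)
  hence Wf: "MOST t. eval2 W (f t) = 0" using * vanish_iff[of W] by fastforce
  define M where "M = form_eval (\<lambda>c. [:c:]) d g (G1, G2, G3)"
  have "MOST t. poly M t = 0"
    using Wf eventually_poly_nonzero[OF G3_nz]
  proof eventually_elim
    case (elim t)
    let ?x = "poly G1 t / poly G3 t" and ?y = "poly G2 t / poly G3 t" and ?z = "poly G3 t"
    have "poly M t = form_eval (\<lambda>c. c) d g (?z * ?x, ?z * ?y, ?z * 1)"
      using comm_hom.hom_form_eval[OF comm_hom_poly[of t], of "\<lambda>c. [:c:]" d g G1 G2 G3] elim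
      by (simp add: M_def)
    also have "\<dots> = ?z ^ d * form_eval (\<lambda>c. c) d g (?x, ?y, 1)"
      unfolding form_eval_def prod.case sum_distrib_left
    proof (intro sum.cong refl)
      fix i j assume "i \<in> {..d}" "j \<in> {..d - i}"
      hence "i + j + (d - i - j) = d" by auto
      then obtain k where k: "d - i - j = k" "d = i + j + k" by metis
      show "g i j * (?z * ?x) ^ i * (?z * ?y) ^ j * (?z * 1) ^ (d - i - j) =
        ?z ^ d * (g i j * ?x ^ i * ?y ^ j * 1 ^ (d - i - j))"
        unfolding k(1) unfolding k(2) power_mult_distrib power_add by (simp only: mult_ac power_one mult_1_right)
    qed
    also have "form_eval (\<lambda>c. c) d g (?x, ?y, 1) = 0" using elim W by (simp add: par_def)
    finally show ?case by simp
  qed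
  hence "M = 0" by (rule poly_eq_0_if_eventually)
  interpret h: comm_hom "\<lambda>G. fps_of_poly (pcompose G [:r, 1:] :: complex poly)"
    by (simp add: comm_hom_def pcompose_add pcompose_mult fps_of_poly_add fps_of_poly_mult pcompose_1)
  have "form_eval fps_const d g (pole_arc r) = fps_of_poly (pcompose M [:r, 1:])"
    unfolding M_def h.hom_form_eval by (simp add: poly_arc_def fps_of_poly_const)
  thus "form_eval fps_const d g (pole_arc r) = 0" by (simp add: \<open>M = 0\<close>)
qed

lemma pole_arc_centred:
  assumes "poly G3 r = 0"
  shows "centred_at_infinity (pole_arc r)"
  using assms no_common_zero[of r]
  by (auto simp: centred_at_infinity_def centred_def poly_arc_def poly_pcompose simp flip: poly_0_coeff_0)

text \<open>\<open>N/D\<close> recovers the parameter along the expansion at a pole. The term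
  \<open>fls_X\<close> of order one will yield primitivity, and the constant term will separate the
  poles.\<close>

lemma pole_arc_parameter:
  assumes "poly G3 r = 0"
  shows "arc_parameter N D (pole_arc r) = fls_const r + fls_X"
    "ev fls_const (arc_point (pole_arc r)) D \<noteq> 0"
proof -
  have c: "centred_at_infinity (pole_arc r)" "arc_on_projective_closure C (pole_arc r)"
    using pole_arc_centred[OF assms] pole_arc_on_closure by blast+
  show D: "ev fls_const (arc_point (pole_arc r)) D \<noteq> 0"
    using branch_arc_parameter(1)[OF _ _ pole_arc_third_nonzero[of r]] c by (simp add: poly_arc_def)
  have "poly (map_poly fls_const G3) (fls_const r + fls_X) \<noteq> 0"
    using pole_arc_third_nonzero[of r] by (simp flip: fps_of_pcompose_X)
  from ev_inverse_ND[OF comm_hom_fls_const this]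
  have "ev fls_const (arc_point (pole_arc r)) N = (fls_const r + fls_X) * ev fls_const (arc_point (pole_arc r)) D"
    by (simp add: arc_point_def poly_arc_def flip: fps_of_pcompose_X)
  thus "arc_parameter N D (pole_arc r) = fls_const r + fls_X"
    using D by (simp add: arc_parameter_def)
qed

lemma pole_arc_in_branch_arcs:
  assumes "poly G3 r = 0"
  shows "pole_arc r \<in> branch_arcs C"
proof -
  have "primitive_arc (pole_arc r)"
    unfolding primitive_arc_def
  proof (rule notI, elim exE conjE)
    fix q u \<tau> assume u: "fps_nth u 0 \<noteq> 0" "fps_nth \<tau> 0 = 0" "fps_nth \<tau> 1 = 0" "pole_arc r = arc_transform u \<tau> q"
    obtain a b c where q: "q = (a, b, c)" by (cases q)
    have c: "fps_of_poly (pcompose G3 [:r, 1:]) = u * (c oo \<tau>)"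
      using u(4) by (simp add: q arc_transform_def poly_arc_def)
    show False
    \<comment> \<open>For \<open>\<tau> = 0\<close> the third coordinate is a unit times a constant
      and vanishes at the origin, hence is zero.\<close>
    proof (cases "\<tau> = 0")
      case True
      have "fps_nth (fps_of_poly (pcompose G3 [:r, 1:])) 0 = 0"
        using pole_arc_centred[OF assms] by (simp add: poly_arc_def centred_at_infinity_def)
      hence "fps_of_poly (pcompose G3 [:r, 1:]) = 0" using u(1) unfolding c by (simp add: True)
      thus False using pole_arc_third_nonzero by simp
    next
      case False
      have "u \<noteq> 0" using u(1) by auto
      have "fls_compose_fps (arc_parameter N D q) \<tau> = fls_const r + fls_X"
        using arc_parameter_transform[OF False u(2) \<open>u \<noteq> 0\<close>, of N D q] pole_arc_parameter(1)[OF assms]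
        by (simp add: u(4))
      hence "fls_compose_fps (arc_parameter N D q - fls_const r) \<tau> = fls_X"
        using False u(2) by (simp add: fls_compose_fps_diff)
      from fls_compose_eq_X[OF False u(2) this] show False using u(3) by simp
    qed
  qed
  thus ?thesis using pole_arc_centred[OF assms] pole_arc_on_closure by (simp add: branch_arcs_def)
qed

text \<open>A change of the local parameter that fixes the origin preserves the constant term of the
  value of \<open>N/D\<close>, which is the pole.\<close>

lemma pole_arc_equivD:
  assumes "poly G3 r = 0" "poly G3 s = 0" "(pole_arc r, pole_arc s) \<in> arc_equiv"
  shows "r = s"
proof -
  obtain \<tau> where \<tau>: "\<tau> \<noteq> 0" "fps_nth \<tau> 0 = 0"
    "arc_parameter N D (pole_arc s) = fls_compose_fps (arc_parameter N D (pole_arc r)) \<tau>"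
    using arc_parameter_equiv[OF assms(3)] .
  have "fls_const s + fls_X = fls_const r + \<F> \<tau>"
    using \<tau> assms by (simp add: pole_arc_parameter fls_compose_fps_add)
  hence "fls_nth (fls_const s + fls_X) 0 = fls_nth (fls_const r + \<F> \<tau>) 0" by simp
  thus ?thesis using \<tau>(2) by simp
qed

text \<open>The parametrization in the coordinate \<open>1/z\<close>: the parameter at infinity
  becomes \<open>0\<close>, so the results about finite poles apply to it.\<close>

abbreviation "rev_poly \<equiv> mob 0 1 1 0 bound"
abbreviation "infinity_arc \<equiv> poly_arc (rev_poly G1) (rev_poly G2) (rev_poly G3) 0"

lemma bound_attained: "coeff G1 bound \<noteq> 0 \<or> coeff G2 bound \<noteq> 0 \<or> coeff G3 bound \<noteq> 0"
proof (cases "bound = 0")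
  case True
  hence "degree G3 = 0" by (simp add: bound_def)
  thus ?thesis using G3_nz True leading_coeff_neq_0 by metis
next
  case False
  hence "bound = degree G1 \<and> G1 \<noteq> 0 \<or> bound = degree G2 \<and> G2 \<noteq> 0 \<or> bound = degree G3 \<and> G3 \<noteq> 0"
    unfolding bound_def by (auto simp: max_def split: if_splits)
  thus ?thesis using leading_coeff_neq_0 by metis
qed

lemma gen_param_reverse:
  "gen_param C (rev_poly G1) (rev_poly G2) (rev_poly G3) (const2 0 * N - const2 1 * D) (const2 0 * D - const2 1 * N)"
  by (rule gen_param_mob) (use bound bound_attained in auto)

lemma poly_rev_0: "degree G \<le> bound \<Longrightarrow> poly (rev_poly G) 0 = coeff G bound"
  by (simp add: poly_mob_hom2 hom2_0_right)

lemma arc_parameter_reverse: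
  "arc_parameter (const2 0 * N - const2 1 * D) (const2 0 * D - const2 1 * N) p = inverse (arc_parameter N D p)"
proof -
  interpret comm_hom "ev fls_const (arc_point p)" by (rule comm_hom_ev[OF comm_hom_fls_const])
  show ?thesis by (simp add: arc_parameter_def hom_simps ev_vars[OF comm_hom_fls_const])
qed

text \<open>If the value of \<open>N/D\<close> on the arc is a power series, its constant term is a
  zero of \<open>G3\<close>; otherwise its inverse has zero constant term, and the reversed
  parametrization places the arc over the parameter at infinity.\<close>

lemma branch_arcs_cases:
  assumes C: "C = {p. eval2 F p = 0}" "F \<noteq> 0" and p: "p \<in> branch_arcs C"
  shows "(\<exists>r. poly G3 r = 0 \<and> (pole_arc r, p) \<in> arc_equiv) \<or>
    (coeff G3 bound = 0 \<and> (infinity_arc, p) \<in> arc_equiv)"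
proof -
  obtain a b c where abc: "p = (a, b, c)" by (cases p)
  have c: "c \<noteq> 0" using branch_arc_not_in_line[OF C] p abc by blast
  let ?T = "arc_parameter N D (a, b, c)"
  show ?thesis
  proof (cases "fls_subdegree ?T \<ge> 0")
    case True
    thus ?thesis using branch_arc_at_pole[OF _ c] p abc by blast
  next
    case False
    interpret R: gen_param C "rev_poly G1" "rev_poly G2" "rev_poly G3" "const2 0 * N - const2 1 * D" "const2 0 * D - const2 1 * N"
      by (rule gen_param_reverse)
    have T: "?T \<noteq> 0" using False by auto
    have 0: "fls_nth (inverse ?T) 0 = 0" by (rule fls_eq0_below_subdegree) (use False T in simp)
    have sub: "fls_subdegree (inverse ?T) \<ge> 0" using False T by simp
    have "poly (rev_poly G3) 0 = 0 \<and> (infinity_arc, p) \<in> arc_equiv"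
      using R.branch_arc_at_pole[of a b c, unfolded arc_parameter_reverse, OF _ c sub, unfolded 0] p abc
      by blast
    thus ?thesis using poly_rev_0[OF bound(3)] by auto
  qed
qed

lemma infinity_arc_in_branch_arcs:
  assumes "coeff G3 bound = 0"
  shows "infinity_arc \<in> branch_arcs C"
  using gen_param.pole_arc_in_branch_arcs[OF gen_param_reverse, of 0] poly_rev_0[OF bound(3)] assms by simp

text \<open>On one arc the value of \<open>N/D\<close> is a power series, on the other it has a
  pole, and reparametrization preserves this difference.\<close>

lemma pole_arc_not_equiv_infinity_arc:
  assumes "poly G3 r = 0" "coeff G3 bound = 0"
  shows "(pole_arc r, infinity_arc) \<notin> arc_equiv"
proof
  assume "(pole_arc r, infinity_arc) \<in> arc_equiv"
  then obtain \<tau> where \<tau>: "\<tau> \<noteq> 0" "fps_nth \<tau> 0 = 0"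
    "arc_parameter N D infinity_arc = fls_compose_fps (arc_parameter N D (pole_arc r)) \<tau>"
    using arc_parameter_equiv by metis
  have "inverse (arc_parameter N D infinity_arc) = fls_const 0 + fls_X"
    using gen_param.pole_arc_parameter(1)[OF gen_param_reverse, of 0, unfolded arc_parameter_reverse]
      poly_rev_0[OF bound(3)] assms(2) by simp
  moreover have "arc_parameter N D infinity_arc = \<F> (fps_const r + \<tau>)"
    using \<tau> assms by (simp add: pole_arc_parameter fls_compose_fps_add)
  ultimately have "inverse (\<F> (fps_const r + \<tau>)) = fls_X" by simp
  moreover have "fls_X \<noteq> (0 :: complex fls)" by simp
  ultimately have "\<F> (fps_const r + \<tau>) * fls_X = 1"
    by (metis inverse_zero right_inverse)
  hence "\<F> ((fps_const r + \<tau>) * fps_X) = \<F> 1" by (simp add: fls_times_fps_to_fls)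
  hence "(fps_const r + \<tau>) * fps_X = 1" by (simp only: fps_to_fls_eq_iff)
  hence "fps_nth ((fps_const r + \<tau>) * fps_X) 0 = 1" by simp
  thus False by simp
qed

end

section \<open>Symmetric Laurent parametrizations\<close>

lemma inj_on_cis: "inj_on cis {0..<2 * pi}"
proof (rule inj_onI)
  fix s t assume st: "s \<in> {0..<2 * pi}" "t \<in> {0..<2 * pi}" "cis s = cis t"
  hence "cis (s - t) = 1" by (simp flip: cis_divide)
  hence "cos (s - t) = 1" by (simp add: complex_eq_iff)
  then obtain x :: int where x: "s - t = of_int x * 2 * pi" using cos_one_2pi_int by blast
  have "\<bar>s - t\<bar> < 2 * pi" using st by auto
  hence "\<bar>of_int x\<bar> * (2 * pi) < 1 * (2 * pi)" unfolding x by (simp add: abs_mult)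
  hence "\<bar>of_int x :: real\<bar> < 1" by (subst (asm) mult_less_cancel_right) auto
  hence "x = 0" by linarith
  thus "s = t" using x by simp
qed

lemma cis_image_circle: "cis ` {0..<2 * pi} = {z. norm z = 1}"
proof safe
  fix z :: complex assume "norm z = 1"
  hence "(Re z)\<^sup>2 + (Im z)\<^sup>2 = 1" by (simp add: cmod_def)
  then obtain t where "0 \<le> t" "t < 2 * pi" "Re z = cos t" "Im z = sin t" by (rule sincos_total_2pi)
  thus "z \<in> cis ` {0..<2 * pi}" by (intro image_eqI[of _ _ t]) (auto simp: complex_eq_iff)
qed simp

lemma infinite_circle: "infinite {z :: complex. norm z = 1}"
  unfolding cis_image_circle[symmetric] finite_image_iff[OF inj_on_cis] by (rule infinite_Ico) simp

lemma rat_generic_if_infinite: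
  assumes "rat u" "infinite {t. u t = 0}"
  shows "MOST t. u t = 0"
  using rat_dichotomy[OF assms(1)] assms(2) by (auto simp: eventually_cofinite)

lemma trig_poly_iff: "trig_poly X \<longleftrightarrow> (\<exists>P. \<forall>t. X t = 2 * Re (poly P (cis t)))"
proof
  assume "trig_poly X"
  then obtain n a b where X: "\<And>t. X t = (\<Sum>k\<le>n. a k * cos (real k * t) + b k * sin (real k * t))"
    unfolding trig_poly_def by blast
  \<comment> \<open>Half of \<open>a k - i * b k\<close>: doubling the real part after
    multiplication by \<open>cis t ^ k\<close> restores the two real coefficients.\<close>
  define P where "P = (\<Sum>k\<le>n. monom (Complex (a k / 2) (- b k / 2)) k)"
  have "X t = 2 * Re (poly P (cis t))" for t
    unfolding X P_def poly_sum poly_monom Re_sum sum_distrib_left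
    by (intro sum.cong) (auto simp: Complex.DeMoivre algebra_simps)
  thus "\<exists>P. \<forall>t. X t = 2 * Re (poly P (cis t))" by blast
next
  assume "\<exists>P. \<forall>t. X t = 2 * Re (poly P (cis t))"
  then obtain P where X: "\<And>t. X t = 2 * Re (poly P (cis t))" by blast
  have "X t = (\<Sum>k\<le>degree P. 2 * Re (coeff P k) * cos (real k * t) + (- 2 * Im (coeff P k)) * sin (real k * t))" for t
    unfolding X poly_altdef Re_sum sum_distrib_left
    by (intro sum.cong) (auto simp: Complex.DeMoivre algebra_simps)
  thus "trig_poly X" unfolding trig_poly_def
    by (intro exI[of _ "degree P"] exI[of _ "\<lambda>k. 2 * Re (coeff P k)"] exI[of _ "\<lambda>k. - 2 * Im (coeff P k)"]) auto
qed

section \<open>Laurent polynomials symmetric under reflection in the unit circle\<close>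

definition lp :: "complex poly \<Rightarrow> complex \<Rightarrow> complex" where
  "lp P z = poly P z + poly (map_poly cnj P) (inverse z)"

lemma lp_altdef: "lp P z = poly P z + cnj (poly P (inverse (cnj z)))"
  by (simp add: lp_def)

lemma lp_reflect: "lp P (inverse (cnj z)) = cnj (lp P z)"
  by (simp add: lp_altdef)

lemma lp_circle: "norm z = 1 \<Longrightarrow> lp P z = complex_of_real (2 * Re (poly P z))"
proof -
  assume "norm z = 1"
  hence "z * cnj z = 1" by (simp add: complex_norm_square[symmetric])
  hence "inverse (cnj z) = z" by (metis inverse_unique mult.commute)
  thus ?thesis unfolding lp_altdef by (simp only:) (simp add: complex_eq_iff)
qed

text \<open>The numerator of \<open>lp P\<close> over \<open>z ^ n\<close>, of formal degree
  \<open>2 * n\<close>. For positive \<open>n\<close> its two extreme coefficients are the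
  coefficient of \<open>P\<close> at \<open>n\<close> and its conjugate.\<close>

definition lp_num :: "nat \<Rightarrow> complex poly \<Rightarrow> complex poly" where
  "lp_num n P = monom 1 n * P + (\<Sum>k\<le>n. monom (cnj (coeff P k)) (n - k))"

lemma poly_lp_num:
  assumes "z \<noteq> 0" "degree P \<le> n"
  shows "poly (lp_num n P) z = z ^ n * lp P z"
proof -
  have "poly (map_poly cnj P) (inverse z) = (\<Sum>k\<le>n. cnj (coeff P k) * inverse z ^ k)"
    by (rule poly_map_poly_altdef) (use assms in auto)
  hence "z ^ n * poly (map_poly cnj P) (inverse z) = (\<Sum>k\<le>n. cnj (coeff P k) * z ^ (n - k))"
    using assms(1) by (auto simp: sum_distrib_left power_diff field_simps intro!: sum.cong)
  thus ?thesis by (simp add: lp_def lp_num_def poly_monom poly_sum algebra_simps)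
qed

lemma degree_lp_num: "degree P \<le> n \<Longrightarrow> degree (lp_num n P) \<le> 2 * n"
proof (rule degree_le, intro allI impI)
  fix i assume "degree P \<le> n" "2 * n < i"
  thus "coeff (lp_num n P) i = 0"
    by (auto simp: lp_num_def coeff_monom_mult coeff_sum coeff_eq_0 intro!: sum.neutral)
qed

lemma coeff_lp_num_top: "0 < n \<Longrightarrow> coeff (lp_num n P) (2 * n) = coeff P n"
  by (auto simp: lp_num_def coeff_monom_mult coeff_sum intro!: sum.neutral)

lemma poly_lp_num_0: "0 < n \<Longrightarrow> poly (lp_num n P) 0 = cnj (coeff P n)"
proof -
  have "(\<Sum>k\<le>n. cnj (coeff P k) * 0 ^ (n - k)) = (\<Sum>k\<in>{n}. cnj (coeff P k) * 0 ^ (n - k))"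
    by (rule sum.mono_neutral_right) (auto simp: power_0_left)
  moreover assume "0 < n"
  ultimately show ?thesis by (simp add: lp_num_def poly_monom poly_sum)
qed

lemma poly_eq_if_eq_nonzero:
  assumes "\<And>z. z \<noteq> 0 \<Longrightarrow> poly p z = poly (q :: complex poly) z"
  shows "p = q"
proof (rule poly_eq_if_eventually)
  show "MOST z. poly p z = poly q z"
    using eventually_nonzero by eventually_elim (rule assms)
qed

text \<open>Reflection symmetry makes the numerator conjugate-reciprocal. This is what identifies
  the arc over infinity with the conjugate of the arc over \<open>0\<close>.\<close>

lemma rev_lp_num:
  assumes "degree P \<le> n"
  shows "mob 0 1 1 0 (2 * n) (lp_num n P) = map_poly cnj (lp_num n P)"
proof (rule poly_eq_if_eq_nonzero)
  fix z :: complex assume z: "z \<noteq> 0"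
  have "poly (mob 0 1 1 0 (2 * n) (lp_num n P)) z = z ^ (2 * n) * poly (lp_num n P) (inverse z)"
    using poly_mob[of "lp_num n P" "2 * n" 1 z 0 0 1] degree_lp_num[OF assms] z by (simp add: divide_inverse)
  also have "\<dots> = z ^ n * lp P (inverse z)"
    using z assms by (simp add: poly_lp_num power_mult power2_eq_square power_mult_distrib flip: power_inverse) (simp add: field_simps)
  also have "\<dots> = cnj (poly (lp_num n P) (cnj z))"
    using z assms lp_reflect[of P "cnj z"] by (simp add: poly_lp_num)
  finally show "poly (mob 0 1 1 0 (2 * n) (lp_num n P)) z = poly (map_poly cnj (lp_num n P)) z"
    by simp
qed

lemma rev_monom: "mob 0 1 1 0 (2 * n) (monom 1 n) = monom 1 n"
proof (rule poly_eq_if_eq_nonzero)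
  fix z :: complex assume z: "z \<noteq> 0"
  have "degree (monom (1::complex) n) \<le> 2 * n" by (simp add: degree_monom_eq)
  thus "poly (mob 0 1 1 0 (2 * n) (monom 1 n)) z = poly (monom 1 n) z"
    using poly_mob[of "monom 1 n" "2 * n" 1 z 0 0 1] z
    by (simp add: poly_monom power_divide power_mult power2_eq_square power_mult_distrib)
qed

lemma fps_of_poly_map_cnj: "fps_of_poly (map_poly cnj p) = fps_cnj (fps_of_poly p)"
  by (simp add: fps_eq_iff coeff_map_poly)

lemma coeff_max_degree_nonzero:
  assumes "n = max (degree P) (degree Q)" "0 < n"
  shows "coeff P n \<noteq> 0 \<or> coeff Q n \<noteq> 0"
proof -
  have "n = degree P \<and> P \<noteq> 0 \<or> n = degree Q \<and> Q \<noteq> 0" using assms by (auto simp: max_def split: if_splits)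
  thus ?thesis using leading_coeff_neq_0 by metis
qed

section \<open>Branches and real points of a symmetrically parametrized curve\<close>

locale symmetric_param =
  fixes C :: "(complex \<times> complex) set" and F :: "complex poly poly"
    and P Q :: "complex poly" and n :: nat and N D :: "complex poly poly"
  assumes C: "C = {p. eval2 F p = 0}" and F: "F \<noteq> 0"
    and n: "n = max (degree P) (degree Q)" "0 < n"
    and gp: "gen_param C (lp_num n P) (lp_num n Q) (monom 1 n) N D"
begin

sublocale gen_param C "lp_num n P" "lp_num n Q" "monom 1 n" N D by (rule gp)

lemma deg: "degree P \<le> n" "degree Q \<le> n" by (simp_all add: n(1))

lemma f_eq: "z \<noteq> 0 \<Longrightarrow> f z = (lp P z, lp Q z)"
  by (simp add: par_def poly_lp_num deg poly_monom)

lemmas top_nonzero = coeff_max_degree_nonzero[OF n]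

lemma bound_eq: "bound = 2 * n"
proof -
  have "degree (lp_num n P) \<ge> 2 * n \<or> degree (lp_num n Q) \<ge> 2 * n"
    using top_nonzero coeff_lp_num_top[OF n(2)] by (metis le_degree)
  thus ?thesis using degree_lp_num[OF deg(1)] degree_lp_num[OF deg(2)]
    by (auto simp: bound_def degree_monom_eq)
qed

lemma monom_top: "coeff (monom (1::complex) n) bound = 0"
  using n(2) by (simp add: bound_eq)

lemma pole_0: "poly (monom 1 n) (0::complex) = 0"
  using n(2) by (simp add: poly_monom)

lemma infinity_arc_eq: "infinity_arc = conj_arc (pole_arc 0)"
proof -
  have "map_poly cnj (monom 1 n) = monom 1 n" by (simp add: map_poly_monom)
  thus ?thesis
    unfolding bound_eq rev_lp_num[OF deg(1)] rev_lp_num[OF deg(2)] rev_monom poly_arc_def conj_arc_def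
      pcompose_idR prod.case fps_of_poly_map_cnj[symmetric] by simp
qed

text \<open>The only finite pole is \<open>0\<close> and the other one is at infinity; their arcs
  are conjugate by \<open>infinity_arc_eq\<close> but inequivalent.\<close>

lemma branches:
  "\<exists>B. B \<noteq> conj_branch B \<and> branches_at_infinity C = {B, conj_branch B}"
proof (intro exI conjI)
  let ?B = "arc_equiv `` {pole_arc 0}"
  have conj: "conj_branch ?B = arc_equiv `` {infinity_arc}"
    by (simp add: conj_branch_class infinity_arc_eq)
  show "?B \<noteq> conj_branch ?B"
    unfolding conj arc_class_eq_iff using pole_arc_not_equiv_infinity_arc[OF pole_0 monom_top] .
  have 1: "pole_arc 0 \<in> branch_arcs C" by (rule pole_arc_in_branch_arcs[OF pole_0])
  have 2: "infinity_arc \<in> branch_arcs C" by (rule infinity_arc_in_branch_arcs[OF monom_top])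
  have 3: "arc_equiv `` {p} \<in> {?B, arc_equiv `` {infinity_arc}}" if "p \<in> branch_arcs C" for p
  proof -
    have "poly (monom 1 n) r = 0 \<longleftrightarrow> r = 0" for r :: complex using n(2) by (simp add: poly_monom)
    with branch_arcs_cases[OF C F that]
    have "(pole_arc 0, p) \<in> arc_equiv \<or> (infinity_arc, p) \<in> arc_equiv"
      by (auto simp del: coeff_monom)
    hence "arc_equiv `` {pole_arc 0} = arc_equiv `` {p} \<or> arc_equiv `` {infinity_arc} = arc_equiv `` {p}"
      unfolding arc_class_eq_iff .
    thus ?thesis by (metis insertI1 insertI2)
  qed
  show "branches_at_infinity C = {?B, conj_branch ?B}"
    unfolding conj branches_at_infinity_altdef
  proof (intro equalityI subsetI)
    fix x assume "x \<in> (\<lambda>p. arc_equiv `` {p}) ` branch_arcs C"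
    thus "x \<in> {?B, arc_equiv `` {infinity_arc}}" using 3 by blast
  next
    fix x assume "x \<in> {?B, arc_equiv `` {infinity_arc}}"
    thus "x \<in> (\<lambda>p. arc_equiv `` {p}) ` branch_arcs C" using 1 2 by blast
  qed
qed

definition bad :: "complex set" where
  "bad = {t. \<not> (t \<noteq> 0 \<and> eval2 D (f t) \<noteq> 0 \<and> eval2 N (f t) = t * eval2 D (f t))}"

lemma finite_bad: "finite bad"
proof -
  from eventually_conj[OF eventually_nonzero inverse_ND] show ?thesis by (simp add: bad_def eventually_cofinite)
qed

lemma good_inverse: "t \<notin> bad \<Longrightarrow> eval2 N (f t) / eval2 D (f t) = t"
  by (simp add: bad_def)

lemma f_circle:
  assumes "norm z = 1"
  shows "f z = (complex_of_real (2 * Re (poly P z)), complex_of_real (2 * Re (poly Q z)))"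
  using assms f_eq[of z] lp_circle[OF assms] by fastforce

lemma nonzero_iff: "poly (monom 1 n) z \<noteq> 0 \<longleftrightarrow> z \<noteq> (0::complex)"
  using n(2) by (simp add: poly_monom)

lemma infinite_real_points: "infinite (real_points C)"
proof -
  let ?S = "{z. norm z = 1} - bad"
  have "infinite ?S" using infinite_circle finite_bad by (rule Diff_infinite_finite[rotated])
  moreover have "inj_on f ?S" by (rule inj_onI) (metis DiffD2 good_inverse)
  ultimately have "infinite (f ` ?S)" by (simp add: finite_image_iff)
  moreover have "f ` ?S \<subseteq> real_points C"
  proof (rule image_subsetI)
    fix z assume z: "z \<in> ?S"
    hence "z \<noteq> 0" by auto
    hence "f z \<in> C" using par_in_zero_set[OF C] by (simp add: nonzero_iff)
    moreover have "fst (f z) \<in> \<real>" "snd (f z) \<in> \<real>" using f_circle[of z] z by auto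
    ultimately show "f z \<in> real_points C" by (simp add: real_points_def)
  qed
  ultimately show ?thesis using finite_subset by blast
qed

lemma trigonometric_if_real:
  assumes "real_plane_curve C"
  shows "trigonometric C"
  unfolding trigonometric_def
proof (intro conjI exI)
  let ?X = "\<lambda>t. 2 * Re (poly P (cis t))" and ?Y = "\<lambda>t. 2 * Re (poly Q (cis t))"
  let ?I = "{0..<2 * pi}"
  show "real_plane_curve C" by fact
  show "trig_poly ?X" "trig_poly ?Y" unfolding trig_poly_iff by blast+
  have fc: "f (cis t) = (complex_of_real (?X t), complex_of_real (?Y t))" for t
    by (rule f_circle) simp
  \<comment> \<open>Two circle parameters with the same image cannot both be good; a good one is
    recovered as the value of \<open>N/D\<close> at the image of the bad one, so both lie in this
    finite set.\<close>
  let ?A = "bad \<union> (\<lambda>s. eval2 N (f s) / eval2 D (f s)) ` bad"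
  have "{t \<in> ?I. \<exists>s\<in>?I. s \<noteq> t \<and> ?X s = ?X t \<and> ?Y s = ?Y t} \<subseteq> cis -` ?A \<inter> ?I"
  proof (safe, goal_cases)
    case (1 t s)
    hence eq: "f (cis s) = f (cis t)" unfolding fc by simp
    have ne: "cis s \<noteq> cis t" using 1 inj_onD[OF inj_on_cis, of s t] by auto
    show ?case
    proof (cases "cis t \<in> bad")
      case False
      hence t: "eval2 N (f (cis t)) / eval2 D (f (cis t)) = cis t" by (rule good_inverse)
      have "cis s \<in> bad" using good_inverse[of "cis s"] eq t ne by auto
      hence "cis t \<in> (\<lambda>s. eval2 N (f s) / eval2 D (f s)) ` bad"
        by (intro image_eqI[of _ _ "cis s"]) (simp_all add: eq t)
      thus ?thesis by simp
    qed simp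
  qed
  moreover have "finite (cis -` ?A \<inter> ?I)"
    by (rule finite_vimage_IntI[OF _ inj_on_cis]) (use finite_bad in auto)
  ultimately show "finite {t \<in> ?I. \<exists>s\<in>?I. s \<noteq> t \<and> ?X s = ?X t \<and> ?Y s = ?Y t}"
    by (rule finite_subset)
  have img: "(\<lambda>t. (complex_of_real (?X t), complex_of_real (?Y t))) ` ?I = f ` {z. norm z = 1}"
    unfolding cis_image_circle[symmetric] image_image fc ..
  show "C = zariski_closure ((\<lambda>t. (complex_of_real (?X t), complex_of_real (?Y t))) ` ?I)"
    unfolding img
  proof (intro equalityI subsetI)
    fix p assume p: "p \<in> C"
    show "p \<in> zariski_closure (f ` {z. norm z = 1})"
      unfolding zariski_closure_def
    proof (intro CollectI allI impI)
      fix W assume W: "\<forall>q\<in>f ` {z. norm z = 1}. eval2 W q = 0"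
      have "infinite {t. eval2 W (f t) = 0}"
        by (rule infinite_super[OF _ infinite_circle]) (use W in auto)
      moreover have "rat (\<lambda>t. eval2 W (f t))" using rat_eval2[OF rat_par] by simp
      ultimately have "MOST t. eval2 W (f t) = 0" by (intro rat_generic_if_infinite)
      thus "eval2 W p = 0" using vanish_iff p by blast
    qed
  next
    fix p assume p: "p \<in> zariski_closure (f ` {z. norm z = 1})"
    have "eval2 F q = 0" if q: "q \<in> f ` {z. norm z = 1}" for q
    proof -
      obtain z where z: "norm z = 1" "q = f z" using q by auto
      hence "z \<noteq> 0" by auto
      hence "f z \<in> C" using par_in_zero_set[OF C] by (simp add: nonzero_iff)
      thus ?thesis using C z by auto
    qed
    thus "p \<in> C" using p C by (auto simp: zariski_closure_def)
  qed
qed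

end

lemma symmetric_param_if_birational:
  assumes C: "C = {p. eval2 F p = 0}" "F \<noteq> 0"
    and b: "birational_parametrization (- {0}) (\<lambda>z. (lp P z, lp Q z)) C"
  shows "\<exists>n N D. symmetric_param C F P Q n N D"
proof -
  let ?f = "\<lambda>z. (lp P z, lp Q z)"
  obtain N D where *: "?f ` (- {0}) \<subseteq> C"
     "finite {t \<in> - {0}. \<not> (eval2 D (?f t) \<noteq> 0 \<and> eval2 N (?f t) / eval2 D (?f t) = t)}"
     "finite {p \<in> C. \<not> (eval2 D p \<noteq> 0 \<and> eval2 N p / eval2 D p \<in> - {0} \<and> ?f (eval2 N p / eval2 D p) = p)}"
    using b unfolding birational_parametrization_def by blast
  define n where "n = max (degree P) (degree Q)"
  \<comment> \<open>Constant \<open>P\<close> and \<open>Q\<close> would give a constant map, which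
    has no generic inverse.\<close>
  have n: "0 < n"
  proof (rule ccontr)
    assume "\<not> 0 < n"
    hence "degree P = 0" "degree Q = 0" by (simp_all add: n_def)
    then obtain a b where "P = [:a:]" "Q = [:b:]" by (metis degree_0_id)
    hence eq: "?f t = ?f 1" for t by (simp add: lp_def map_poly_pCons)
    have "{t \<in> - {0}. t \<noteq> eval2 N (?f 1) / eval2 D (?f 1)} \<subseteq>
      {t \<in> - {0}. \<not> (eval2 D (?f t) \<noteq> 0 \<and> eval2 N (?f t) / eval2 D (?f t) = t)}"
    proof (safe, goal_cases)
      case (1 t)
      thus ?case using eq[of t] by metis
    qed
    with *(2) have "finite {t \<in> - {0}. t \<noteq> eval2 N (?f 1) / eval2 D (?f 1)}" by (rule finite_subset[rotated])
    hence "finite (insert 0 (insert (eval2 N (?f 1) / eval2 D (?f 1)) {t \<in> - {0}. t \<noteq> eval2 N (?f 1) / eval2 D (?f 1)}))"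
      by simp
    also have "(insert 0 (insert (eval2 N (?f 1) / eval2 D (?f 1)) {t \<in> - {0}. t \<noteq> eval2 N (?f 1) / eval2 D (?f 1)})) = UNIV"
      by auto
    finally show False using infinite_UNIV_char_0[where 'a = complex] by simp
  qed
  have deg: "degree P \<le> n" "degree Q \<le> n" by (auto simp: n_def)
  note top = coeff_max_degree_nonzero[OF n_def n]
  have "gen_param C (lp_num n P) (lp_num n Q) (monom 1 n) N D"
  proof (rule gen_param_if_birational[OF C(1) _ *(1) _ _ _ *(2,3)])
    show "(lp P t, lp Q t) = par (lp_num n P) (lp_num n Q) (monom 1 n) t" if "t \<in> - {0}" for t
      using that deg by (simp add: par_def poly_lp_num poly_monom)
    show "poly (lp_num n P) t \<noteq> 0 \<or> poly (lp_num n Q) t \<noteq> 0 \<or> poly (monom 1 n) t \<noteq> 0" for t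
      using top n by (cases "t = 0") (auto simp: poly_lp_num_0 poly_monom)
  qed auto
  thus ?thesis using n C unfolding symmetric_param_def n_def by blast
qed

section \<open>Lifting complex conjugation\<close>

lemma only_zero_root_imp_monom:
  fixes p :: "complex poly"
  assumes "p \<noteq> 0" "\<And>z. poly p z = 0 \<Longrightarrow> z = 0"
  shows "\<exists>c m. c \<noteq> 0 \<and> p = monom c m"
  using assms
proof (induction "degree p" arbitrary: p)
  case 0
  then obtain c where "p = [:c:]" by (metis degree_0_id)
  thus ?case using 0 by (intro exI[of _ c] exI[of _ 0]) (simp add: monom_0)
next
  case (Suc n)
  have "\<not> constant (poly p)" using Suc.hyps(2) by (simp add: constant_degree)
  then obtain z where "poly p z = 0" using fundamental_theorem_of_algebra by blast
  hence "poly p 0 = 0" using Suc.prems(2) by blast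
  then obtain q where q: "p = [:- 0, 1:] * q" unfolding poly_eq_0_iff_dvd by (elim dvdE)
  have "q \<noteq> 0" using q Suc.prems(1) by auto
  hence n: "n = degree q" using Suc.hyps(2) unfolding q by (subst (asm) degree_mult_eq) auto
  have "z = 0" if "poly q z = 0" for z by (rule Suc.prems(2)) (simp add: q that)
  from Suc.hyps(1)[OF n \<open>q \<noteq> 0\<close> this] obtain c m where "c \<noteq> 0" "q = monom c m" by blast
  thus ?case by (intro exI[of _ c] exI[of _ "Suc m"]) (simp add: q monom_Suc)
qed

section \<open>Moving the two poles to zero and infinity\<close>

lemma coeff_mult_degree_bound:
  assumes "degree p \<le> m" "degree q \<le> k"
  shows "coeff (p * q) (m + k) = coeff p m * coeff q k"
proof (cases "degree p = m \<and> degree q = k")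
  case True
  thus ?thesis using coeff_mult_degree_sum[of p q] by simp
next
  case False
  hence "degree p < m \<or> degree q < k" using assms by auto
  moreover from this have "degree (p * q) < m + k" using degree_mult_le[of p q] assms by linarith
  ultimately show ?thesis by (auto simp: coeff_eq_0)
qed

lemma degree_linear_power: "degree ([:b, a:] ^ j) \<le> j"
  using degree_power_le[of "[:b, a:]" j] by (rule order.trans) (simp add: degree_pCons_eq_if)

lemma coeff_linear_power_top: "coeff ([:b, a:] ^ j) j = (a :: 'a::comm_ring_1) ^ j"
proof (induction j)
  case (Suc j)
  have "coeff ([:b, a:] * [:b, a:] ^ j) (1 + j) = coeff [:b, a:] 1 * coeff ([:b, a:] ^ j) j"
    by (rule coeff_mult_degree_bound) (auto simp: degree_linear_power)
  thus ?case using Suc by simp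
qed simp

lemma degree_mob: "degree (mob a b c d n G) \<le> n"
  unfolding mob_def hom2_def
proof (rule degree_sum_le)
  fix j assume "j \<in> {..n}"
  have "degree ([:coeff G j:] * [:b, a:] ^ j * [:d, c:] ^ (n - j)) \<le> 0 + j + (n - j)"
    by (intro order.trans[OF degree_mult_le] add_mono degree_linear_power) auto
  thus "degree ([:coeff G j:] * [:b, a:] ^ j * [:d, c:] ^ (n - j)) \<le> n" using \<open>j \<in> {..n}\<close> by simp
qed simp

lemma coeff_mob_top: "coeff (mob a b c d n G) n = hom2 (\<lambda>z. z) n G a c"
  unfolding mob_def hom2_def coeff_sum
proof (rule sum.cong[OF refl])
  fix j assume j: "j \<in> {..n}"
  have "coeff ([:b, a:] ^ j * [:d, c:] ^ (n - j)) (j + (n - j)) = a ^ j * c ^ (n - j)"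
    by (subst coeff_mult_degree_bound) (auto simp: degree_linear_power coeff_linear_power_top)
  thus "coeff ([:coeff G j:] * [:b, a:] ^ j * [:d, c:] ^ (n - j)) n = coeff G j * a ^ j * c ^ (n - j)"
    using j by (simp add: mult.assoc)
qed

lemma (in gen_param) bound_eqI:
  assumes "degree G1 \<le> n" "degree G2 \<le> n" "degree G3 \<le> n"
    "coeff G1 n \<noteq> 0 \<or> coeff G2 n \<noteq> 0 \<or> coeff G3 n \<noteq> 0"
  shows "bound = n"
  using assms(1-3) le_degree[of G1 n] le_degree[of G2 n] le_degree[of G3 n] assms(4)
  by (auto simp: bound_def)

text \<open>The substitution \<open>r + 1/z\<close> moves a parameter \<open>r\<close> that is not a
  pole to infinity, after which all poles are finite.\<close>

lemma (in gen_param) regular_at_infinity: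
  "\<exists>G1 G2 G3 N D. gen_param C G1 G2 G3 N D \<and> coeff G3 (gen_param.bound G1 G2 G3) \<noteq> 0"
proof -
  obtain r where r: "poly G3 r \<noteq> 0" using G3_nz poly_all_0_iff_0 by blast
  let ?m = "mob r 1 1 0 bound"
  have gp: "gen_param C (?m G1) (?m G2) (?m G3) (const2 0 * N - const2 1 * D) (const2 r * D - const2 1 * N)"
    by (rule gen_param_mob) (use bound bound_attained in auto)
  have "coeff (?m G3) bound = poly G3 r"
    using hom2_complex[OF bound(3), of 1 r] by (simp add: coeff_mob_top)
  moreover from this have "gen_param.bound (?m G1) (?m G2) (?m G3) = bound"
    by (intro gen_param.bound_eqI[OF gp]) (use r degree_mob in auto)
  ultimately show ?thesis using gp r by metis
qed

text \<open>With no pole at infinity, poles and branches correspond bijectively, so there are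
  exactly two poles \<open>p\<close> and \<open>q\<close>. Once they sit at \<open>0\<close> and
  infinity, the third coordinate has no root but \<open>0\<close> and is a monomial.\<close>

lemma (in gen_param) two_poles_normal_form:
  assumes C: "C = {p. eval2 F p = 0}" "F \<noteq> 0"
    and top: "coeff G3 bound \<noteq> 0"
    and B: "B \<noteq> B'" "branches_at_infinity C = {B, B'}"
  shows "\<exists>G1 G2 c m N D. gen_param C G1 G2 (monom c m) N D \<and> c \<noteq> 0 \<and> 0 < m \<and>
     m < gen_param.bound G1 G2 (monom c m)"
proof -
  let ?cl = "\<lambda>r. arc_equiv `` {pole_arc r}"
  have br: "branches_at_infinity C = ?cl ` {r. poly G3 r = 0}"
    unfolding branches_at_infinity_altdef
  proof (intro equalityI image_subsetI)
    fix p assume "p \<in> branch_arcs C"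
    then obtain r where r: "poly G3 r = 0" "(pole_arc r, p) \<in> arc_equiv"
      using branch_arcs_cases[OF C] top by blast
    from r(2) have "?cl r = arc_equiv `` {p}" unfolding arc_class_eq_iff .
    thus "arc_equiv `` {p} \<in> ?cl ` {r. poly G3 r = 0}"
      by (intro image_eqI[of _ _ r]) (simp_all add: r(1))
  next
    fix r assume "r \<in> {r. poly G3 r = 0}"
    thus "?cl r \<in> (\<lambda>p. arc_equiv `` {p}) ` branch_arcs C"
      using pole_arc_in_branch_arcs by blast
  qed
  have inj: "r = s" if "poly G3 r = 0" "poly G3 s = 0" "?cl r = ?cl s" for r s
    by (rule pole_arc_equivD[OF that(1,2)]) (use that(3) in \<open>unfold arc_class_eq_iff\<close>)
  have "B \<in> ?cl ` {r. poly G3 r = 0}" "B' \<in> ?cl ` {r. poly G3 r = 0}"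
    unfolding br[symmetric] B(2) by simp_all
  then obtain p q where pq: "poly G3 p = 0" "poly G3 q = 0" "?cl p = B" "?cl q = B'"
    by (elim imageE) simp
  have "p \<noteq> q" using pq B(1) by auto
  have only: "r = p \<or> r = q" if "poly G3 r = 0" for r
  proof -
    have "?cl r \<in> {B, B'}" unfolding B(2)[symmetric] br by (rule imageI) (simp add: that)
    thus ?thesis using inj[OF that pq(1)] inj[OF that pq(2)] pq(3,4) by auto
  qed
  \<comment> \<open>Sends \<open>0\<close> to \<open>p\<close>, infinity to \<open>q\<close>, and
    \<open>1\<close> to infinity.\<close>
  let ?m = "mob (- q) p (- 1) 1 bound"
  have gp: "gen_param C (?m G1) (?m G2) (?m G3) (const2 1 * N - const2 p * D) (const2 (- q) * D - const2 (- 1) * N)"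
    by (rule gen_param_mob) (use \<open>p \<noteq> q\<close> bound bound_attained in auto)
  have root: "z = 0" if "poly (?m G3) z = 0" for z
  \<comment> \<open>At \<open>z = 1\<close> the substitution is infinite; the value there is
    governed by the nonzero top coefficient of \<open>G3\<close>.\<close>
  proof (cases "z = 1")
    case True
    thus ?thesis using that top \<open>p \<noteq> q\<close> by (simp add: poly_mob_hom2 hom2_0_right)
  next
    case False
    hence nz: "1 - z \<noteq> 0" by simp
    let ?t = "(- q * z + p) / (- 1 * z + 1)"
    have "poly G3 ?t = 0" using poly_mob[OF bound(3), of "- 1" z 1 "- q" p] nz that by simp
    hence "?t = p \<or> ?t = q" by (rule only)
    hence "- q * z + p = p * (1 - z) \<or> - q * z + p = q * (1 - z)" using nz by (auto simp: field_simps)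
    hence "z * (p - q) = 0 \<or> p = q" by (auto simp: algebra_simps)
    thus ?thesis using \<open>p \<noteq> q\<close> by auto
  qed
  obtain c m where cm: "c \<noteq> 0" "?m G3 = monom c m"
    using only_zero_root_imp_monom[OF gen_param.G3_nz[OF gp] root] by blast
  have "poly (?m G3) 0 = 0" using poly_mob[OF bound(3), of "- 1" 0 1 "- q" p] pq(1) by simp
  hence "0 < m" using cm by (cases m) (auto simp: poly_monom)
  \<comment> \<open>The formal top coefficient is, up to sign, the value at \<open>q\<close>. The
    third one vanishes there while one of the others does not, which puts \<open>m\<close> strictly
    below the bound.\<close>
  have tops: "coeff (?m G) bound = (- 1) ^ bound * poly G q" if "degree G \<le> bound" for G
    using hom2_complex[OF that, of "- 1" "- q"] by (simp add: coeff_mob_top)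
  have "coeff (?m G3) bound = 0" by (simp add: tops bound pq)
  moreover have "coeff (?m G1) bound \<noteq> 0 \<or> coeff (?m G2) bound \<noteq> 0"
    using no_common_zero[of q] pq(2) by (simp add: tops bound)
  ultimately have "m \<noteq> bound" and b: "gen_param.bound (?m G1) (?m G2) (?m G3) = bound"
    using cm gen_param.bound_eqI[OF gp degree_mob degree_mob degree_mob] by auto
  moreover have "m \<le> bound" using degree_mob[of "- q" p "- 1" 1 bound G3] cm by (simp add: degree_monom_eq)
  ultimately show ?thesis using gp cm \<open>0 < m\<close>
    by (intro exI[of _ "?m G1"] exI[of _ "?m G2"] exI[of _ c] exI[of _ m] exI conjI) (auto simp: cm(2))
qed

lemma eventually_cnj: "(MOST t. P (cnj t)) \<longleftrightarrow> (MOST t. P t)"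
proof -
  have "{t. \<not> P (cnj t)} = cnj ` {t. \<not> P t}"
    by (auto intro: image_eqI[of _ _ "cnj _"])
  thus ?thesis by (simp add: eventually_cofinite finite_image_iff inj_on_def)
qed

lemma rat_coprime:
  assumes "rat u"
  obtains A E where "E \<noteq> 0" "\<And>t. poly A t \<noteq> 0 \<or> poly E t \<noteq> 0"
    "MOST t. poly E t \<noteq> 0 \<and> u t = poly A t / poly E t"
proof -
  obtain A0 E0 where 0: "E0 \<noteq> 0" "MOST t. u t = poly A0 t / poly E0 t"
    using assms by (auto simp: rat_def)
  from remove_common_zeros[OF 0(1), of A0 0] obtain H A G E where
    H: "A0 = H * A" "0 = H * G" "E0 = H * E" "\<And>t. poly A t \<noteq> 0 \<or> poly G t \<noteq> 0 \<or> poly E t \<noteq> 0"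
    by blast
  have nz: "H \<noteq> 0" "E \<noteq> 0" using H 0(1) by auto
  hence "G = 0" using H(2) by simp
  show ?thesis
  proof (rule that[OF nz(2)])
    show "poly A t \<noteq> 0 \<or> poly E t \<noteq> 0" for t using H(4)[of t] \<open>G = 0\<close> by simp
    show "MOST t. poly E t \<noteq> 0 \<and> u t = poly A t / poly E t"
      using 0(2) eventually_poly_nonzero[OF nz(1)] eventually_poly_nonzero[OF nz(2)]
      by eventually_elim (simp add: H)
  qed
qed

lemma eval2_cnj:
  "eval2 (map_poly (map_poly cnj) W) (cnj x, cnj y) = cnj (eval2 W (x, y))"
  using comm_hom.hom_eval2[OF comm_hom_cnj, of W x y] by simp

lemma laurent_split:
  "\<exists>A B. \<forall>z. z \<noteq> 0 \<longrightarrow> poly G z / z ^ m = poly A z + poly B (inverse (z :: complex))"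
proof (induction m arbitrary: G)
  case 0
  show ?case by (intro exI[of _ G] exI[of _ 0]) simp
next
  case (Suc m)
  obtain g H where G: "G = pCons g H" by (cases G)
  obtain A B where AB: "\<And>z. z \<noteq> 0 \<Longrightarrow> poly H z / z ^ m = poly A z + poly B (inverse z)"
    using Suc.IH by blast
  have "poly G z / z ^ Suc m = poly A z + poly (B + monom g (Suc m)) (inverse z)" if "z \<noteq> 0" for z
  proof -
    have "poly G z / z ^ Suc m = poly H z / z ^ m + g * inverse z ^ Suc m"
      using that by (simp add: G field_simps)
    thus ?thesis using AB[OF that] by (simp add: poly_monom)
  qed
  thus ?case by blast
qed

text \<open>A Laurent polynomial splits into \<open>A(z) + B(1/z)\<close>. Averaging this expression
  with its reflection, which is the same function, yields \<open>P\<close> as half the sum of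
  \<open>A\<close> and the conjugate of \<open>B\<close>.\<close>

lemma symmetric_laurent_is_lp:
  assumes "\<And>z. z \<noteq> 0 \<Longrightarrow> L (inverse (cnj z)) = cnj (L z)"
    and "\<And>z. z \<noteq> 0 \<Longrightarrow> L z = poly G z / z ^ m"
  shows "\<exists>P. \<forall>z. z \<noteq> 0 \<longrightarrow> L z = lp P z"
proof -
  obtain A B where AB: "\<And>z. z \<noteq> 0 \<Longrightarrow> poly G z / z ^ m = poly A z + poly B (inverse z)"
    using laurent_split[of G m] by blast
  have L: "L z = lp (smult (1 / 2) (A + map_poly cnj B)) z" if z: "z \<noteq> 0" for z
  proof -
    have 1: "L z = poly A z + poly B (inverse z)" using AB z assms(2) by simp
    have "cnj (L z) = poly A (inverse (cnj z)) + poly B (cnj z)"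
      using AB[of "inverse (cnj z)"] assms(1,2)[of "inverse (cnj z)"] assms(1)[OF z] z by simp
    hence "cnj (cnj (L z)) = cnj (poly A (inverse (cnj z)) + poly B (cnj z))" by (rule arg_cong)
    hence 2: "L z = cnj (poly A (inverse (cnj z))) + cnj (poly B (cnj z))" by simp
    have "lp (smult (1 / 2) (A + map_poly cnj B)) z = (1 / 2) * (poly A z + cnj (poly B (cnj z))
       + (cnj (poly A (inverse (cnj z))) + poly B (inverse z)))"
      by (simp add: lp_altdef algebra_simps)
    also have "\<dots> = (1 / 2) * (L z + L z)" using 1 2 by (simp add: algebra_simps)
    finally show ?thesis by simp
  qed
  thus ?thesis by blast
qed

lemma coeff_pcompose_scale: "coeff (pcompose p [:0, c:]) i = c ^ i * coeff (p :: complex poly) i"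
proof (induction p arbitrary: i)
  case (pCons a p)
  have "pcompose (pCons a p) [:0, c:] = pCons a (smult c (pcompose p [:0, c:]))"
    by (simp add: pcompose_pCons)
  thus ?case using pCons by (cases i) auto
qed simp

section \<open>The real structure on a curve with two poles\<close>

locale two_pole_param = gen_param C G1 G2 "monom c m" N D
  for C :: "(complex \<times> complex) set" and G1 G2 :: "complex poly" and c :: complex and m :: nat
    and N D :: "complex poly poly" +
  fixes F :: "complex poly poly"
  assumes C_def: "C = {p. eval2 F p = 0}"
    and cnj_closed: "\<And>x y. (x, y) \<in> C \<Longrightarrow> (cnj x, cnj y) \<in> C"
    and c: "c \<noteq> 0" and m: "0 < m" "m < bound"
begin

definition fbar :: "complex \<Rightarrow> complex \<times> complex" where
  "fbar t = (cnj (fst (f (cnj t))), cnj (snd (f (cnj t))))"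

lemma nonzero_iff: "poly (monom c m) z \<noteq> 0 \<longleftrightarrow> z \<noteq> 0"
  using c m(1) by (simp add: poly_monom)

lemma f_in_C: "z \<noteq> 0 \<Longrightarrow> f z \<in> C"
  using par_in_zero_set[OF C_def] by (simp add: nonzero_iff)

lemma fbar_in_C: "z \<noteq> 0 \<Longrightarrow> fbar z \<in> C"
  unfolding fbar_def by (rule cnj_closed) (use f_in_C[of "cnj z"] in simp)

lemma poly_0_nonzero: "poly G1 0 \<noteq> 0 \<or> poly G2 0 \<noteq> 0"
  using no_common_zero[of 0] nonzero_iff[of 0] by auto

lemma coeff_top_nonzero: "coeff G1 bound \<noteq> 0 \<or> coeff G2 bound \<noteq> 0"
  using bound_attained m(2) by auto

text \<open>\<open>C\<close> is stable under conjugation, so conjugating the coefficients of the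
  parametrization gives a second one with the same vanishing ideal.\<close>

lemma vanish_fbar_iff: "(\<forall>p\<in>C. eval2 W p = 0) \<longleftrightarrow> (MOST t. eval2 W (fbar t) = 0)"
proof -
  let ?W = "map_poly (map_poly cnj) W"
  have W: "eval2 ?W (x, y) = cnj (eval2 W (cnj x, cnj y))" for x y
    using eval2_cnj[of W "cnj x" "cnj y"] by simp
  have "(\<forall>p\<in>C. eval2 W p = 0) \<longleftrightarrow> (\<forall>p\<in>C. eval2 ?W p = 0)"
    using cnj_closed W by fastforce
  also have "\<dots> \<longleftrightarrow> (MOST t. eval2 ?W (f t) = 0)" by (rule vanish_iff)
  also have "\<dots> \<longleftrightarrow> (MOST t. eval2 W (fbar (cnj t)) = 0)"
    by (intro eventually_subst always_eventually allI) (simp add: fbar_def W par_def)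
  also have "\<dots> \<longleftrightarrow> (MOST t. eval2 W (fbar t) = 0)" by (rule eventually_cnj)
  finally show ?thesis .
qed

lemma fbar_eq: "fbar = par (map_poly cnj G1) (map_poly cnj G2) (map_poly cnj (monom c m))"
  by (rule ext) (simp add: fbar_def par_def)

lemma rat_fbar: "rat (\<lambda>t. fst (fbar t))" "rat (\<lambda>t. snd (fbar t))"
proof -
  have "map_poly cnj (monom c m) \<noteq> 0" using c by (simp add: map_poly_monom)
  thus "rat (\<lambda>t. fst (fbar t))" "rat (\<lambda>t. snd (fbar t))"
    unfolding fbar_eq par_def fst_conv snd_conv by (intro rat_quotient; assumption)+
qed

lemma fbar_generic_nonzero:
  assumes "\<not> (MOST t. eval2 W (f t) = 0)"
  shows "MOST t. eval2 W (fbar t) \<noteq> 0"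
  using rat_dichotomy[OF rat_eval2[OF rat_fbar, of W]] assms
  unfolding prod.collapse vanish_iff[of W, symmetric] vanish_fbar_iff[of W, symmetric] by blast

text \<open>
  The real structure of \<open>C\<close> lifts to the parameter; the lift permutes the two poles \<open>0\<close> and
  \<open>\<infinity>\<close>, so it is given by a monomial.
\<close>

lemma conjugation_lifts:
  "\<exists>\<kappa> k h. \<kappa> \<noteq> 0 \<and> (h = (\<lambda>z. \<kappa> * z ^ k) \<or> h = (\<lambda>z. \<kappa> / z ^ k)) \<and> (\<forall>z. z \<noteq> 0 \<longrightarrow> f (h z) = fbar z)"
proof -
  let ?G3 = "monom c m"
  let ?b = bound
  \<comment> \<open>The parameter that \<open>N/D\<close> assigns to \<open>fbar t\<close>; so far
    only a rational function that satisfies the lifting identity generically.\<close>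
  define h where "h = (\<lambda>t. eval2 N (fbar t) / eval2 D (fbar t))"
  have "rat h" unfolding h_def
    using rat_divide[OF rat_eval2[OF rat_fbar, of N] rat_eval2[OF rat_fbar, of D]] by simp
  then obtain A E where AE: "E \<noteq> 0" "\<And>t. poly A t \<noteq> 0 \<or> poly E t \<noteq> 0"
    "MOST t. poly E t \<noteq> 0 \<and> h t = poly A t / poly E t" using rat_coprime by blast
  have fh: "MOST t. t \<noteq> 0 \<and> poly ?G3 (h t) \<noteq> 0 \<and> f (h t) = fbar t"
    using eventually_nonzero fbar_generic_nonzero[OF D_generic]
      fbar_generic_nonzero[OF hom2_generic[OF bound(3) G3_nz]]
  proof eventually_elim
    case (elim t)
    obtain x y where xy: "fbar t = (x, y)" by (cases "fbar t")
    have pt: "ev (\<lambda>c. c) (x, y) W = 0" if "\<forall>p\<in>C. eval2 W p = 0" for W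
      using that fbar_in_C[OF elim(1)] by (simp add: ev_id flip: xy)
    have D: "ev (\<lambda>c. c) (x, y) D \<noteq> 0" "ev (\<lambda>c. c) (x, y) (hom2 const2 bound ?G3 N D) \<noteq> 0"
      using elim by (simp_all add: ev_id flip: xy)
    define T where "T = eval2 N (x, y) / eval2 D (x, y)"
    have "poly ?G3 T \<noteq> 0" "x = poly G1 T / poly ?G3 T" "y = poly G2 T / poly ?G3 T"
      using parameter_of_point[OF comm_hom_id pt D] by (simp_all add: ev_id T_def)
    moreover have "h t = T" by (simp only: h_def xy T_def)
    ultimately show ?case using elim(1) unfolding xy par_def by metis
  qed
  \<comment> \<open>Homogenizing in \<open>A\<close> and \<open>E\<close> makes the identity
    polynomial, so it holds also at parameters where \<open>h\<close> takes the value
    \<open>0\<close> or infinity.\<close>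
  have id: "hom2 (\<lambda>z. z) ?b G (poly A z) (poly E z) * poly (map_poly cnj ?G3) z =
     poly (map_poly cnj G) z * hom2 (\<lambda>z. z) ?b ?G3 (poly A z) (poly E z)"
    if G: "G = G1 \<or> G = G2" for G z
  proof -
    have dG: "degree G \<le> ?b" using that bound by blast
    define M where "M = (\<lambda>G. hom2 (\<lambda>z. [:z:]) ?b G A E)"
    have M: "poly (M G) z = hom2 (\<lambda>z. z) ?b G (poly A z) (poly E z)" for G z
      using comm_hom.hom_hom2[OF comm_hom_poly[of z]] by (simp add: M_def)
    have "MOST t. poly (M G * map_poly cnj ?G3) t = poly (map_poly cnj G * M ?G3) t"
      using fh AE(3)
    proof eventually_elim
      case (elim t)
      have h: "hom2 (\<lambda>z. z) ?b G' (poly A t) (poly E t) = poly E t ^ ?b * poly G' (h t)"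
        if "degree G' \<le> ?b" for G' using hom2_complex[OF that, of "poly E t"] elim by simp
      have "poly (map_poly cnj ?G3) t \<noteq> 0" using elim nonzero_iff[of "cnj t"] by simp
      moreover have "poly G (h t) / poly ?G3 (h t) = poly (map_poly cnj G) t / poly (map_poly cnj ?G3) t"
        using elim G unfolding fbar_eq par_def by auto
      ultimately have "poly G (h t) * poly (map_poly cnj ?G3) t = poly (map_poly cnj G) t * poly ?G3 (h t)"
        using conjunct1[OF conjunct2[OF elim(1)]] by (simp add: frac_eq_eq)
      hence "poly E t ^ ?b * (poly G (h t) * poly (map_poly cnj ?G3) t)
        = poly E t ^ ?b * (poly (map_poly cnj G) t * poly ?G3 (h t))" by (rule arg_cong)
      thus ?case unfolding poly_mult M h[OF dG] h[OF bound(3)] by (simp only: mult_ac)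
    qed
    hence "M G * map_poly cnj ?G3 = map_poly cnj G * M ?G3" by (rule poly_eq_if_eventually)
    hence "poly (M G * map_poly cnj ?G3) z = poly (map_poly cnj G * M ?G3) z" by simp
    thus ?thesis by (simp only: poly_mult M)
  qed
  have cG3: "poly (map_poly cnj ?G3) z \<noteq> 0" if "z \<noteq> 0" for z
    using that nonzero_iff[of "cnj z"] by simp
  have hom2_0: "hom2 (\<lambda>z. z) ?b G 0 y = poly G 0 * y ^ ?b" for G and y :: complex
  proof -
    have "hom2 (\<lambda>z. z) ?b G 0 y = (\<Sum>j\<in>{0}. coeff G j * 0 ^ j * y ^ (?b - j))"
      unfolding hom2_def by (rule sum.mono_neutral_right) (auto simp: power_0_left)
    thus ?thesis by (simp add: poly_0_coeff_0)
  qed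
  \<comment> \<open>If \<open>h\<close> met the pole \<open>0\<close> at some nonzero
    \<open>z\<close>, then \<open>G1\<close> and \<open>G2\<close> would both vanish at
    \<open>0\<close>, since \<open>fbar\<close> is finite at \<open>z\<close>.\<close>
  have Az: "poly A z \<noteq> 0" if "z \<noteq> 0" for z
  proof
    assume 0: "poly A z = 0"
    have "poly ?G3 0 = 0" using nonzero_iff by auto
    hence "poly G 0 = 0" if "G = G1 \<or> G = G2" for G
      using id[OF that, of z] cG3[OF \<open>z \<noteq> 0\<close>] AE(2)[of z] 0 by (simp add: hom2_0)
    thus False using poly_0_nonzero by blast
  qed
  \<comment> \<open>The same at infinity, with the top coefficients in place of the values at
    \<open>0\<close>.\<close>
  have Ez: "poly E z \<noteq> 0" if "z \<noteq> 0" for z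
  proof
    assume 0: "poly E z = 0"
    have "coeff ?G3 ?b = 0" using m by simp
    hence "coeff G ?b = 0" if "G = G1 \<or> G = G2" for G
      using id[OF that, of z] cG3[OF \<open>z \<noteq> 0\<close>] AE(2)[of z] 0 by (simp add: hom2_0_right)
    thus False using coeff_top_nonzero by blast
  qed
  have "A \<noteq> 0" using Az[of 1] by auto
  obtain a k where a: "a \<noteq> 0" "A = monom a k" using only_zero_root_imp_monom[OF \<open>A \<noteq> 0\<close>] Az by blast
  obtain b l where b: "b \<noteq> 0" "E = monom b l" using only_zero_root_imp_monom[OF AE(1)] Ez by blast
  define g where "g = (\<lambda>z. poly A z / poly E z)"
  have fg: "f (g z) = fbar z" if z: "z \<noteq> 0" for z
  proof -
    have h: "hom2 (\<lambda>z. z) ?b G' (poly A z) (poly E z) = poly E z ^ ?b * poly G' (g z)"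
      if "degree G' \<le> ?b" for G'
      using hom2_complex[OF that Ez[OF z]] by (simp add: g_def)
    have nz: "poly ?G3 (g z) \<noteq> 0" using Az[OF z] Ez[OF z] by (simp add: nonzero_iff g_def)
    have "poly G (g z) / poly ?G3 (g z) = poly (map_poly cnj G) z / poly (map_poly cnj ?G3) z"
      if "G = G1 \<or> G = G2" for G
    proof -
      have dG: "degree G \<le> ?b" using that bound by blast
      have "poly E z ^ ?b * (poly G (g z) * poly (map_poly cnj ?G3) z) =
        poly E z ^ ?b * (poly (map_poly cnj G) z * poly ?G3 (g z))"
        using id[OF that, of z] unfolding h[OF dG] h[OF bound(3)] by (simp only: mult_ac)
      hence "poly G (g z) * poly (map_poly cnj ?G3) z = poly (map_poly cnj G) z * poly ?G3 (g z)"
        using Ez[OF z] by simp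
      with frac_eq_eq[OF nz cG3[OF z]] show ?thesis by blast
    qed
    thus ?thesis unfolding fbar_eq par_def by simp
  qed
  have "k = 0 \<or> l = 0" using AE(2)[of 0] a b by (auto simp: poly_monom power_0_left split: if_splits)
  thus ?thesis
  proof
    assume "l = 0"
    hence "g = (\<lambda>z. (a / b) * z ^ k)" by (intro ext) (simp add: g_def a b poly_monom)
    thus ?thesis using fg a b by (intro exI[of _ "a / b"] exI[of _ k] exI[of _ g]) auto
  next
    assume "k = 0"
    hence "g = (\<lambda>z. (a / b) / z ^ l)" by (intro ext) (simp add: g_def a b poly_monom)
    thus ?thesis using fg a b by (intro exI[of _ "a / b"] exI[of _ l] exI[of _ g]) auto
  qed
qed

definition good :: "complex \<Rightarrow> bool" where
  "good t \<longleftrightarrow> eval2 D (f t) \<noteq> 0 \<and> eval2 N (f t) = t * eval2 D (f t)"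

lemma eventually_good: "MOST t. good t"
  using inverse_ND by (simp add: good_def)

lemma good_inj: "good s \<Longrightarrow> good t \<Longrightarrow> f s = f t \<Longrightarrow> s = t"
  by (auto simp: good_def)

text \<open>A self-map of the parameter that leaves \<open>f\<close> invariant is the identity,
  because \<open>f\<close> is injective on good parameters; it has to be checked first that generic
  parameters are mapped to good ones.\<close>

lemma deck_monomial:
  assumes "\<And>z. z \<noteq> 0 \<Longrightarrow> f (w * z ^ j) = f z"
  shows "j = 1 \<and> w = 1"
proof -
  have "MOST z. good (w * z ^ j)"
  proof (cases "j = 0 \<or> w = 0")
    case True
    \<comment> \<open>A constant self-map would give all generic parameters the same image under
      \<open>f\<close>.\<close>
    then obtain v where v: "w * z ^ j = v" if "z \<noteq> 0" for z by (cases "w = 0") auto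
    have "MOST z. z = eval2 N (f v) / eval2 D (f v)"
      using eventually_good eventually_nonzero
    proof eventually_elim
      case (elim z)
      thus ?case using assms[of z] v[of z] by (simp add: good_def)
    qed
    hence "MOST z. poly [:- (eval2 N (f v) / eval2 D (f v)), 1:] z = 0"
      by eventually_elim simp
    hence "[:- (eval2 N (f v) / eval2 D (f v)), 1:] = (0 :: complex poly)" by (rule poly_eq_0_if_eventually)
    thus ?thesis by simp
  next
    case False
    have "finite (\<Union>b\<in>{t. \<not> good t}. {z. poly (monom w j - [:b:]) z = 0})"
    proof (rule finite_UN_I)
      show "finite {t. \<not> good t}" using eventually_good by (simp add: eventually_cofinite)
      fix b
      obtain i where "j = Suc i" using False by (cases j) auto
      hence "coeff (monom w j - [:b:]) j \<noteq> 0" using False by simp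
      hence "monom w j - [:b:] \<noteq> 0" by (metis coeff_0)
      thus "finite {z. poly (monom w j - [:b:]) z = 0}" by (rule poly_roots_finite)
    qed
    moreover have "{z. \<not> good (w * z ^ j)} \<subseteq> (\<Union>b\<in>{t. \<not> good t}. {z. poly (monom w j - [:b:]) z = 0})"
      by (auto simp: poly_monom)
    ultimately show ?thesis unfolding eventually_cofinite by (rule finite_subset[rotated])
  qed
  hence "MOST z. poly (monom w j) z = poly (monom 1 1) z"
    using eventually_good eventually_nonzero
  proof eventually_elim
    case (elim z)
    thus ?case using good_inj[OF elim(1,2)] assms by (simp add: poly_monom)
  qed
  hence "monom w j = monom 1 1" by (rule poly_eq_if_eventually)
  hence "coeff (monom w j) 1 = 1" by simp
  thus ?thesis by (simp split: if_splits)
qed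

lemma fbar_of_cnj: "fbar (cnj z) = (cnj (fst (f z)), cnj (snd (f z)))"
  by (simp add: fbar_def)

lemma fbar_cnj_lift:
  assumes "\<And>z. z \<noteq> 0 \<Longrightarrow> f (h z) = fbar z" "z \<noteq> 0"
  shows "fbar (cnj (h (cnj z))) = f z"
  using assms(1)[of "cnj z"] assms(2) fbar_of_cnj[of "h (cnj z)"] by (simp add: fbar_of_cnj)

text \<open>A lift fixing the pole \<open>0\<close> is a linear change of the local parameter there,
  so the arc over \<open>0\<close> is equivalent to its conjugate. Two distinct conjugate branches
  rule this case out.\<close>

lemma conj_branch_fixed_if_scaling:
  assumes "\<kappa> \<noteq> 0" "\<And>z. z \<noteq> 0 \<Longrightarrow> f (\<kappa> * z) = fbar z"
  shows "(pole_arc 0, conj_arc (pole_arc 0)) \<in> arc_equiv"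
proof -
  \<comment> \<open>Determined by the third coordinate: conjugation turns \<open>c * z ^ m\<close>
    into \<open>v\<close> times its rescaling by \<open>\<kappa>\<close>.\<close>
  define v where "v = cnj c / (c * \<kappa> ^ m)"
  have "v \<noteq> 0" using c assms by (simp add: v_def)
  have scale: "map_poly cnj G = smult v (pcompose G [:0, \<kappa>:])"
    if G: "G = G1 \<or> G = G2 \<or> G = monom c m" for G
  proof (rule poly_eq_if_eq_nonzero)
    fix z :: complex assume z: "z \<noteq> 0"
    consider "G = monom c m" | "G = G1 \<or> G = G2" using G by blast
    thus "poly (map_poly cnj G) z = poly (smult v (pcompose G [:0, \<kappa>:])) z"
    proof cases
      case 1
      thus ?thesis using c assms(1)
        by (simp add: poly_pcompose poly_monom v_def power_mult_distrib)
    next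
      case 2
      hence "poly G (\<kappa> * z) / poly (monom c m) (\<kappa> * z) = poly (map_poly cnj G) z / poly (map_poly cnj (monom c m)) z"
        using assms(2)[OF z] unfolding fbar_eq par_def by auto
      hence "poly (map_poly cnj G) z = poly G (\<kappa> * z) * (poly (map_poly cnj (monom c m)) z / poly (monom c m) (\<kappa> * z))"
        using c z assms(1) by (simp add: poly_monom field_simps)
      also have "poly (map_poly cnj (monom c m)) z / poly (monom c m) (\<kappa> * z) = v"
        using c z assms(1) by (simp add: poly_monom v_def power_mult_distrib)
      finally show ?thesis by (simp add: poly_pcompose mult.commute)
    qed
  qed
  have fps: "fps_cnj (fps_of_poly G) = fps_const v * (fps_of_poly G oo (fps_const \<kappa> * fps_X))"
    if "G = G1 \<or> G = G2 \<or> G = monom c m" for G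
  proof (rule fps_ext)
    fix n
    have "coeff (map_poly cnj G) n = v * (\<kappa> ^ n * coeff G n)"
      unfolding scale[OF that] by (simp add: coeff_pcompose_scale)
    thus "fps_nth (fps_cnj (fps_of_poly G)) n = fps_nth (fps_const v * (fps_of_poly G oo (fps_const \<kappa> * fps_X))) n"
      by (simp add: fps_compose_linear coeff_map_poly)
  qed
  have "conj_arc (pole_arc 0) = arc_transform (fps_const v) (fps_const \<kappa> * fps_X) (pole_arc 0)"
    unfolding poly_arc_def pcompose_idR conj_arc_def arc_transform_def prod.case using fps by blast
  moreover have "fps_nth (fps_const v) 0 \<noteq> 0" "fps_nth (fps_const \<kappa> * fps_X) 0 = 0"
    "fps_nth (fps_const \<kappa> * fps_X) 1 \<noteq> 0" using \<open>v \<noteq> 0\<close> assms(1) by simp_all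
  ultimately show ?thesis unfolding arc_equiv_def by blast
qed

text \<open>A real point is fixed by conjugation, so its parameter \<open>t\<close> is fixed by the
  lift: \<open>t = \<kappa> / cnj t\<close>, and \<open>\<kappa>\<close> is the squared norm of
  \<open>t\<close>. Infinitely many real points leave one outside the exceptional sets.\<close>

lemma positive_inversion_if_real_points:
  assumes "\<kappa> \<noteq> 0" "\<And>z. z \<noteq> 0 \<Longrightarrow> f (\<kappa> / z) = fbar z" "infinite (real_points C)"
    and "cnj \<kappa> = \<kappa>"
  shows "\<exists>t. t \<noteq> 0 \<and> \<kappa> = t * cnj t"
proof -
  let ?X = "{p \<in> C. \<not> (eval2 D p \<noteq> 0 \<and> poly (monom c m) (eval2 N p / eval2 D p) \<noteq> 0 \<and>
      f (eval2 N p / eval2 D p) = p)}"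
  \<comment> \<open>Points whose lifted parameter would not be good. Since \<open>\<kappa>\<close>
    is real the lift is an involution, so these are images of lifts of bad parameters.\<close>
  let ?Y = "f ` ((\<lambda>s. \<kappa> / cnj s) ` {s. \<not> good s})"
  have "finite (?X \<union> ?Y)"
    using finite_exceptional_points eventually_good by (simp add: eventually_cofinite)
  hence "infinite (real_points C - (?X \<union> ?Y))" using assms(3) by (rule Diff_infinite_finite)
  hence "real_points C - (?X \<union> ?Y) \<noteq> {}" by (metis finite.emptyI)
  then obtain p where p: "p \<in> real_points C" "p \<notin> ?X" "p \<notin> ?Y" by blast
  define t where "t = eval2 N p / eval2 D p"
  have pC: "p \<in> C" "fst p \<in> \<real>" "snd p \<in> \<real>" using p(1) by (auto simp: real_points_def)
  have t: "t \<noteq> 0" "f t = p" using p(2) pC by (auto simp: t_def nonzero_iff)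
  define s where "s = \<kappa> / cnj t"
  have "f s = p"
  proof -
    have "f s = fbar (cnj t)" unfolding s_def by (rule assms(2)) (use t in simp)
    also have "\<dots> = (cnj (fst p), cnj (snd p))" by (simp add: fbar_of_cnj t)
    also have "\<dots> = p" using pC by (simp add: Reals_cnj_iff)
    finally show ?thesis .
  qed
  have "good s"
  proof (rule ccontr)
    assume "\<not> good s"
    moreover have "t = \<kappa> / cnj s" using t assms(1,4) by (simp add: s_def)
    ultimately have "p \<in> ?Y" using t(2) by blast
    thus False using p(3) by blast
  qed
  hence "s = t" using \<open>f s = p\<close> by (auto simp: good_def t_def)
  hence "\<kappa> = t * cnj t" using t(1) by (simp add: s_def field_simps)
  thus ?thesis using t(1) by blast
qed

lemma symmetric_parametrization:
  assumes B: "B \<noteq> conj_branch B" "branches_at_infinity C = {B, conj_branch B}"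
    and inf: "infinite (real_points C)"
  shows "\<exists>P Q. birational_parametrization (- {0}) (\<lambda>z. (lp P z, lp Q z)) C"
proof -
  obtain \<kappa> k h where h: "\<kappa> \<noteq> 0" "h = (\<lambda>z. \<kappa> * z ^ k) \<or> h = (\<lambda>z. \<kappa> / z ^ k)"
    "\<And>z. z \<noteq> 0 \<Longrightarrow> f (h z) = fbar z" using conjugation_lifts by blast
  have hnz: "h z \<noteq> 0" if "z \<noteq> 0" for z using h(1,2) that by auto
  \<comment> \<open>Conjugating twice: the square of the antiholomorphic lift leaves
    \<open>f\<close> invariant.\<close>
  have deck: "f (h (cnj (h (cnj z)))) = f z" if "z \<noteq> 0" for z
    using h(3)[of "cnj (h (cnj z))"] fbar_cnj_lift[of h, OF h(3) that] hnz[of "cnj z"] that by simp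
  have scaling: False if "h = (\<lambda>z. \<kappa> * z ^ k)"
  proof -
    have "f ((\<kappa> * cnj \<kappa> ^ k) * z ^ (k * k)) = f z" if "z \<noteq> 0" for z
      using deck[OF that] by (simp add: \<open>h = _\<close> power_mult_distrib power_mult mult.assoc)
    hence "k * k = 1 \<and> \<kappa> * cnj \<kappa> ^ k = 1" by (rule deck_monomial)
    hence "k = 1" by simp
    hence "f (\<kappa> * z) = fbar z" if "z \<noteq> 0" for z using h(3)[OF that] \<open>h = _\<close> by simp
    from conj_branch_fixed_if_scaling[OF h(1) this]
    have eq: "arc_equiv `` {pole_arc 0} = conj_branch (arc_equiv `` {pole_arc 0})"
      by (simp add: conj_branch_class arc_class_eq_iff)
    have "poly (monom c m) 0 = 0" using nonzero_iff by auto
    hence "arc_equiv `` {pole_arc 0} \<in> branches_at_infinity C"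
      unfolding branches_at_infinity_altdef by (intro imageI pole_arc_in_branch_arcs)
    hence "arc_equiv `` {pole_arc 0} \<in> {B, conj_branch B}" unfolding B(2) .
    moreover have "conj_branch (conj_branch B) = B"
      by (simp add: conj_branch_def image_image case_prod_beta)
    ultimately show False using eq B(1) by auto
  qed
  hence hk: "h = (\<lambda>z. \<kappa> / z ^ k)" using h(2) by blast
  \<comment> \<open>For the inversion the same computation yields exponent one and a real
    \<open>\<kappa>\<close>.\<close>
  have "f ((\<kappa> / cnj \<kappa> ^ k) * z ^ (k * k)) = f z" if "z \<noteq> 0" for z
    using deck[OF that] by (simp add: hk power_divide power_mult)
  hence "k * k = 1 \<and> \<kappa> / cnj \<kappa> ^ k = 1" by (rule deck_monomial)
  hence "k * k = 1" "\<kappa> / cnj \<kappa> ^ k = 1" by blast+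
  hence k: "k = 1" and "\<kappa> / cnj \<kappa> ^ k = 1" by simp_all
  hence real: "cnj \<kappa> = \<kappa>" using h(1) by simp
  have inv: "f (\<kappa> / z) = fbar z" if "z \<noteq> 0" for z using h(3)[OF that] by (simp add: hk k)
  obtain t where t: "t \<noteq> 0" "\<kappa> = t * cnj t"
    using positive_inversion_if_real_points[OF h(1) inv inf real] by blast
  \<comment> \<open>The lift is the reflection in the circle of radius \<open>\<rho>\<close>;
    rescaling by \<open>\<rho>\<close> turns this into the unit circle.\<close>
  define \<rho> where "\<rho> = complex_of_real (cmod t)"
  have \<rho>: "\<rho> \<noteq> 0" "cnj \<rho> = \<rho>" "\<kappa> = \<rho> * \<rho>"
    using t complex_norm_square[of t] by (simp_all add: \<rho>_def power2_eq_square)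
  have sym: "f (\<rho> * inverse (cnj z)) = (cnj (fst (f (\<rho> * z))), cnj (snd (f (\<rho> * z))))" if z: "z \<noteq> 0" for z
  proof -
    have "\<rho> * inverse (cnj z) = \<kappa> / cnj (\<rho> * z)" using \<rho> z by (simp add: field_simps)
    also have "f \<dots> = fbar (cnj (\<rho> * z))" by (rule inv) (use \<rho> z in simp)
    finally show ?thesis by (simp only: fbar_of_cnj)
  qed
  have L: "poly (pcompose G [:0, \<rho>:]) z / (c * \<rho> ^ m) / z ^ m = poly G (\<rho> * z) / poly (monom c m) (\<rho> * z)" for G z
    by (simp add: poly_pcompose poly_monom power_mult_distrib algebra_simps)
  have "\<exists>P. \<forall>z. z \<noteq> 0 \<longrightarrow> fst (f (\<rho> * z)) = lp P z"
    by (rule symmetric_laurent_is_lp[where G = "smult (inverse (c * \<rho> ^ m)) (pcompose G1 [:0, \<rho>:])" and m = m])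
      (use sym L[of G1] in \<open>simp_all add: par_def divide_inverse mult_ac\<close>)
  moreover have "\<exists>Q. \<forall>z. z \<noteq> 0 \<longrightarrow> snd (f (\<rho> * z)) = lp Q z"
    by (rule symmetric_laurent_is_lp[where G = "smult (inverse (c * \<rho> ^ m)) (pcompose G2 [:0, \<rho>:])" and m = m])
      (use sym L[of G2] in \<open>simp_all add: par_def divide_inverse mult_ac\<close>)
  ultimately obtain P Q where PQ: "\<And>z. z \<noteq> 0 \<Longrightarrow> f (\<rho> * z) = (lp P z, lp Q z)"
    by (metis prod.collapse)
  let ?m = "mob \<rho> 0 0 1 bound"
  have gp: "gen_param C (?m G1) (?m G2) (?m (monom c m)) (const2 1 * N - const2 0 * D) (const2 \<rho> * D - const2 0 * N)"
    by (rule gen_param_mob) (use \<rho> bound bound_attained in auto)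
  have mob: "poly (?m G) z = poly G (\<rho> * z)" if "degree G \<le> bound" for G z
    using poly_mob[OF that, of 0 z 1 \<rho> 0] by simp
  have "birational_parametrization (- {0}) (\<lambda>z. (lp P z, lp Q z)) C"
  proof (rule gen_param.birational[OF gp C_def])
    show "- {0} = {z. poly (?m (monom c m)) z \<noteq> 0}"
      using \<rho>(1) by (auto simp: mob[OF bound(3)] nonzero_iff)
    fix z assume "z \<in> - {0 :: complex}"
    thus "(lp P z, lp Q z) = par (?m G1) (?m G2) (?m (monom c m)) z"
      using PQ[of z] by (simp add: par_def mob bound)
  qed
  thus ?thesis by blast
qed

end

lemma symmetric_parametrization_if_two_conjugate_branches:
  assumes C: "C = {p. eval2 F p = 0}" "F \<noteq> 0"
    and cnj: "\<And>x y. (x, y) \<in> C \<Longrightarrow> (cnj x, cnj y) \<in> C"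
    and rational: "rational_curve C"
    and B: "B \<noteq> conj_branch B" "branches_at_infinity C = {B, conj_branch B}"
    and inf: "infinite (real_points C)"
  shows "\<exists>P Q. birational_parametrization (- {0}) (\<lambda>z. (lp P z, lp Q z)) C"
proof -
  obtain G1 G2 G3 N D where "gen_param C G1 G2 G3 N D"
    using rational birational_imp_gen_param[OF C(1)] unfolding rational_curve_def by blast
  then obtain G1 G2 G3 N D where gp: "gen_param C G1 G2 G3 N D" "coeff G3 (gen_param.bound G1 G2 G3) \<noteq> 0"
    using gen_param.regular_at_infinity by blast
  obtain G1 G2 c m N D where "gen_param C G1 G2 (monom c m) N D" "c \<noteq> 0" "0 < m"
     "m < gen_param.bound G1 G2 (monom c m)"
    using gen_param.two_poles_normal_form[OF gp(1) C gp(2) B] by blast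
  then interpret two_pole_param C G1 G2 c m N D F
    unfolding two_pole_param_def two_pole_param_axioms_def using C cnj by blast
  show ?thesis by (rule symmetric_parametrization[OF B inf])
qed

section \<open>Parametrizations injective on the unit circle\<close>

definition laur :: "(complex \<Rightarrow> complex) \<Rightarrow> bool" where
  "laur u \<longleftrightarrow> (\<exists>A m. \<forall>t. t \<noteq> 0 \<longrightarrow> u t = poly A t / t ^ m)"

lemma laur_const: "laur (\<lambda>t. c)"
  unfolding laur_def by (intro exI[of _ "[:c:]"] exI[of _ 0]) simp

lemma laur_ident: "laur (\<lambda>t. t)"
  unfolding laur_def by (intro exI[of _ "[:0, 1:]"] exI[of _ 0]) simp

lemma laur_add:
  assumes "laur u" "laur v" shows "laur (\<lambda>t. u t + v t)"
proof -
  obtain A m B k where "\<And>t. t \<noteq> 0 \<Longrightarrow> u t = poly A t / t ^ m" "\<And>t. t \<noteq> 0 \<Longrightarrow> v t = poly B t / t ^ k"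
    using assms unfolding laur_def by blast
  thus ?thesis unfolding laur_def
    by (intro exI[of _ "A * monom 1 k + B * monom 1 m"] exI[of _ "m + k"])
      (auto simp: poly_monom power_add field_simps)
qed

lemma laur_mult:
  assumes "laur u" "laur v" shows "laur (\<lambda>t. u t * v t)"
proof -
  obtain A m B k where "\<And>t. t \<noteq> 0 \<Longrightarrow> u t = poly A t / t ^ m" "\<And>t. t \<noteq> 0 \<Longrightarrow> v t = poly B t / t ^ k"
    using assms unfolding laur_def by blast
  thus ?thesis unfolding laur_def
    by (intro exI[of _ "A * B"] exI[of _ "m + k"]) (auto simp: power_add)
qed

lemma laur_poly: "laur u \<Longrightarrow> laur (\<lambda>t. poly p (u t))"
  by (induction p) (auto intro!: laur_const laur_add laur_mult)

lemma laur_eval2: "laur u \<Longrightarrow> laur v \<Longrightarrow> laur (\<lambda>t. eval2 W (u t, v t))"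
  unfolding eval2_def by (induction W) (auto intro!: laur_const laur_add laur_mult laur_poly)

lemma laur_lp: "laur (lp P)"
  unfolding laur_def
proof (intro exI allI impI)
  fix t :: complex assume "t \<noteq> 0"
  thus "lp P t = poly (lp_num (degree P) P) t / t ^ degree P" by (simp add: poly_lp_num)
qed

lemma laur_cases:
  assumes "laur u"
  shows "(\<forall>t. t \<noteq> 0 \<longrightarrow> u t = 0) \<or> (MOST t. u t \<noteq> 0)"
proof -
  obtain A m where A: "\<And>t. t \<noteq> 0 \<Longrightarrow> u t = poly A t / t ^ m" using assms unfolding laur_def by blast
  show ?thesis
  proof (cases "A = 0")
    case True
    thus ?thesis using A by simp
  next
    case False
    from eventually_poly_nonzero[OF False] eventually_nonzero
    have "MOST t. u t \<noteq> 0" by eventually_elim (simp add: A)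
    thus ?thesis ..
  qed
qed

lemma laur_eq_0:
  assumes "laur u" "infinite {t. u t = 0}" "t \<noteq> 0"
  shows "u t = 0"
  using laur_cases[OF assms(1)] assms(2,3) by (auto simp: eventually_cofinite)

lemma laur_rat: "laur u \<Longrightarrow> rat u"
proof -
  assume "laur u"
  then obtain A m where A: "\<And>t. t \<noteq> 0 \<Longrightarrow> u t = poly A t / t ^ m" unfolding laur_def by blast
  from eventually_nonzero have "MOST t. poly A t / poly (monom 1 m) t = u t"
    by eventually_elim (simp add: A poly_monom)
  thus ?thesis by (rule rat_cong[rotated]) (rule rat_quotient, simp)
qed

text \<open>Large near both poles \<open>0\<close> and infinity and invariant under reflection, so
  that growth at the two ends is treated at once.\<close>

definition sz :: "complex \<Rightarrow> real" where "sz z = max (norm z) (inverse (norm z))"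

lemma sz_ge_1: "z \<noteq> 0 \<Longrightarrow> 1 \<le> sz z"
  unfolding sz_def by (cases "norm z \<ge> 1") (auto simp: le_max_iff_disj one_le_inverse_iff)

lemma sz_ge: "norm z \<le> sz z" "inverse (norm z) \<le> sz z"
  by (simp_all add: sz_def)

lemma sz_reflect: "sz (inverse (cnj z)) = sz z"
  by (simp add: sz_def norm_inverse max.commute)

lemma norm_poly_le:
  fixes P :: "complex poly"
  assumes "degree P \<le> n" "norm z \<le> s" "1 \<le> s"
  shows "norm (poly P z) \<le> (\<Sum>k\<le>n. norm (coeff P k)) * s ^ n"
proof -
  have "poly P z = (\<Sum>k\<le>n. coeff P k * z ^ k)"
    using poly_map_poly_altdef[of "\<lambda>c. c" P n z] assms(1) by simp
  hence "norm (poly P z) \<le> (\<Sum>k\<le>n. norm (coeff P k) * norm z ^ k)"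
    by (simp add: sum_norm_le norm_mult norm_power)
  also have "\<dots> \<le> (\<Sum>k\<le>n. norm (coeff P k) * s ^ n)"
  proof (intro sum_mono mult_left_mono)
    fix k assume "k \<in> {..n}"
    have "norm z ^ k \<le> s ^ k" using assms(2) by (intro power_mono) auto
    also have "\<dots> \<le> s ^ n" using assms(3) \<open>k \<in> _\<close> by (intro power_increasing) auto
    finally show "norm z ^ k \<le> s ^ n" .
  qed simp
  finally show ?thesis by (simp add: sum_distrib_right)
qed

lemma lp_upper_bound:
  assumes "degree P \<le> n" "t \<noteq> 0"
  shows "norm (lp P t) \<le> 2 * (\<Sum>k\<le>n. norm (coeff P k)) * sz t ^ n"
proof -
  have "norm (poly P t) \<le> (\<Sum>k\<le>n. norm (coeff P k)) * sz t ^ n"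
    by (rule norm_poly_le) (use assms sz_ge sz_ge_1 in auto)
  moreover have "norm (poly P (inverse (cnj t))) \<le> (\<Sum>k\<le>n. norm (coeff P k)) * sz t ^ n"
    by (rule norm_poly_le) (use assms sz_ge sz_ge_1 in \<open>auto simp: norm_inverse\<close>)
  ultimately show ?thesis
    using norm_triangle_ineq[of "poly P t" "cnj (poly P (inverse (cnj t)))"] by (simp add: lp_altdef)
qed

text \<open>For \<open>norm t\<close> at least one, all terms except the leading one, those in
  \<open>1/t\<close> included, are of order at most \<open>n - 1\<close>. Small \<open>t\<close>
  reduces to this by reflection.\<close>

lemma lp_lower_bound:
  assumes "degree P \<le> n" "0 < n" "t \<noteq> 0"
  shows "norm (coeff P n) * sz t ^ n \<le> norm (lp P t) + 2 * (\<Sum>k\<le>n. norm (coeff P k)) * sz t ^ (n - 1)"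
proof -
  let ?c = "\<Sum>k\<le>n. norm (coeff P k)"
  have main: "norm (coeff P n) * sz t ^ n \<le> norm (lp P t) + 2 * ?c * sz t ^ (n - 1)"
    if t: "1 \<le> norm t" for t
  proof -
    have szt: "sz t = norm t" using t unfolding sz_def by (simp add: max_def) (metis inverse_le_1_iff order.trans antisym)
    define R where "R = P - monom (coeff P n) n"
    have cR: "coeff R k = (if k = n then 0 else coeff P k)" for k by (simp add: R_def)
    have "degree R \<le> n - 1"
      by (rule degree_le) (use assms(1,2) in \<open>auto simp: cR coeff_eq_0\<close>)
    hence "norm (poly R t) \<le> (\<Sum>k\<le>n - 1. norm (coeff R k)) * sz t ^ (n - 1)"
      by (rule norm_poly_le) (use t szt in auto)
    also have "\<dots> \<le> ?c * sz t ^ (n - 1)"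
    proof (rule mult_right_mono)
      have "(\<Sum>k\<le>n - 1. norm (coeff R k)) \<le> (\<Sum>k\<le>n. norm (coeff R k))"
        by (rule sum_mono2) auto
      also have "\<dots> \<le> ?c" by (rule sum_mono) (simp add: cR)
      finally show "(\<Sum>k\<le>n - 1. norm (coeff R k)) \<le> ?c" .
    qed (use szt t in simp)
    finally have 1: "norm (poly R t) \<le> ?c * sz t ^ (n - 1)" .
    have "norm (poly P (inverse (cnj t))) \<le> ?c * 1 ^ n"
      by (rule norm_poly_le[OF assms(1)]) (use t in \<open>auto simp: norm_inverse inverse_le_1_iff\<close>)
    also have "\<dots> \<le> ?c * sz t ^ (n - 1)"
      using t szt by (intro mult_left_mono) (auto intro: sum_nonneg)
    finally have 2: "norm (poly P (inverse (cnj t))) \<le> ?c * sz t ^ (n - 1)" .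
    have "coeff P n * t ^ n = lp P t - poly R t - cnj (poly P (inverse (cnj t)))"
      by (simp add: lp_altdef R_def poly_monom)
    hence "norm (coeff P n * t ^ n) \<le> norm (lp P t) + norm (poly R t) + norm (cnj (poly P (inverse (cnj t))))"
      using norm_triangle_ineq4[of "lp P t - poly R t" "cnj (poly P (inverse (cnj t)))"]
        norm_triangle_ineq4[of "lp P t" "poly R t"] by simp
    thus ?thesis using 1 2 by (simp add: norm_mult norm_power szt)
  qed
  show ?thesis
  proof (cases "1 \<le> norm t")
    case True
    thus ?thesis by (rule main)
  next
    case False
    have "1 \<le> norm (inverse (cnj t))" using False assms(3) by (simp add: norm_inverse one_le_inverse_iff)
    from main[OF this] show ?thesis by (simp add: sz_reflect lp_reflect)
  qed
qed

text \<open>\<open>lp P\<close> grows like \<open>sz t ^ n\<close>, from above and from below, so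
  parameters with equal values have comparable sizes.\<close>

lemma lp_fibre_bound:
  assumes "degree P \<le> n" "0 < n" "coeff P n \<noteq> 0"
  shows "\<exists>K\<ge>1. \<forall>s t. s \<noteq> 0 \<longrightarrow> t \<noteq> 0 \<longrightarrow> lp P s = lp P t \<longrightarrow> sz s \<le> K * sz t"
proof -
  define c where "c = (\<Sum>k\<le>n. norm (coeff P k))"
  define a where "a = norm (coeff P n)"
  have a: "a > 0" using assms by (simp add: a_def)
  have c: "c \<ge> 0" by (simp add: c_def sum_nonneg)
  \<comment> \<open>For \<open>sz t \<le> sz s\<close>, both the upper bound for \<open>t\<close>
    and the lower-order error for \<open>s\<close> are at most
    \<open>2 * c * sz t * sz s ^ (n - 1)\<close>; together they give the constant
    \<open>4 * c / a\<close>.\<close>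
  have "sz s \<le> max 1 (4 * c / a) * sz t" if st: "s \<noteq> 0" "t \<noteq> 0" "lp P s = lp P t" for s t
  proof (cases "sz s \<le> sz t")
    case True
    have "1 * sz t \<le> max 1 (4 * c / a) * sz t"
      using sz_ge_1[OF st(2)] by (intro mult_right_mono) auto
    thus ?thesis using True by linarith
  next
    case False
    define S T where "S = sz s" and "T = sz t"
    have ST: "1 \<le> S" "1 \<le> T" "T \<le> S" using False st sz_ge_1 by (auto simp: S_def T_def)
    obtain k where k: "n = Suc k" using assms(2) by (cases n) auto
    have "a * S ^ n \<le> 2 * c * T ^ n + 2 * c * S ^ k"
      using lp_lower_bound[OF assms(1,2) st(1)] lp_upper_bound[OF assms(1) st(2)] st(3)
      by (simp add: a_def c_def S_def T_def k)
    also have "\<dots> \<le> 2 * c * (T * S ^ k) + 2 * c * (T * S ^ k)"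
    proof (intro add_mono mult_left_mono)
      show "T ^ n \<le> T * S ^ k" unfolding k power_Suc using ST by (intro mult_left_mono power_mono) auto
      show "S ^ k \<le> T * S ^ k" using ST by (auto simp: mult_le_cancel_right1)
    qed (use c in auto)
    finally have "S ^ k * (a * S) \<le> S ^ k * (4 * c * T)" by (simp add: k algebra_simps)
    hence "a * S \<le> 4 * c * T" using ST by (simp add: mult_le_cancel_left)
    hence "S \<le> 4 * c / a * T" using a by (simp add: field_simps)
    also have "\<dots> \<le> max 1 (4 * c / a) * T" using ST by (intro mult_right_mono) auto
    finally show ?thesis by (simp add: S_def T_def)
  qed
  thus ?thesis by (intro exI[of _ "max 1 (4 * c / a)"]) auto
qed

lemma eventually_at_if_cofinite:
  fixes z :: complex
  assumes "eventually Q cofinite"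
  shows "eventually Q (at z)"
proof -
  have "open (- ({t. \<not> Q t} - {z}))"
    using assms by (intro open_Compl finite_imp_closed) (auto simp: eventually_cofinite)
  thus ?thesis unfolding eventually_at_topological
    by (intro exI[of _ "- ({t. \<not> Q t} - {z})"]) auto
qed

lemma le_if_cofinite_le:
  fixes u v :: "complex \<Rightarrow> real"
  assumes "MOST t. u t \<le> v t" "isCont u z" "isCont v z"
  shows "u z \<le> v z"
  by (rule tendsto_le[of "at z" v "v z" u "u z"])
    (use assms in \<open>auto simp: isCont_def intro: eventually_at_if_cofinite\<close>)

section \<open>The minimal polynomial of the parameter over the curve\<close>

definition ev3 :: "complex poly poly poly \<Rightarrow> complex \<times> complex \<Rightarrow> complex \<Rightarrow> complex" where
  "ev3 M p T = poly (map_poly (\<lambda>W. eval2 W p) M) T"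

lemma comm_hom_ev3: "comm_hom (\<lambda>M. ev3 M p T)"
  unfolding ev3_def by (rule comm_hom_compose[OF comm_hom_poly comm_hom.comm_hom_map_poly[OF comm_hom_eval2]])

lemmas ev3_simps = comm_hom.hom_simps[OF comm_hom_ev3] comm_hom.hom_0[OF comm_hom_ev3]

lemma ev3_pCons: "ev3 (pCons W M) p T = eval2 W p + T * ev3 M p T"
  by (simp add: ev3_def map_poly_pCons)

lemma ev3_monom: "ev3 (monom W j) p T = eval2 W p * T ^ j"
  by (simp add: ev3_def map_poly_monom poly_monom)

lemma ev3_smult: "ev3 (smult W M) p T = eval2 W p * ev3 M p T"
proof -
  have "smult W M = [:W:] * M" by simp
  thus ?thesis by (simp only: ev3_simps) (simp add: ev3_pCons ev3_simps)
qed

lemma ev3_map_const2: "ev3 (map_poly const2 G) p T = poly G T"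
  by (simp add: ev3_def map_poly_map_poly o_def)

lemma pderiv_map_eval2: "pderiv (map_poly (\<lambda>W. eval2 W p) M) = map_poly (\<lambda>W. eval2 W p) (pderiv M)"
proof (rule poly_eqI)
  fix j
  have "eval2 (of_nat k * W) p = of_nat k * eval2 W p" for k W
    by (induction k) (simp_all add: algebra_simps comm_hom.hom_simps[OF comm_hom_eval2])
  thus "coeff (pderiv (map_poly (\<lambda>W. eval2 W p) M)) j = coeff (map_poly (\<lambda>W. eval2 W p) (pderiv M)) j"
    by (simp add: coeff_pderiv coeff_map_poly del: of_nat_Suc)
qed

locale lp_pair =
  fixes P Q :: "complex poly" and n :: nat
  assumes n_def: "n = max (degree P) (degree Q)" and n_pos: "0 < n"
begin

definition g :: "complex \<Rightarrow> complex \<times> complex" where "g z = (lp P z, lp Q z)"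

definition fib :: "complex \<Rightarrow> complex set" where "fib t = {s. s \<noteq> 0 \<and> g s = g t}"

lemma deg: "degree P \<le> n" "degree Q \<le> n" by (simp_all add: n_def)

lemmas top_nonzero = coeff_max_degree_nonzero[OF n_def n_pos]

lemma laur_g: "laur (\<lambda>t. eval2 W (g t))"
  unfolding g_def by (intro laur_eval2 laur_lp)

lemma laur_ev3: "laur (\<lambda>t. ev3 M (g t) t)"
  by (induction M) (auto simp: ev3_pCons ev3_simps intro!: laur_const laur_add laur_mult laur_g laur_ident)

lemma size_bound: "\<exists>K\<ge>1. \<forall>s t. s \<noteq> 0 \<longrightarrow> t \<noteq> 0 \<longrightarrow> g s = g t \<longrightarrow> sz s \<le> K * sz t"
  using top_nonzero lp_fibre_bound[OF deg(1) n_pos] lp_fibre_bound[OF deg(2) n_pos]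
  unfolding g_def by (metis prod.inject)

lemma finite_fib: "finite (fib t)"
proof -
  let ?p = "\<lambda>R. lp_num n R - smult (lp R t) (monom 1 n)"
  have root: "poly (?p R) s = 0" if "s \<noteq> 0" "lp R s = lp R t" "degree R \<le> n" for R s
    using that by (simp add: poly_lp_num poly_monom)
  have "coeff (?p P) (2 * n) \<noteq> 0 \<or> coeff (?p Q) (2 * n) \<noteq> 0"
    using top_nonzero n_pos by (simp add: coeff_lp_num_top)
  hence "?p P \<noteq> 0 \<or> ?p Q \<noteq> 0" by (metis coeff_0)
  hence "finite {s. poly (?p P) s = 0} \<or> finite {s. poly (?p Q) s = 0}" using poly_roots_finite by blast
  moreover have "fib t \<subseteq> {s. poly (?p P) s = 0}" "fib t \<subseteq> {s. poly (?p Q) s = 0}"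
    using root deg by (auto simp: fib_def g_def)
  ultimately show ?thesis using finite_subset by blast
qed

lemma fib_eq: "s \<in> fib t \<Longrightarrow> fib s = fib t"
  by (auto simp: fib_def)

text \<open>Fibres are finite, so the parameters sharing an image with one of finitely many
  exceptional ones are again finite in number.\<close>

lemma eventually_fib:
  assumes "MOST t. R t"
  shows "MOST t. t \<noteq> 0 \<and> (\<forall>s\<in>fib t. R s)"
proof -
  have "finite (\<Union>s\<in>{s. \<not> R s}. fib s)"
    using assms finite_fib by (auto simp: eventually_cofinite)
  moreover have "{t. \<not> (t = 0 \<or> (\<forall>s\<in>fib t. R s))} \<subseteq> (\<Union>s\<in>{s. \<not> R s}. fib s)"
    by (auto simp: fib_def)
  ultimately have "MOST t. t = 0 \<or> (\<forall>s\<in>fib t. R s)"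
    unfolding eventually_cofinite by (rule finite_subset[rotated])
  with eventually_nonzero show ?thesis by eventually_elim auto
qed

text \<open>Annihilating polynomials of the parameter. Their coefficients are plane polynomials, not
  reduced modulo those vanishing on the image; \<open>null\<close> detects the coefficients that are
  zero there.\<close>

definition kills :: "complex poly poly poly \<Rightarrow> bool" where
  "kills M \<longleftrightarrow> (\<forall>t. t \<noteq> 0 \<longrightarrow> ev3 M (g t) t = 0)"

definition null :: "complex poly poly \<Rightarrow> bool" where
  "null W \<longleftrightarrow> (\<forall>t. t \<noteq> 0 \<longrightarrow> eval2 W (g t) = 0)"

definition annihilator_degree :: "nat \<Rightarrow> bool" where
  "annihilator_degree k \<longleftrightarrow> (\<exists>M. degree M = k \<and> kills M \<and> \<not> null (lead_coeff M))"

text \<open>The degree of the parameter over the rational functions on the image; a leading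
  coefficient counts only if it is not \<open>null\<close>.\<close>

definition k :: nat where "k = (LEAST k. annihilator_degree k)"

definition rel1 :: "complex poly poly poly" where "rel1 = monom XX n - map_poly const2 (lp_num n P)"
definition rel2 :: "complex poly poly poly" where "rel2 = monom YY n - map_poly const2 (lp_num n Q)"

lemma ev3_rel: "ev3 rel1 p T = fst p * T ^ n - poly (lp_num n P) T"
  "ev3 rel2 p T = snd p * T ^ n - poly (lp_num n Q) T"
  by (simp_all add: rel1_def rel2_def ev3_simps ev3_monom ev3_map_const2)

lemma kills_rel: "kills rel1" "kills rel2"
  by (simp_all add: kills_def ev3_rel poly_lp_num deg g_def)

lemma annihilator_exists: "\<exists>k. annihilator_degree k"
proof -
  have *: "annihilator_degree (2 * n)"
    if "coeff R n \<noteq> 0" "degree R \<le> n" "kills (monom Z n - map_poly const2 (lp_num n R))" for R Z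
  proof -
    let ?M = "monom Z n - map_poly const2 (lp_num n R)"
    have c: "coeff ?M (2 * n) = const2 (- coeff R n)"
      using n_pos by (simp add: coeff_map_poly coeff_lp_num_top
          comm_hom.hom_uminus[OF comm_hom_const2])
    have nz: "\<not> null (const2 (- coeff R n))" using that(1) by (auto simp: null_def)
    hence "coeff ?M (2 * n) \<noteq> 0" using c by (auto simp: null_def eval2_def)
    moreover have "degree ?M \<le> 2 * n"
      by (rule degree_le) (use degree_lp_num[OF that(2)] in
          \<open>auto simp: coeff_map_poly coeff_eq_0\<close>)
    ultimately have "degree ?M = 2 * n" using le_degree by (metis le_antisym)
    thus ?thesis using that(3) nz c unfolding annihilator_degree_def by metis
  qed
  show ?thesis using top_nonzero *[OF _ deg(1)] *[OF _ deg(2)] kills_rel unfolding rel1_def rel2_def by blast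
qed

definition M :: "complex poly poly poly" where
  "M = (SOME M. degree M = k \<and> kills M \<and> \<not> null (lead_coeff M))"

lemma M: "degree M = k" "kills M" "\<not> null (coeff M k)"
proof -
  have "annihilator_degree k" unfolding k_def using annihilator_exists by (rule LeastI_ex)
  hence "\<exists>M. degree M = k \<and> kills M \<and> \<not> null (lead_coeff M)" by (simp only: annihilator_degree_def)
  from someI_ex[OF this, folded M_def] show "degree M = k" "kills M" "\<not> null (coeff M k)" by auto
qed

text \<open>By minimality of \<open>k\<close> the leading coefficient is null; removing its term
  preserves \<open>kills\<close> and lowers the degree.\<close>

lemma null_coeffs_if_kills:
  assumes "kills R" "R = 0 \<or> degree R < k"
  shows "null (coeff R j)"
  using assms
proof (induction "degree R" arbitrary: R j rule: less_induct)
  case less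
  show ?case
  proof (cases "R = 0")
    case True
    thus ?thesis by (simp add: null_def eval2_def)
  next
    case False
    hence d: "degree R < k" using less.prems by blast
    have "\<not> annihilator_degree (degree R)" using not_less_Least[of _ annihilator_degree] d unfolding k_def by blast
    hence lc: "null (lead_coeff R)" using less.prems(1) unfolding annihilator_degree_def by blast
    define R' where "R' = R - monom (lead_coeff R) (degree R)"
    have R': "coeff R' j = (if j = degree R then 0 else coeff R j)" for j by (simp add: R'_def)
    have "kills R'" using less.prems(1) lc by (auto simp: kills_def null_def R'_def ev3_simps ev3_monom)
    have "null (coeff R' j)"
    proof (cases "R' = 0")
      case True
      thus ?thesis by (simp add: null_def eval2_def)
    next
      case nz: False
      have "degree R' \<le> degree R" by (rule degree_le) (simp add: R' coeff_eq_0)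
      moreover have "degree R' \<noteq> degree R"
        using R'[of "degree R"] nz by (metis leading_coeff_0_iff)
      ultimately have "degree R' < degree R" by simp
      thus ?thesis by (rule less.hyps) (use \<open>kills R'\<close> d \<open>degree R' < degree R\<close> in auto)
    qed
    thus ?thesis using lc by (cases "j = degree R") (auto simp: R')
  qed
qed

lemma ev3_eq_0_if_null_coeffs:
  assumes "\<And>j. null (coeff R j)" "t \<noteq> 0"
  shows "ev3 R (g t) T = 0"
proof -
  have "map_poly (\<lambda>W. eval2 W (g t)) R = 0"
    by (rule poly_eqI) (use assms in \<open>simp add: coeff_map_poly null_def\<close>)
  thus ?thesis by (simp add: ev3_def)
qed

text \<open>Pseudo-division by \<open>M\<close> avoids inverting its leading coefficient. The
  remainder kills and has degree below \<open>k\<close>, so its coefficients vanish on the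
  image.\<close>

lemma root_of_killing:
  assumes "kills R" "t \<noteq> 0" "eval2 (coeff M k) (g t) \<noteq> 0" "ev3 M (g t) T = 0"
  shows "ev3 R (g t) T = 0"
proof -
  have nz: "M \<noteq> 0" using M(3) by (auto simp: null_def eval2_def)
  obtain q r where qr: "pseudo_divmod R M = (q, r)" by (cases "pseudo_divmod R M")
  define W where "W = coeff M (degree M) ^ (Suc (degree R) - degree M)"
  have eq: "smult W R = M * q + r" and r: "r = 0 \<or> degree r < degree M"
    using pseudo_divmod[OF nz qr] by (simp_all add: W_def)
  have eq': "eval2 W p * ev3 R p T = ev3 M p T * ev3 q p T + ev3 r p T" for p T
    using arg_cong[OF eq, of "\<lambda>M. ev3 M p T"] by (simp add: ev3_simps ev3_smult)
  have "kills r"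
    unfolding kills_def
  proof (intro allI impI)
    fix s :: complex assume "s \<noteq> 0"
    thus "ev3 r (g s) s = 0" using eq'[of "g s" s] assms(1) M(2) by (simp add: kills_def)
  qed
  hence "null (coeff r j)" for j using r M(1) by (intro null_coeffs_if_kills) auto
  hence "ev3 r (g t) T = 0" using assms(2) by (rule ev3_eq_0_if_null_coeffs)
  moreover have "eval2 W (g t) \<noteq> 0"
    using assms(3) M(1) by (simp add: W_def comm_hom.hom_power[OF comm_hom_eval2])
  ultimately show ?thesis using eq'[of "g t" T] assms(4) by simp
qed

text \<open>\<open>rel1\<close> and \<open>rel2\<close> cut out the fibre, and where the leading
  coefficient of \<open>M\<close> is nonzero every root of \<open>M\<close> satisfies them;
  conversely \<open>M\<close> vanishes at every point of the fibre because it kills.\<close>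

lemma roots_eq_fib:
  assumes "t \<noteq> 0" "eval2 (coeff M k) (g t) \<noteq> 0"
  shows "{T. ev3 M (g t) T = 0} = fib t"
proof (intro equalityI subsetI)
  fix T assume "T \<in> {T. ev3 M (g t) T = 0}"
  hence 0: "ev3 M (g t) T = 0" by simp
  have 1: "lp P t * T ^ n = poly (lp_num n P) T" "lp Q t * T ^ n = poly (lp_num n Q) T"
    using root_of_killing[OF kills_rel(1) assms 0] root_of_killing[OF kills_rel(2) assms 0]
    by (simp_all add: ev3_rel g_def)
  \<comment> \<open>\<open>lp_num\<close> at \<open>0\<close> is the conjugate of the coefficient at
    \<open>n\<close>, which is nonzero for \<open>P\<close> or for \<open>Q\<close>.\<close>
  have "T \<noteq> 0"
  proof
    assume "T = 0"
    thus False using 1 n_pos top_nonzero by (auto simp: poly_lp_num_0 zero_power)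
  qed
  thus "T \<in> fib t" using 1 deg by (simp add: fib_def g_def poly_lp_num)
next
  fix T assume "T \<in> fib t"
  hence "T \<noteq> 0" "g t = g T" by (auto simp: fib_def)
  thus "T \<in> {T. ev3 M (g t) T = 0}" using M(2) by (simp add: kills_def)
qed

lemma k_pos: "0 < k"
proof (rule ccontr)
  assume "\<not> 0 < k"
  hence "degree M = 0" using M(1) by simp
  then obtain W where W: "M = [:W:]" by (metis degree_0_id)
  have "null W" using M(2) by (simp add: W kills_def null_def ev3_pCons ev3_simps)
  thus False using M(3) \<open>\<not> 0 < k\<close> by (simp add: W)
qed

lemma eventually_lead_nonzero: "MOST t. eval2 (coeff M k) (g t) \<noteq> 0"
  using laur_cases[OF laur_g, of "coeff M k"] M(3) by (auto simp: null_def)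

text \<open>In characteristic zero the derivative has \<open>k\<close> times the leading coefficient
  of \<open>M\<close>, so by minimality it cannot kill. With \<open>eventually_fib\<close> this
  makes all roots over a general fibre simple.\<close>

lemma eventually_pderiv_nonzero: "MOST t. ev3 (pderiv M) (g t) t \<noteq> 0"
proof -
  have "\<not> kills (pderiv M)"
  proof
    assume "kills (pderiv M)"
    moreover have "degree (pderiv M) < k"
      using degree_pderiv[of M] M(1) k_pos by simp
    ultimately have "null (coeff (pderiv M) (k - 1))" by (intro null_coeffs_if_kills) auto
    moreover have "coeff (pderiv M) (k - 1) = of_nat k * coeff M k"
      using k_pos by (simp add: coeff_pderiv del: of_nat_Suc)
    moreover have "eval2 (of_nat k * coeff M k) p = of_nat k * eval2 (coeff M k) p" for p
      by (simp add: comm_hom.hom_mult[OF comm_hom_eval2]) (simp add: eval2_def)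
    ultimately show False using M(3) k_pos by (auto simp: null_def)
  qed
  thus ?thesis using laur_cases[OF laur_ev3, of "pderiv M"] by (auto simp: kills_def)
qed

text \<open>Over a general fibre the specialization of \<open>M\<close> is squarefree of degree
  \<open>k\<close> with the fibre as its roots, so its constant term yields the product.\<close>

lemma fib_card_prod:
  "MOST t. card (fib t) = k \<and>
     \<Prod>(fib t) = (- 1) ^ k * eval2 (coeff M 0) (g t) / eval2 (coeff M k) (g t)"
  using eventually_fib[OF eventually_pderiv_nonzero] eventually_lead_nonzero
proof eventually_elim
  case (elim t)
  define m where "m = map_poly (\<lambda>W. eval2 W (g t)) M"
  have cm: "coeff m j = eval2 (coeff M j) (g t)" for j
    by (simp add: m_def coeff_map_poly)
  have dm: "degree m = k"
  proof (rule antisym)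
    show "degree m \<le> k" by (rule degree_le) (use M(1) in \<open>simp add: cm coeff_eq_0 eval2_def\<close>)
    show "k \<le> degree m" by (rule le_degree) (use elim in \<open>simp add: cm\<close>)
  qed
  have roots: "{T. poly m T = 0} = fib t" using roots_eq_fib[of t] elim by (simp add: m_def ev3_def)
  have "m \<noteq> 0" using elim cm[of k] by auto
  have "rsquarefree m"
    unfolding rsquarefree_roots
  proof (intro allI notI, elim conjE)
    fix T assume T: "poly m T = 0" "poly (pderiv m) T = 0"
    hence "T \<in> fib t" using roots by blast
    hence "ev3 (pderiv M) (g T) T \<noteq> 0" "g T = g t" using elim by (auto simp: fib_def)
    moreover have "poly (pderiv m) T = ev3 (pderiv M) (g t) T" by (simp add: m_def pderiv_map_eval2 ev3_def)
    ultimately show False using T(2) by simp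
  qed
  from complex_poly_decompose_rsquarefree[OF this]
  have dec: "m = smult (lead_coeff m) (\<Prod>z\<in>fib t. [:- z, 1:])" by (simp add: roots)
  have "k = degree (\<Prod>z\<in>fib t. [:- z, 1:])" using dm dec \<open>m \<noteq> 0\<close> by (metis degree_smult_eq leading_coeff_0_iff)
  also have "\<dots> = card (fib t)" by (subst degree_prod_sum_eq) auto
  finally have card: "card (fib t) = k" ..
  have "coeff m 0 = poly m 0" by (simp add: poly_0_coeff_0)
  also have "\<dots> = coeff m k * (\<Prod>z\<in>fib t. - z)" by (subst dec) (simp add: poly_prod dm)
  also have "(\<Prod>z\<in>fib t. - z) = (- 1) ^ k * \<Prod>(fib t)"
    by (simp add: prod_uminus card)
  finally have "eval2 (coeff M 0) (g t) = eval2 (coeff M k) (g t) * ((- 1) ^ k * \<Prod>(fib t))" by (simp add: cm)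
  hence "(- 1) ^ k * eval2 (coeff M 0) (g t) / eval2 (coeff M k) (g t) = ((- 1) ^ k * (- 1) ^ k) * \<Prod>(fib t)"
    using elim by simp
  also have "(- 1) ^ k * (- 1) ^ k = (1 :: complex)" by (simp flip: power_add)
  finally show ?case using card by simp
qed

lemma rat_prod_fib: "rat (\<lambda>t. \<Prod>(fib t))"
proof -
  have "rat (\<lambda>t. (- 1) ^ k * eval2 (coeff M 0) (g t) / eval2 (coeff M k) (g t))"
    by (intro rat_divide rat_mult rat_const laur_rat laur_g)
  thus ?thesis by (rule rat_cong) (use fib_card_prod in \<open>auto elim!: eventually_mono\<close>)
qed

text \<open>Comparability of sizes keeps the norm of each point of the fibre between
  \<open>K * sz t\<close> and its inverse.\<close>

lemma prod_fib_bounds: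
  assumes "K \<ge> 1" "\<And>s t. s \<noteq> 0 \<Longrightarrow> t \<noteq> 0 \<Longrightarrow> g s = g t \<Longrightarrow> sz s \<le> K * sz t"
    and t: "t \<noteq> 0" "card (fib t) = k"
  shows "norm (\<Prod>(fib t)) \<le> (K * sz t) ^ k" "1 \<le> norm (\<Prod>(fib t)) * (K * sz t) ^ k"
proof -
  have pos: "K * sz t > 0" using assms(1) sz_ge_1[OF t(1)] by simp
  have s: "norm s \<le> K * sz t" "1 \<le> norm s * (K * sz t)" if "s \<in> fib t" for s
  proof -
    have st: "s \<noteq> 0" "sz s \<le> K * sz t" using that assms(2) t(1) by (auto simp: fib_def)
    show "norm s \<le> K * sz t" using sz_ge(1)[of s] st(2) by linarith
    have "1 = norm s * inverse (norm s)" using st by simp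
    also have "\<dots> \<le> norm s * (K * sz t)" using sz_ge(2)[of s] st(2) by (intro mult_left_mono) auto
    finally show "1 \<le> norm s * (K * sz t)" .
  qed
  have "norm (\<Prod>(fib t)) = (\<Prod>s\<in>fib t. norm s)" by (simp add: prod_norm)
  also have "\<dots> \<le> (\<Prod>s\<in>fib t. K * sz t)" by (rule prod_mono) (use s in auto)
  finally show "norm (\<Prod>(fib t)) \<le> (K * sz t) ^ k" using t(2) by simp
  have "1 \<le> (\<Prod>s\<in>fib t. norm s * (K * sz t))" by (rule prod_ge_1) (use s in auto)
  thus "1 \<le> norm (\<Prod>(fib t)) * (K * sz t) ^ k"
    using t(2) by (simp add: prod.distrib flip: prod_norm)
qed

text \<open>The bounds keep the product finite and nonzero near every \<open>z\<close> other than
  \<open>0\<close>, so in lowest terms neither numerator nor denominator vanishes there.\<close>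

lemma prod_fib_monomial:
  "\<exists>\<omega> a b. \<omega> \<noteq> 0 \<and> (a = 0 \<or> b = 0) \<and> (MOST t. \<Prod>(fib t) = \<omega> * t ^ a / t ^ b)"
proof -
  obtain K where K: "K \<ge> 1" "\<And>s t. s \<noteq> 0 \<Longrightarrow> t \<noteq> 0 \<Longrightarrow> g s = g t \<Longrightarrow> sz s \<le> K * sz t"
    using size_bound by blast
  obtain A E where AE: "E \<noteq> 0" "\<And>t. poly A t \<noteq> 0 \<or> poly E t \<noteq> 0"
    "MOST t. poly E t \<noteq> 0 \<and> \<Prod>(fib t) = poly A t / poly E t"
    using rat_coprime[OF rat_prod_fib] by blast
  have cont: "isCont (\<lambda>t. norm (poly p t)) z" "isCont (\<lambda>t. norm (poly p t) * (K * sz t) ^ k) z"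
    if "z \<noteq> 0" for p :: "complex poly" and z
    unfolding sz_def using that by (auto intro!: continuous_intros)
  \<comment> \<open>Multiplied out, the bounds become inequalities between continuous functions and
    extend from cofinitely many parameters to all nonzero ones.\<close>
  have 1: "MOST t. norm (poly A t) \<le> norm (poly E t) * (K * sz t) ^ k"
    using AE(3) fib_card_prod eventually_nonzero
  proof eventually_elim
    case (elim t)
    have "norm (\<Prod>(fib t)) \<le> (K * sz t) ^ k"
      by (rule prod_fib_bounds(1)[OF K(1)]) (use K(2) elim in auto)
    thus ?case using elim by (simp add: norm_divide field_simps)
  qed
  have 2: "MOST t. norm (poly E t) \<le> norm (poly A t) * (K * sz t) ^ k"
    using AE(3) fib_card_prod eventually_nonzero
  proof eventually_elim
    case (elim t)
    have "1 \<le> norm (\<Prod>(fib t)) * (K * sz t) ^ k"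
      by (rule prod_fib_bounds(2)[OF K(1)]) (use K(2) elim in auto)
    thus ?case using elim by (simp add: norm_divide field_simps)
  qed
  have "poly A z \<noteq> 0 \<and> poly E z \<noteq> 0" if "z \<noteq> 0" for z
    using le_if_cofinite_le[OF 1 cont[OF that]] le_if_cofinite_le[OF 2 cont[OF that]] AE(2)[of z] by auto
  hence nz: "z = 0" if "poly A z = 0 \<or> poly E z = 0" for z using that by blast
  have "A \<noteq> 0" using nz[of 1] by auto
  obtain \<alpha> a where a: "\<alpha> \<noteq> 0" "A = monom \<alpha> a" using only_zero_root_imp_monom[OF \<open>A \<noteq> 0\<close>] nz by blast
  obtain \<beta> b where b: "\<beta> \<noteq> 0" "E = monom \<beta> b" using only_zero_root_imp_monom[OF AE(1)] nz by blast
  have "a = 0 \<or> b = 0" using AE(2)[of 0] a b by (auto simp: poly_monom power_0_left split: if_splits)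
  moreover have "MOST t. \<Prod>(fib t) = (\<alpha> / \<beta>) * t ^ a / t ^ b"
    using AE(3) by eventually_elim (simp add: a b poly_monom)
  ultimately show ?thesis using a(1) b(1) by (intro exI[of _ "\<alpha> / \<beta>"]) auto
qed

lemma fib_reflect:
  assumes "norm t = 1" "s \<in> fib t"
  shows "inverse (cnj s) \<in> fib t"
  using assms lp_reflect[of P s] lp_reflect[of Q s] lp_circle[OF assms(1)]
  by (auto simp: fib_def g_def)

end

section \<open>Injectivity on the unit circle forces degree one\<close>

locale circle_injective = lp_pair +
  assumes inj: "finite {z. norm z = 1 \<and> (\<exists>w. norm w = 1 \<and> w \<noteq> z \<and> g w = g z)}"
begin

lemma circle_point:
  assumes "MOST t. R t"
  obtains t where "norm t = 1" "R t" "fib t \<inter> {z. norm z = 1} = {t}"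
proof -
  have "finite ({z. norm z = 1 \<and> (\<exists>w. norm w = 1 \<and> w \<noteq> z \<and> g w = g z)} \<union> {t. \<not> R t})"
    using inj assms by (simp add: eventually_cofinite)
  from Diff_infinite_finite[OF this infinite_circle]
  have "{z. norm z = 1} - ({z. norm z = 1 \<and> (\<exists>w. norm w = 1 \<and> w \<noteq> z \<and> g w = g z)} \<union> {t. \<not> R t}) \<noteq> {}"
    by (metis finite.emptyI)
  then obtain t where "norm t = 1" "R t" "\<And>w. norm w = 1 \<Longrightarrow> g w = g t \<Longrightarrow> w = t" by blast
  moreover from this have "fib t \<inter> {z. norm z = 1} = {t}" by (auto simp: fib_def)
  ultimately show ?thesis using that by blast
qed

text \<open>
  The fibre through a point of the unit circle is stable under reflection in the circle, which
  pairs off the points outside the circle.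
\<close>

lemma odd_k: "odd k"
proof -
  obtain t where t: "norm t = 1" "card (fib t) = k" "fib t \<inter> {z. norm z = 1} = {t}"
    by (rule circle_point[OF eventually_mono[OF fib_card_prod conjunct1]])
  let ?A = "{s \<in> fib t. norm s < 1}" and ?B = "{s \<in> fib t. norm s > 1}"
  have "bij_betw (\<lambda>s. inverse (cnj s)) ?A ?B"
  proof (rule bij_betw_byWitness[where f' = "\<lambda>s. inverse (cnj s)"])
    show "(\<lambda>s. inverse (cnj s)) ` ?A \<subseteq> ?B"
      using fib_reflect[OF t(1)] by (auto simp: norm_inverse fib_def one_less_inverse_iff)
    show "(\<lambda>s. inverse (cnj s)) ` ?B \<subseteq> ?A"
      using fib_reflect[OF t(1)] by (auto simp: norm_inverse fib_def inverse_less_1_iff)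
  qed auto
  hence AB: "card ?A = card ?B" by (rule bij_betw_same_card)
  have fib: "fib t = insert t (?A \<union> ?B)" using t(3) by force
  have "finite ?A" "finite ?B" using finite_fib by auto
  hence "card (insert t (?A \<union> ?B)) = Suc (card ?A + card ?B)"
    using t(1) by (subst card_insert_disjoint) (auto intro!: card_Un_disjoint)
  thus ?thesis using t(2) fib AB by simp
qed

text \<open>For a large parameter of norm \<open>s\<close> the fibre has \<open>a\<close> points of
  norm comparable to \<open>s\<close> and \<open>b\<close> points of norm comparable to
  \<open>1/s\<close>, so the product has size about \<open>s ^ a / s ^ b\<close>. Since
  \<open>a + b = k\<close> is odd, \<open>a\<close> and \<open>b\<close> differ.\<close>

lemma prod_fib_not_constant:
  assumes "\<omega> \<noteq> 0" "MOST t. \<Prod>(fib t) = \<omega>"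
  shows False
proof -
  obtain K where K: "K \<ge> 1" "\<And>s t. s \<noteq> 0 \<Longrightarrow> t \<noteq> 0 \<Longrightarrow> g s = g t \<Longrightarrow> sz s \<le> K * sz t"
    using size_bound by blast
  \<comment> \<open>The two final estimates bound \<open>s\<close> by
    \<open>norm \<omega> * K ^ k\<close> or by \<open>K ^ k / norm \<omega>\<close>; a parameter of
    norm above \<open>r\<close> contradicts both.\<close>
  define r where "r = max 1 (max (norm \<omega> * K ^ k) (K ^ k / norm \<omega>))"
  have "MOST t. \<Prod>(fib t) = \<omega> \<and> card (fib t) = k"
    using assms(2) fib_card_prod by eventually_elim simp
  hence "finite {t. \<not> (\<Prod>(fib t) = \<omega> \<and> card (fib t) = k)}" by (simp add: eventually_cofinite)
  moreover have "infinite (range (\<lambda>i :: nat. complex_of_real (r + 1 + i)))"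
    by (rule range_inj_infinite) (auto simp: inj_on_def)
  ultimately have "infinite (range (\<lambda>i :: nat. complex_of_real (r + 1 + i)) - {t. \<not> (\<Prod>(fib t) = \<omega> \<and> card (fib t) = k)})"
    by (rule Diff_infinite_finite)
  hence "range (\<lambda>i :: nat. complex_of_real (r + 1 + i)) - {t. \<not> (\<Prod>(fib t) = \<omega> \<and> card (fib t) = k)} \<noteq> {}"
    by (metis finite.emptyI)
  then obtain i :: nat and t where i: "t = complex_of_real (r + 1 + i)" "\<Prod>(fib t) = \<omega>" "card (fib t) = k" by auto
  define s where "s = norm t"
  have s: "s > r" "s > 1" unfolding s_def i(1) norm_of_real r_def by auto
  hence t0: "t \<noteq> 0" and szt: "sz t = s"
    by (auto simp: s_def sz_def max_def) (smt (verit) inverse_less_1_iff)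
  let ?A = "{z \<in> fib t. norm z \<ge> 1}" and ?B = "{z \<in> fib t. norm z < 1}"
  define a b where "a = card ?A" and "b = card ?B"
  have fin: "finite ?A" "finite ?B" using finite_fib by auto
  have un: "?A \<union> ?B = fib t" "?A \<inter> ?B = {}" by auto
  have ab: "a + b = k" using card_Un_disjoint[OF fin un(2)] un(1) i(3) by (simp add: a_def b_def)
  have K0: "K > 0" using K(1) by simp
  have bd: "sz z \<le> K * s" "s \<le> K * sz z" "z \<noteq> 0" if "z \<in> fib t" for z
    using K(2)[of z t] K(2)[of t z] that t0 by (auto simp: fib_def szt)
  have A: "s / K \<le> norm z" "norm z \<le> K * s" if "z \<in> ?A" for z
  proof -
    have "inverse (norm z) \<le> 1" using that by (simp add: inverse_le_1_iff)
    hence "sz z = norm z" using that by (auto simp: sz_def max_def)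
    thus "s / K \<le> norm z" "norm z \<le> K * s" using bd[of z] that K0 by (auto simp: field_simps)
  qed
  have B: "1 / (K * s) \<le> norm z" "norm z \<le> K / s" if "z \<in> ?B" for z
  proof -
    have z: "norm z > 0" using bd(3)[of z] that by auto
    hence "1 < inverse (norm z)" using that by (simp add: one_less_inverse_iff)
    hence "sz z = inverse (norm z)" using that by (auto simp: sz_def max_def)
    thus "1 / (K * s) \<le> norm z" "norm z \<le> K / s" using bd[of z] that K0 s z by (auto simp: field_simps)
  qed
  have "norm \<omega> = (\<Prod>z\<in>?A \<union> ?B. norm z)" unfolding un(1) i(2)[symmetric] by (simp add: prod_norm)
  also have "\<dots> = (\<Prod>z\<in>?A. norm z) * (\<Prod>z\<in>?B. norm z)" by (rule prod.union_disjoint[OF fin un(2)])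
  finally have w: "norm \<omega> = (\<Prod>z\<in>?A. norm z) * (\<Prod>z\<in>?B. norm z)" .
  have low: "(s / K) ^ a * (1 / (K * s)) ^ b \<le> norm \<omega>"
    unfolding w a_def b_def using A B K0 s
    by (subst (1 2) prod_constant[symmetric], intro mult_mono prod_mono) (auto intro!: prod_nonneg)
  have up: "norm \<omega> \<le> (K * s) ^ a * (K / s) ^ b"
    unfolding w a_def b_def using A B K0 s
    by (subst (1 2) prod_constant[symmetric], intro mult_mono prod_mono) (auto intro!: prod_nonneg)
  have "a \<noteq> b" using odd_k ab by (metis even_add)
  then consider d where "a = b + Suc d" | d where "b = a + Suc d"
    by (metis less_imp_Suc_add linorder_neqE_nat add_Suc_right)
  thus False
  proof cases
    case (1 d)
    have "s * 1 \<le> s * s ^ d" using s by (intro mult_left_mono) (auto simp: one_le_power)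
    also have "s * s ^ d = (s / K) ^ a * (1 / (K * s)) ^ b * K ^ k"
      unfolding ab[symmetric] 1 using s K0 by (simp add: power_add power_divide power_mult_distrib field_simps)
    also have "\<dots> \<le> norm \<omega> * K ^ k" using low K0 by (intro mult_right_mono) auto
    finally show False using s by (simp add: r_def)
  next
    case (2 d)
    have "norm \<omega> * s = norm \<omega> * s * 1" by simp
    also have "\<dots> \<le> norm \<omega> * s * s ^ d" using s by (intro mult_left_mono) (auto simp: one_le_power)
    also have "\<dots> \<le> ((K * s) ^ a * (K / s) ^ b) * s * s ^ d" using up s by (intro mult_right_mono) auto
    also have "\<dots> = K ^ k"
      unfolding ab[symmetric] 2 using s K0 by (simp add: power_add power_divide power_mult_distrib field_simps)
    finally have "s \<le> K ^ k / norm \<omega>" using assms(1) by (simp add: field_simps)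
    thus False using s by (simp add: r_def)
  qed
qed

lemma k_eq_1: "k = 1"
proof -
  obtain \<omega> a b where w: "\<omega> \<noteq> 0" "a = 0 \<or> b = 0" "MOST t. \<Prod>(fib t) = \<omega> * t ^ a / t ^ b"
    using prod_fib_monomial by blast
  have ab: "a + b \<noteq> 0"
  proof
    assume "a + b = 0"
    thus False using prod_fib_not_constant[OF w(1)] w(3) by simp
  qed
  \<comment> \<open>The formula for the product is required at every point of the fibre, not only at
    \<open>t\<close>: these points have the same fibre, so the values of the monomial agree.\<close>
  obtain t where t: "norm t = 1" "fib t \<inter> {z. norm z = 1} = {t}" "card (fib t) = k"
    "\<And>s. s \<in> fib t \<Longrightarrow> \<Prod>(fib s) = \<omega> * s ^ a / s ^ b"
    using circle_point[OF eventually_conj[OF eventually_fib[OF w(3)] fib_card_prod]] by metis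
  have tt: "t \<in> fib t" using t(1) by (auto simp: fib_def)
  have "norm s = 1" if s: "s \<in> fib t" for s
  proof -
    have s0: "norm s > 0" using s by (auto simp: fib_def)
    have "\<omega> * s ^ a / s ^ b = \<omega> * t ^ a / t ^ b" using t(4)[OF s] t(4)[OF tt] fib_eq[OF s] by simp
    hence "norm (\<omega> * s ^ a / s ^ b) = norm (\<omega> * t ^ a / t ^ b)" by simp
    hence "norm \<omega> * (norm s ^ a / norm s ^ b) = norm \<omega> * 1"
      using t(1) by (simp add: norm_mult norm_divide norm_power)
    hence "norm s ^ a / norm s ^ b = 1" using w(1) by (simp only: mult_cancel_left norm_eq_zero) blast
    hence "norm s ^ a = norm s ^ b" using s0 by (simp add: divide_eq_1_iff)
    hence "norm s ^ (a + b) = 1" using w(2) by (auto simp: power_add)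
    thus ?thesis using ab power_eq_iff_eq_base[of "a + b" "norm s" 1] by simp
  qed
  hence "fib t = {t}" using t(2) by auto
  thus ?thesis using t(3) by simp
qed

text \<open>For \<open>k = 1\<close> the annihilating polynomial is linear in the parameter and can
  be solved for it.\<close>

lemma inverse_on_image:
  "\<exists>N D. MOST t. eval2 D (g t) \<noteq> 0 \<and> eval2 N (g t) = t * eval2 D (g t)"
proof -
  obtain A B where AB: "M = pCons A B" by (cases M)
  have "degree B = 0" using M(1) k_eq_1 by (simp add: AB split: if_splits)
  then obtain D where D: "M = [:A, D:]" using AB by (metis degree_0_id)
  have "MOST t. eval2 D (g t) \<noteq> 0 \<and> eval2 (- A) (g t) = t * eval2 D (g t)"
    using eventually_lead_nonzero eventually_nonzero
  proof eventually_elim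
    case (elim t)
    have "ev3 M (g t) t = 0" using M(2) elim by (simp add: kills_def)
    thus ?case using elim
      by (simp add: D k_eq_1 ev3_pCons ev3_simps comm_hom.hom_uminus[OF comm_hom_eval2] eq_neg_iff_add_eq_0
          minus_equation_iff add.commute neg_eq_iff_add_eq_0)
  qed
  thus ?thesis by blast
qed

end

section \<open>From a trigonometric curve to a symmetric Laurent parametrization\<close>

lemma symmetric_parametrization_if_trigonometric:
  assumes C: "C = {p. eval2 F p = 0}" and "trigonometric C"
  shows "\<exists>P Q. birational_parametrization (- {0}) (\<lambda>z. (lp P z, lp Q z)) C"
proof -
  obtain X Y where XY: "trig_poly X" "trig_poly Y"
    "finite {t \<in> {0..<2*pi}. \<exists>s\<in>{0..<2*pi}. s \<noteq> t \<and> X s = X t \<and> Y s = Y t}"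
    "C = zariski_closure ((\<lambda>t. (complex_of_real (X t), complex_of_real (Y t))) ` {0..<2*pi})"
    using assms(2) unfolding trigonometric_def by blast
  obtain P Q where PQ: "X = (\<lambda>t. 2 * Re (poly P (cis t)))" "Y = (\<lambda>t. 2 * Re (poly Q (cis t)))"
    using XY(1,2) unfolding trig_poly_iff by blast
  let ?I = "{0..<2*pi}"
  define n where "n = max (degree P) (degree Q)"
  \<comment> \<open>For constant \<open>X\<close> and \<open>Y\<close> every parameter would share
    its image with another one, contrary to generic injectivity.\<close>
  have "0 < n"
  proof (rule ccontr)
    assume "\<not> 0 < n"
    hence "degree P = 0" "degree Q = 0" by (simp_all add: n_def)
    then obtain a b where "P = [:a:]" "Q = [:b:]" by (metis degree_0_id)
    hence XYc: "X t = X 0" "Y t = Y 0" for t by (simp_all add: PQ)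
    have "\<exists>s\<in>?I. s \<noteq> t \<and> X s = X t \<and> Y s = Y t" for t
    proof (rule bexI)
      show "(if t = 0 then pi else 0) \<in> ?I" using pi_gt_zero by auto
      show "(if t = 0 then pi else 0) \<noteq> t \<and> X (if t = 0 then pi else 0) = X t \<and>
          Y (if t = 0 then pi else 0) = Y t"
        using XYc(1)[of t] XYc(2)[of t] XYc(1)[of pi] XYc(2)[of pi] by auto
    qed
    hence "{t \<in> ?I. \<exists>s\<in>?I. s \<noteq> t \<and> X s = X t \<and> Y s = Y t} = ?I" by blast
    thus False using XY(3) infinite_Ico[of 0 "2 * pi"] by simp
  qed
  interpret lp_pair P Q n by unfold_locales (use \<open>0 < n\<close> in \<open>simp_all add: n_def\<close>)
  have gc: "g (cis t) = (complex_of_real (X t), complex_of_real (Y t))" for t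
    using lp_circle[of "cis t"] by (simp add: g_def PQ)
  have img: "(\<lambda>t. (complex_of_real (X t), complex_of_real (Y t))) ` ?I = g ` {z. norm z = 1}"
    unfolding cis_image_circle[symmetric] image_image gc ..
  interpret circle_injective P Q n
  proof
    have "{z. norm z = 1 \<and> (\<exists>w. norm w = 1 \<and> w \<noteq> z \<and> g w = g z)}
      \<subseteq> cis ` {t \<in> ?I. \<exists>s\<in>?I. s \<noteq> t \<and> X s = X t \<and> Y s = Y t}"
    proof (safe, goal_cases)
      case (1 z w)
      obtain t where t: "t \<in> ?I" "z = cis t" using cis_image_circle 1 by blast
      obtain s where s: "s \<in> ?I" "w = cis s" using cis_image_circle 1 by blast
      have "X s = X t" "Y s = Y t" using 1 by (simp_all add: s t gc)
      moreover have "s \<noteq> t" using s t 1 by auto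
      ultimately show ?case using s(1) t by (intro image_eqI[of _ _ t]) auto
    qed
    thus "finite {z. norm z = 1 \<and> (\<exists>w. norm w = 1 \<and> w \<noteq> z \<and> g w = g z)}"
      using XY(3) finite_subset by blast
  qed
  obtain N D where ND: "MOST t. eval2 D (g t) \<noteq> 0 \<and> eval2 N (g t) = t * eval2 D (g t)"
    using inverse_on_image by blast
  let ?f = "par (lp_num n P) (lp_num n Q) (monom 1 n)"
  have f: "?f z = g z" if "z \<noteq> 0" for z
    using that by (simp add: par_def g_def poly_lp_num deg poly_monom)
  have "gen_param C (lp_num n P) (lp_num n Q) (monom 1 n) N D"
  proof
    show "poly (lp_num n P) t \<noteq> 0 \<or> poly (lp_num n Q) t \<noteq> 0 \<or> poly (monom 1 n) t \<noteq> 0" for t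
      using top_nonzero n_pos by (cases "t = 0") (auto simp: poly_lp_num_0 poly_monom)
    show "MOST t. eval2 D (?f t) \<noteq> 0 \<and> eval2 N (?f t) = t * eval2 D (?f t)"
      using ND eventually_nonzero by eventually_elim (simp add: f)
    fix W
    \<comment> \<open>A polynomial vanishing on the image of the circle is, along the
      parametrization, a Laurent polynomial with infinitely many zeros. Hence the closure of the
      image of the circle and the image of the punctured plane have the same ideal.\<close>
    have "(\<forall>p\<in>C. eval2 W p = 0) \<longleftrightarrow> (\<forall>z. norm z = 1 \<longrightarrow> eval2 W (g z) = 0)"
    proof
      assume W: "\<forall>p\<in>C. eval2 W p = 0"
      have "g z \<in> C" if "norm z = 1" for z
        unfolding XY(4) img zariski_closure_def using that by blast
      thus "\<forall>z. norm z = 1 \<longrightarrow> eval2 W (g z) = 0" using W by blast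
    next
      assume "\<forall>z. norm z = 1 \<longrightarrow> eval2 W (g z) = 0"
      thus "\<forall>p\<in>C. eval2 W p = 0" unfolding XY(4) img zariski_closure_def by blast
    qed
    also have "\<dots> \<longleftrightarrow> null W"
    proof
      assume "\<forall>z. norm z = 1 \<longrightarrow> eval2 W (g z) = 0"
      hence "infinite {t. eval2 W (g t) = 0}" by (intro infinite_super[OF _ infinite_circle]) auto
      thus "null W" using laur_eq_0[OF laur_g] by (simp add: null_def)
    next
      assume "null W"
      thus "\<forall>z. norm z = 1 \<longrightarrow> eval2 W (g z) = 0"
        unfolding null_def by (metis norm_zero zero_neq_one)
    qed
    also have "\<dots> \<longleftrightarrow> (MOST t. eval2 W (?f t) = 0)"
    proof
      assume "null W"
      from eventually_nonzero show "MOST t. eval2 W (?f t) = 0"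
        by eventually_elim (use \<open>null W\<close> in \<open>simp add: null_def f\<close>)
    next
      assume "MOST t. eval2 W (?f t) = 0"
      with eventually_nonzero have ev: "MOST t. eval2 W (g t) = 0"
        by eventually_elim (simp add: f)
      have "\<not> (MOST t. eval2 W (g t) \<noteq> 0)"
      proof
        assume "MOST t. eval2 W (g t) \<noteq> 0"
        with ev have "MOST t :: complex. False" by eventually_elim simp
        thus False by (simp add: infinite_UNIV_char_0)
      qed
      with laur_cases[OF laur_g, of W] show "null W" unfolding null_def by blast
    qed
    finally show "(\<forall>p\<in>C. eval2 W p = 0) \<longleftrightarrow> (MOST t. eval2 W (?f t) = 0)" .
  qed simp
  hence "birational_parametrization (- {0}) (\<lambda>z. (lp P z, lp Q z)) C"
  proof (rule gen_param.birational[OF _ C])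
    show "- {0} = {t. poly (monom 1 n) t \<noteq> (0 :: complex)}" using n_pos by (auto simp: poly_monom)
  qed (auto simp: f g_def)
  thus ?thesis by blast
qed

theorem lemma4p13:
  fixes C :: "(complex \<times> complex) set"
  assumes "real_plane_curve C"
  shows "(trigonometric C \<longleftrightarrow>
            (\<exists>P Q :: complex poly. birational_parametrization (- {0})
               (\<lambda>\<phi>. (poly P \<phi> + poly (map_poly cnj P) (inverse \<phi>),
                     poly Q \<phi> + poly (map_poly cnj Q) (inverse \<phi>))) C)) \<and>
         ((\<exists>P Q :: complex poly. birational_parametrization (- {0})
               (\<lambda>\<phi>. (poly P \<phi> + poly (map_poly cnj P) (inverse \<phi>),
                     poly Q \<phi> + poly (map_poly cnj Q) (inverse \<phi>))) C) \<longleftrightarrow>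
            rational_curve C \<and>
            (\<exists>B. B \<noteq> conj_branch B \<and> branches_at_infinity C = {B, conj_branch B}) \<and>
            infinite (real_points C))"
proof -
  obtain F0 :: "real poly poly" where F0: "\<And>c. F0 \<noteq> [:[:c:]:]"
    "C = {p. eval2 (map_poly (map_poly complex_of_real) F0) p = 0}"
    using assms unfolding real_plane_curve_def by blast
  define F where "F = map_poly (map_poly complex_of_real) F0"
  have C: "C = {p. eval2 F p = 0}" using F0(2) by (simp add: F_def)
  have "F0 \<noteq> 0" using F0(1)[of 0] by simp
  hence "F \<noteq> 0" by (simp add: F_def map_poly_eq_0_iff)
  \<comment> \<open>Real coefficients are fixed by conjugation, which makes the zero set stable
    under it.\<close>
  have "map_poly (map_poly cnj) F = F"
    by (simp add: F_def map_poly_map_poly o_def)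
  hence cnj: "(cnj x, cnj y) \<in> C" if "(x, y) \<in> C" for x y
    using eval2_cnj[of F x y] that by (simp add: C)
  have sp: "\<exists>n N D. symmetric_param C F P Q n N D"
    if "birational_parametrization (- {0}) (\<lambda>z. (lp P z, lp Q z)) C" for P Q
    using symmetric_param_if_birational[OF C \<open>F \<noteq> 0\<close> that] .
  show ?thesis
    unfolding lp_def[symmetric]
  proof (intro conjI iffI; (elim exE conjE)?)
    assume "trigonometric C"
    thus "\<exists>P Q. birational_parametrization (- {0}) (\<lambda>z. (lp P z, lp Q z)) C"
      by (rule symmetric_parametrization_if_trigonometric[OF C])
  next
    fix P Q assume "birational_parametrization (- {0}) (\<lambda>z. (lp P z, lp Q z)) C"
    from sp[OF this] obtain n N D where "symmetric_param C F P Q n N D" by blast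
    thus "trigonometric C" using assms by (rule symmetric_param.trigonometric_if_real)
  next
    fix P Q assume "birational_parametrization (- {0}) (\<lambda>z. (lp P z, lp Q z)) C"
    thus "rational_curve C" unfolding rational_curve_def by blast
  next
    fix P Q assume "birational_parametrization (- {0}) (\<lambda>z. (lp P z, lp Q z)) C"
    from sp[OF this] obtain n N D where "symmetric_param C F P Q n N D" by blast
    thus "\<exists>B. B \<noteq> conj_branch B \<and> branches_at_infinity C = {B, conj_branch B}"
      by (rule symmetric_param.branches)
  next
    fix P Q assume "birational_parametrization (- {0}) (\<lambda>z. (lp P z, lp Q z)) C"
    from sp[OF this] obtain n N D where "symmetric_param C F P Q n N D" by blast
    thus "infinite (real_points C)" by (rule symmetric_param.infinite_real_points)
  next
    fix B assume "rational_curve C" "infinite (real_points C)" "B \<noteq> conj_branch B"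
      "branches_at_infinity C = {B, conj_branch B}"
    thus "\<exists>P Q. birational_parametrization (- {0}) (\<lambda>z. (lp P z, lp Q z)) C"
      by (intro symmetric_parametrization_if_two_conjugate_branches[OF C \<open>F \<noteq> 0\<close> cnj]) auto
  qed
qed

end
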